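(* Let $K\subset\mathbb{R}^n$ be a compact convex set whose interior contains the origin, with gauge function $\gamma$, polar $K^\circ$, and $\gamma^\circ$ the gauge function of $K^\circ$. Let $U\subset\mathbb{R}^n$ be a bounded open set with $C^1$ boundary, and let $\varphi:\mathbb{R}^n\to\mathbb{R}$ be a continuous function with $-\gamma(y-x)\le\varphi(x)-\varphi(y)\le\gamma(x-y)$ for all $x,y\in\mathbb{R}^n$. Suppose $F=F(z,p,M):\mathbb{R}\times\mathbb{R}^n\times\mathcal{S}^{n\times n}\to\mathbb{R}$ (not depending on $x$) satisfies the structure conditions and the second-order growth conditions defined in the context, and suppose there is $v\in C^{0}(\overline{U})\cap W_{\mathrm{loc}}^{2,n}(U)\cap W_{\bar{\rho},\rho}(U)$ that satisfies $F[v]\le0$ a.e. Let $u\in C^{1}(\overline{U})\cap W_{\mathrm{loc}}^{2,n}(U)\cap W_{\bar{\rho},\rho}(U)$ be a solution of the double obstacle problem $$\begin{cases}F[u]=0 & \text{a.e. in }\{-\bar{\rho}<u<\rho\},\\ F[u]\le0 & \text{a.e. on }\{u=\rho\},\\ F[u]\ge0 & \text{a.e. on }\{u=-\bar{\rho}\}.\end{cases}$$ Then $u$ also satisfies $$\begin{cases}\max\{F(u,Du,D^{2}u),\;H(Du)\}=0 & \text{a.e. in }U,\\ u=\varphi & \text{on }\partial U,\end{cases}$$ where $H=\gamma^\circ-1$.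
   Context: $\mathcal{S}^{n\times n}$ is the space of real symmetric $n\times n$ matrices, and $F[u]:=F(u,Du,D^2u)$. Convex analysis: $\gamma(x)=\gamma_K(x):=\inf\{\lambda>0:x\in\lambda K\}$, $K^\circ:=\{x:\langle x,y\rangle\le 1\text{ for all }y\in K\}$, $\gamma^\circ:=\gamma_{K^\circ}$. No regularity or strict convexity of $K$ or $K^\circ$ is assumed. Obstacles: $\rho(x):=\min_{y\in\partial U}[\gamma(x-y)+\varphi(y)]$ and $\bar\rho(x):=\min_{y\in\partial U}[\gamma(y-x)-\varphi(y)]$. $W_{\bar\rho,\rho}(U):=\{v\in W^{1,2}(U):-\bar\rho\le v\le\rho\text{ a.e., }v=\varphi\text{ on }\partial U\}$, with boundary equality in the sense of trace. Structure conditions on $F=F(z,p,M)$: $F$ is $C^1$ and (a) there are constants $\Lambda\ge\lambda>0$ such that $-\Lambda\,\mathrm{tr}(N)\le F(z,p,M+N)-F(z,p,M)\le-\lambda\,\mathrm{tr}(N)$ for all $z,p$ and all $M,N\in\mathcal{S}^{n\times n}$ with $N\ge0$; (b) for every $C>0$ there is $c_1=c_1(C)>0$ such that $|F(z,p,0)|\le c_1(1+|p|^2)$, $|F_z|\le c_1(1+|p|^2+|M|)$, $|F_p|\le c_1(1+|p|+|M|)$ for all $|z|\le C$, $p\in\mathbb{R}^n$, $M\in\mathcal{S}^{n\times n}$; (c) $F_z\ge0$; (d) $F$ is a convex function of $M$; (e) there is a constant $c_3>0$ with $F(z,p,0)\,\mathrm{sign}(z)\ge-c_3(1+|p|)$ for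 all $z,p$. Second-order growth conditions: $F$ is $C^2$, and for every $C>0$ there is $c_2=c_2(C)>0$ such that $|F_{Mz}|,|F_{Mp}|\le c_2$ and $|F_{pp}|,|F_{pz}|,|F_{zz}|\le c_2(1+|M|)$ for all $|z|,|p|\le C$ and $M\in\mathcal{S}^{n\times n}$. *)

theory Defs
  imports "HOL-Analysis.Analysis"
begin

section \<open>Convex analysis and obstacles\<close>

definition gauge_fun :: "(real^'n) set \<Rightarrow> real^'n \<Rightarrow> real" where
  "gauge_fun K x = Inf {l. l > 0 \<and> x \<in> (\<lambda>y. l *\<^sub>R y) ` K}"

definition polar_set :: "(real^'n) set \<Rightarrow> (real^'n) set" where
  "polar_set K = {x. \<forall>y\<in>K. x \<bullet> y \<le> 1}"

text \<open>For bounded open nonempty \<open>U\<close> and continuous data the infimum over the compact nonempty set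
  \<open>frontier U\<close> is attained, so it is the minimum.\<close>

definition upper_obstacle ::
  "(real^'n) set \<Rightarrow> (real^'n) set \<Rightarrow> (real^'n \<Rightarrow> real) \<Rightarrow> real^'n \<Rightarrow> real" where
  "upper_obstacle K U \<phi> x = (INF y\<in>frontier U. gauge_fun K (x - y) + \<phi> y)"

definition lower_obstacle ::
  "(real^'n) set \<Rightarrow> (real^'n) set \<Rightarrow> (real^'n \<Rightarrow> real) \<Rightarrow> real^'n \<Rightarrow> real" where
  "lower_obstacle K U \<phi> x = (INF y\<in>frontier U. gauge_fun K (y - x) - \<phi> y)"

section \<open>Classical differentiability\<close>

definition partial_deriv :: "'n \<Rightarrow> (real^'n \<Rightarrow> real) \<Rightarrow> real^'n \<Rightarrow> real" where
  "partial_deriv i f x = frechet_derivative f (at x) (axis i 1)"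

primrec Ck :: "nat \<Rightarrow> (real^'n \<Rightarrow> real) \<Rightarrow> bool" where
  "Ck 0 f \<longleftrightarrow> continuous_on UNIV f"
| "Ck (Suc k) f \<longleftrightarrow> f differentiable_on UNIV \<and> (\<forall>i. Ck k (partial_deriv i f))"

definition C1_closure :: "(real^'n) set \<Rightarrow> (real^'n \<Rightarrow> real) set" where
  "C1_closure U = {u. continuous_on (closure U) u \<and>
     (\<exists>G. continuous_on (closure U) G \<and> (\<forall>x\<in>U. (u has_derivative (\<lambda>h. G x \<bullet> h)) (at x)))}"

text \<open>Near each boundary point, \<open>U\<close> is the strict epigraph, in a direction \<open>e\<close>, of a \<open>C\<^sup>1\<close>
  function of the coordinates orthogonal to \<open>e\<close>. Such a function is encoded as one on the whole
  space that is invariant under translation along \<open>e\<close>.\<close>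

definition C1_boundary :: "(real^'n) set \<Rightarrow> bool" where
  "C1_boundary U \<longleftrightarrow> (\<forall>x0\<in>frontier U. \<exists>r>0. \<exists>e g. norm e = 1 \<and> Ck 1 g \<and>
     (\<forall>x t. g (x + t *\<^sub>R e) = g x) \<and> U \<inter> ball x0 r = {x \<in> ball x0 r. x \<bullet> e > g x})"

section \<open>Weak derivatives and Sobolev spaces\<close>

definition test_functions :: "(real^'n) set \<Rightarrow> (real^'n \<Rightarrow> real) set" where
  "test_functions U = {\<psi>. (\<forall>k. Ck k \<psi>) \<and> compact (closure {x. \<psi> x \<noteq> 0}) \<and> closure {x. \<psi> x \<noteq> 0} \<subseteq> U}"

definition Lp :: "nat \<Rightarrow> (real^'n) set \<Rightarrow> (real^'n \<Rightarrow> real) set" where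
  "Lp p U = {f \<in> borel_measurable (lebesgue_on U). integrable (lebesgue_on U) (\<lambda>x. \<bar>f x\<bar> ^ p)}"

definition Lp_loc :: "nat \<Rightarrow> (real^'n) set \<Rightarrow> (real^'n \<Rightarrow> real) set" where
  "Lp_loc p U = {f. \<forall>C. compact C \<and> C \<subseteq> U \<longrightarrow> f \<in> Lp p C}"

definition has_weak_deriv ::
  "(real^'n) set \<Rightarrow> 'n \<Rightarrow> (real^'n \<Rightarrow> real) \<Rightarrow> (real^'n \<Rightarrow> real) \<Rightarrow> bool" where
  "has_weak_deriv U i u g \<longleftrightarrow> u \<in> Lp_loc 1 U \<and> g \<in> Lp_loc 1 U \<and>
     (\<forall>\<psi>\<in>test_functions U.
        (LINT x|lebesgue_on U. u x * partial_deriv i \<psi> x) = - (LINT x|lebesgue_on U. g x * \<psi> x))"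

text \<open>Weak derivatives are unique up to null sets; \<open>weak_deriv\<close> fixes a representative. It is used
  below only in statements that hold almost everywhere and under integrals.\<close>

definition weak_deriv :: "(real^'n) set \<Rightarrow> 'n \<Rightarrow> (real^'n \<Rightarrow> real) \<Rightarrow> real^'n \<Rightarrow> real" where
  "weak_deriv U i u = (SOME g. has_weak_deriv U i u g)"

definition weak_grad :: "(real^'n) set \<Rightarrow> (real^'n \<Rightarrow> real) \<Rightarrow> real^'n \<Rightarrow> real^'n" where
  "weak_grad U u x = (\<chi> i. weak_deriv U i u x)"

definition weak_hessian :: "(real^'n) set \<Rightarrow> (real^'n \<Rightarrow> real) \<Rightarrow> real^'n \<Rightarrow> real^'n^'n" where
  "weak_hessian U u x = (\<chi> i j. weak_deriv U j (weak_deriv U i u) x)"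

text \<open>All weak partial derivatives of \<open>u\<close> on \<open>U\<close> of order at most \<open>k\<close> exist and lie in \<open>X\<close>.\<close>

primrec weakly_diff ::
  "nat \<Rightarrow> (real^'n \<Rightarrow> real) set \<Rightarrow> (real^'n) set \<Rightarrow> (real^'n \<Rightarrow> real) \<Rightarrow> bool" where
  "weakly_diff 0 X U u \<longleftrightarrow> u \<in> X"
| "weakly_diff (Suc k) X U u \<longleftrightarrow>
     u \<in> X \<and> (\<forall>i. \<exists>g. has_weak_deriv U i u g \<and> weakly_diff k X U g)"

definition sobolev :: "nat \<Rightarrow> nat \<Rightarrow> (real^'n) set \<Rightarrow> (real^'n \<Rightarrow> real) set" where
  "sobolev k p U = {u. weakly_diff k (Lp p U) U u}"

definition sobolev_loc :: "nat \<Rightarrow> nat \<Rightarrow> (real^'n) set \<Rightarrow> (real^'n \<Rightarrow> real) set" where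
  "sobolev_loc k p U = {u. weakly_diff k (Lp_loc p U) U u}"

definition W12_norm :: "(real^'n) set \<Rightarrow> (real^'n \<Rightarrow> real) \<Rightarrow> real" where
  "W12_norm U u = sqrt ((LINT x|lebesgue_on U. (u x)\<^sup>2) +
     (\<Sum>i\<in>UNIV. LINT x|lebesgue_on U. (weak_deriv U i u x)\<^sup>2))"

section \<open>Traces\<close>

text \<open>Hausdorff measure of dimension \<open>s\<close>. Only bounded covering sets are allowed because
  \<^const>\<open>diameter\<close> is meaningless otherwise; empty ones must not contribute when \<open>s = 0\<close>.\<close>

definition hausdorff_pre :: "nat \<Rightarrow> real \<Rightarrow> (real^'n) set \<Rightarrow> ennreal" where
  "hausdorff_pre s \<delta> A =
     (INF C\<in>{C :: nat \<Rightarrow> (real^'n) set. A \<subseteq> (\<Union>i. C i) \<and> (\<forall>i. bounded (C i) \<and> diameter (C i) \<le> \<delta>)}.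
        \<Sum>i. if C i = {} then 0 else ennreal (unit_ball_vol (real s) * (diameter (C i) / 2) ^ s))"

definition hausdorff_measure :: "nat \<Rightarrow> (real^'n) measure" where
  "hausdorff_measure s = measure_of UNIV (sets borel) (\<lambda>A. SUP \<delta>\<in>{0<..}. hausdorff_pre s \<delta> A)"

definition surface_measure :: "(real^'n) set \<Rightarrow> (real^'n) measure" where
  "surface_measure U = restrict_space (hausdorff_measure (CARD('n) - 1)) (frontier U)"

text \<open>For bounded \<open>U\<close> with \<open>C\<^sup>1\<close> boundary the trace operator from \<open>W\<^sup>1\<^sup>,\<^sup>2(U)\<close> to \<open>L\<^sup>2(\<partial>U)\<close> is the extension
  by continuity of the restriction \<open>w \<mapsto> w|\<partial>U\<close> from the dense subspace of functions that are \<open>C\<^sup>1\<close>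
  up to the boundary; \<open>has_trace U v g\<close> says that its value at \<open>v\<close> is (the class of) \<open>g\<close>.\<close>

definition has_trace ::
  "(real^'n) set \<Rightarrow> (real^'n \<Rightarrow> real) \<Rightarrow> (real^'n \<Rightarrow> real) \<Rightarrow> bool" where
  "has_trace U v g \<longleftrightarrow> v \<in> sobolev 1 2 U \<and> g \<in> borel_measurable (surface_measure U) \<and>
     (\<exists>w :: nat \<Rightarrow> real^'n \<Rightarrow> real. (\<forall>k. w k \<in> C1_closure U) \<and>
        (\<lambda>k. W12_norm U (\<lambda>x. w k x - v x)) \<longlonglongrightarrow> 0 \<and>
        (\<lambda>k. \<integral>\<^sup>+x. ennreal ((w k x - g x)\<^sup>2) \<partial>surface_measure U) \<longlonglongrightarrow> 0)"

definition W_obstacle ::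
  "(real^'n) set \<Rightarrow> (real^'n) set \<Rightarrow> (real^'n \<Rightarrow> real) \<Rightarrow> (real^'n \<Rightarrow> real) set" where
  "W_obstacle K U \<phi> = {v \<in> sobolev 1 2 U.
     (AE x in lebesgue_on U. - lower_obstacle K U \<phi> x \<le> v x \<and> v x \<le> upper_obstacle K U \<phi> x) \<and>
     has_trace U v \<phi>}"

section \<open>The operator\<close>

text \<open>A function on \<open>\<real> \<times> \<real>\<^sup>n \<times> S\<close>, with \<open>S\<close> the symmetric matrices, is represented by a function
  on all matrices whose values outside \<open>S\<close> are never constrained.\<close>

definition sym_mats :: "(real^'n^'n) set" where
  "sym_mats = {M. transpose M = M}"

definition psd_mats :: "(real^'n^'n) set" where
  "psd_mats = {N \<in> sym_mats. \<forall>x. 0 \<le> x \<bullet> (N *v x)}"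

definition C1_on :: "'a::real_normed_vector set \<Rightarrow> ('a \<Rightarrow> real) \<Rightarrow> bool" where
  "C1_on D f \<longleftrightarrow> (\<exists>f' :: 'a \<Rightarrow> 'a \<Rightarrow>\<^sub>L real.
     (\<forall>x\<in>D. (f has_derivative blinfun_apply (f' x)) (at x within D)) \<and> continuous_on D f')"

definition C2_on :: "'a::real_normed_vector set \<Rightarrow> ('a \<Rightarrow> real) \<Rightarrow> bool" where
  "C2_on D f \<longleftrightarrow> (\<exists>(f' :: 'a \<Rightarrow> 'a \<Rightarrow>\<^sub>L real) (f'' :: 'a \<Rightarrow> 'a \<Rightarrow>\<^sub>L ('a \<Rightarrow>\<^sub>L real)).
     (\<forall>x\<in>D. (f has_derivative blinfun_apply (f' x)) (at x within D)) \<and>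
     (\<forall>x\<in>D. (f' has_derivative blinfun_apply (f'' x)) (at x within D)) \<and> continuous_on D f'')"

type_synonym 'n op_fun = "real \<Rightarrow> real^'n \<Rightarrow> real^'n^'n \<Rightarrow> real"

definition D_z :: "'n::finite op_fun \<Rightarrow> real \<Rightarrow> real^'n \<Rightarrow> real^'n^'n \<Rightarrow> real" where
  "D_z F z p M = deriv (\<lambda>t. F t p M) z"

definition D_p :: "'n::finite op_fun \<Rightarrow> real \<Rightarrow> real^'n \<Rightarrow> real^'n^'n \<Rightarrow> real^'n" where
  "D_p F z p M = (\<chi> i. partial_deriv i (\<lambda>q. F z q M) p)"

text \<open>\<open>sym_unit i j\<close> is the symmetric part of the matrix unit \<open>E\<^sub>i\<^sub>j\<close>; hence \<open>D_M\<close> is the gradient on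
  the space of symmetric matrices with respect to the Frobenius inner product.\<close>

definition sym_unit :: "'n \<Rightarrow> 'n \<Rightarrow> real^'n^'n" where
  "sym_unit i j = (1/2) *\<^sub>R (axis i (axis j 1) + axis j (axis i 1))"

definition D_M :: "'n::finite op_fun \<Rightarrow> real \<Rightarrow> real^'n \<Rightarrow> real^'n^'n \<Rightarrow> real^'n^'n" where
  "D_M F z p M = (\<chi> i j. deriv (\<lambda>t. F z p (M + t *\<^sub>R sym_unit i j)) 0)"

definition structure_conditions :: "'n::finite op_fun \<Rightarrow> bool" where
  "structure_conditions F \<longleftrightarrow>
     C1_on (UNIV \<times> UNIV \<times> sym_mats) (\<lambda>(z, p, M). F z p M) \<and>
     (\<exists>\<theta> \<Theta>. 0 < \<theta> \<and> \<theta> \<le> \<Theta> \<and> (\<forall>z p. \<forall>M\<in>sym_mats. \<forall>N\<in>psd_mats.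
        - \<Theta> * trace N \<le> F z p (M + N) - F z p M \<and> F z p (M + N) - F z p M \<le> - \<theta> * trace N)) \<and>
     (\<forall>C>0. \<exists>c\<^sub>1>0. \<forall>z p. \<forall>M\<in>sym_mats. \<bar>z\<bar> \<le> C \<longrightarrow>
        \<bar>F z p 0\<bar> \<le> c\<^sub>1 * (1 + (norm p)\<^sup>2) \<and>
        \<bar>D_z F z p M\<bar> \<le> c\<^sub>1 * (1 + (norm p)\<^sup>2 + norm M) \<and>
        norm (D_p F z p M) \<le> c\<^sub>1 * (1 + norm p + norm M)) \<and>
     (\<forall>z p. \<forall>M\<in>sym_mats. D_z F z p M \<ge> 0) \<and>
     (\<forall>z p. convex_on sym_mats (F z p)) \<and>
     (\<exists>c\<^sub>3>0. \<forall>z p. F z p 0 * sgn z \<ge> - c\<^sub>3 * (1 + norm p))"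

definition second_order_growth :: "'n::finite op_fun \<Rightarrow> bool" where
  "second_order_growth F \<longleftrightarrow>
     C2_on (UNIV \<times> UNIV \<times> sym_mats) (\<lambda>(z, p, M). F z p M) \<and>
     (\<forall>C>0. \<exists>c\<^sub>2>0. \<forall>z p. \<forall>M\<in>sym_mats. \<bar>z\<bar> \<le> C \<and> norm p \<le> C \<longrightarrow>
        norm (vector_derivative (\<lambda>t. D_M F t p M) (at z)) \<le> c\<^sub>2 \<and>
        onorm (frechet_derivative (\<lambda>q. D_M F z q M) (at p)) \<le> c\<^sub>2 \<and>
        onorm (frechet_derivative (\<lambda>q. D_p F z q M) (at p)) \<le> c\<^sub>2 * (1 + norm M) \<and>
        norm (vector_derivative (\<lambda>t. D_p F t p M) (at z)) \<le> c\<^sub>2 * (1 + norm M) \<and>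
        \<bar>deriv (\<lambda>t. D_z F t p M) z\<bar> \<le> c\<^sub>2 * (1 + norm M))"

text \<open>\<open>F[u]\<close>. The weak Hessian is symmetric almost everywhere.\<close>

definition op_apply ::
  "'n::finite op_fun \<Rightarrow> (real^'n) set \<Rightarrow> (real^'n \<Rightarrow> real) \<Rightarrow> real^'n \<Rightarrow> real" where
  "op_apply F U u x = F (u x) (weak_grad U u x) (weak_hessian U u x)"

definition solves_double_obstacle ::
  "'n::finite op_fun \<Rightarrow> (real^'n) set \<Rightarrow> (real^'n) set \<Rightarrow> (real^'n \<Rightarrow> real) \<Rightarrow> (real^'n \<Rightarrow> real) \<Rightarrow> bool"
where
  "solves_double_obstacle F K U \<phi> u \<longleftrightarrow>
     (AE x in lebesgue_on U.
        - lower_obstacle K U \<phi> x < u x \<and> u x < upper_obstacle K U \<phi> x \<longrightarrow> op_apply F U u x = 0) \<and>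
     (AE x in lebesgue_on U. u x = upper_obstacle K U \<phi> x \<longrightarrow> op_apply F U u x \<le> 0) \<and>
     (AE x in lebesgue_on U. u x = - lower_obstacle K U \<phi> x \<longrightarrow> op_apply F U u x \<ge> 0)"

definition H_fun :: "(real^'n) set \<Rightarrow> real^'n \<Rightarrow> real" where
  "H_fun K p = gauge_fun (polar_set K) p - 1"

end

theory Submission
  imports Defs
begin

text \<open>
  Write \<open>\<sigma> \<le> u \<le> \<rho>\<close> for the two obstacle constraints. Since \<open>\<phi>\<close> is 1-Lipschitz for the gauge, \<open>\<sigma> = \<phi> = \<rho>\<close> on
  the boundary, which already gives the boundary values of \<open>u\<close>. Everything else rests on a comparison principle
  for strong solutions in \<open>W\<^sup>2\<^sup>,\<^sup>n\<close>, which follows from the Alexandrov--Bakelman--Pucci argument: small slopes at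
  which a function \<open>w\<close> with a positive interior maximum has a concave contact point fill a ball, whereas the area
  formula and the inequality \<open>tr(-D\<^sup>2w) \<le> \<beta> |Dw|\<close> with \<open>\<beta> \<in> L\<^sup>n\<close> bound the measure of an annulus
  of such slopes of radius \<open>s\<close> by \<open>o(s\<^sup>n)\<close>.

  Comparing \<open>u(x + h) - \<gamma>(h)\<close> with \<open>u(x)\<close> on \<open>U \<inter> (U - h)\<close> gives \<open>u(x + h) - u(x) \<le> \<gamma>(h)\<close>, hence \<open>H(Du) \<le> 0\<close>:
  where the first function is larger, \<open>u < \<rho>\<close> at \<open>x\<close> and \<open>u > \<sigma>\<close> at \<open>x + h\<close>. Moving from a contact point straight
  towards the point of \<open>\<partial>U\<close> realizing the obstacle shows \<open>H(Du) \<ge> 0\<close> there. Finally \<open>v \<le> u\<close> by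
  comparison, so \<open>u = v\<close> where \<open>u = \<sigma>\<close>, and there \<open>D\<^sup>2u = D\<^sup>2v\<close> a.e. and \<open>F[u] = F[v] \<le> 0\<close>.
\<close>

text \<open>The contact argument needs classical second derivatives, while \<open>w\<close> is only
  in W^{2,n}; so it is run for mollifications and the integral inequality is passed to the limit.
  Contact sets need not converge, but bounds on the gradient and semidefiniteness of the Hessian are
  closed conditions: the limit superior of the integrands stays below the limiting integrand, which
  is the direction required. No fixed function dominates the mollified Hessians; Jensen's inequality
  dominates their n-th powers by functions that converge in L^1, and this suffices. Slopes are taken
  from an annulus to keep away from slope zero. After division by s^n there remains the integral of
  \<beta>^n over {0 < |Dw| \<le> s}. These sets shrink to the empty set, so neither the norm of
  \<beta> nor the size of the domain has to be small. Translates of \<open>u\<close> may be compared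
  with \<open>u\<close> because F does not depend on x, and monotonicity in z lets a positive
  constant be subtracted. The function \<open>v\<close> supplies the sign that the obstacle problem
  does not give: on {u = \<sigma>} the problem only says F[u] \<ge> 0.\<close>

section \<open>Area inequality\<close>

text \<open>The area formula of the library needs a well-ordered index type; it is transported from a
  well-ordered copy of the given finite one.\<close>

typedef 'a wo = "UNIV :: 'a set" ..

instance wo :: (finite) finite
proof
  have "range Abs_wo = (UNIV :: 'a wo set)"
    by (metis Rep_wo_inverse surjI)
  then show "finite (UNIV :: 'a wo set)"
    by (metis finite finite_imageI)
qed

text \<open>Any injection into the naturals will do; only the order pulled back along it is
  wanted.\<close>

definition wo_index :: "'a::finite wo \<Rightarrow> nat" where
  "wo_index x = (SOME f :: 'a \<Rightarrow> nat. inj f) (Rep_wo x)"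

lemma inj_wo_index: "inj (wo_index :: 'a::finite wo \<Rightarrow> nat)"
proof -
  have "\<exists>f :: 'a \<Rightarrow> nat. inj f"
    using finite_imp_inj_to_nat_seg[OF finite[of "UNIV :: 'a set"]] by metis
  then have "inj (SOME f :: 'a \<Rightarrow> nat. inj f)"
    by (rule someI_ex)
  then show ?thesis
    by (intro injI) (auto simp: wo_index_def Rep_wo_inject dest: injD)
qed

instantiation wo :: (finite) wellorder
begin

definition less_eq_wo :: "'a wo \<Rightarrow> 'a wo \<Rightarrow> bool" where
  "less_eq_wo x y \<longleftrightarrow> wo_index x \<le> wo_index y"

definition less_wo :: "'a wo \<Rightarrow> 'a wo \<Rightarrow> bool" where
  "less_wo x y \<longleftrightarrow> wo_index x < wo_index y"

instance
proof
  fix P :: "'a wo \<Rightarrow> bool" and a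
  assume *: "\<And>x. (\<And>y. y < x \<Longrightarrow> P y) \<Longrightarrow> P x"
  show "P a"
    by (induction a rule: measure_induct_rule[of wo_index]) (rule *, simp add: less_wo_def)
qed (use inj_wo_index in \<open>auto simp: less_eq_wo_def less_wo_def inj_def\<close>)

end

definition to_wo :: "real^'n \<Rightarrow> real^('n::finite wo)" where
  "to_wo x = (\<chi> i. x $ Rep_wo i)"

definition of_wo :: "real^('n::finite wo) \<Rightarrow> real^'n" where
  "of_wo y = (\<chi> i. y $ Abs_wo i)"

lemma bij_Rep_wo: "bij (Rep_wo :: 'n wo \<Rightarrow> 'n)"
  by (metis Abs_wo_inverse Rep_wo_inverse UNIV_I bijI')

lemma of_to_wo [simp]: "of_wo (to_wo x) = x" "to_wo (of_wo y) = y"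
  by (simp_all add: of_wo_def to_wo_def vec_eq_iff Abs_wo_inverse Rep_wo_inverse)

lemma linear_to_wo: "linear to_wo" and linear_of_wo: "linear of_wo"
  by (auto intro!: linearI simp: of_wo_def to_wo_def vec_eq_iff)

lemma card_wo: "CARD('n::finite wo) = CARD('n)"
  using bij_betw_same_card[OF bij_Rep_wo] .

lemma continuous_on_to_wo: "continuous_on A to_wo" and continuous_on_of_wo: "continuous_on B of_wo"
  by (simp_all add: linear_continuous_on linear_linear linear_to_wo linear_of_wo)

lemma prod_Basis_vec:
  fixes f :: "real^'n \<Rightarrow> real"
  shows "prod f Basis = (\<Prod>i\<in>UNIV. f (axis i 1))"
proof -
  have "bij_betw (\<lambda>i :: 'n. axis i (1::real)) UNIV Basis"
    by (auto simp: bij_betw_def inj_on_def axis_eq_axis Basis_vec_def)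
  then show ?thesis
    by (metis (no_types, lifting) prod.cong prod.reindex_bij_betw)
qed

text \<open>Relabelling coordinates maps boxes to boxes with the same side lengths, and the values
  on boxes characterize \<open>lborel\<close>.\<close>

lemma lborel_distr_of_wo: "distr lborel borel of_wo = (lborel :: (real^'n::finite) measure)"
proof (rule lborel_eqI[symmetric])
  fix l u :: "real^'n"
  assume le: "\<And>b. b \<in> Basis \<Longrightarrow> l \<bullet> b \<le> u \<bullet> b"
  have le': "l $ i \<le> u $ i" for i
    using le[of "axis i 1"] by (auto simp: inner_axis Basis_vec_def)
  have "of_wo -` box l u = box (to_wo l) (to_wo u)"
  proof -
    have "(\<forall>i. l $ i < y $ Abs_wo i \<and> y $ Abs_wo i < u $ i) \<longleftrightarrow>
          (\<forall>i. l $ Rep_wo i < y $ i \<and> y $ i < u $ Rep_wo i)" for y :: "real^('n wo)"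
      by (metis Abs_wo_inverse Rep_wo_inverse UNIV_I)
    then show ?thesis
      by (auto simp: mem_box_cart of_wo_def to_wo_def)
  qed
  then have "emeasure (distr lborel borel of_wo) (box l u) = emeasure lborel (box (to_wo l) (to_wo u))"
    by (subst emeasure_distr)
      (auto intro!: borel_measurable_continuous_onI continuous_on_of_wo)
  also have "\<dots> = ennreal (\<Prod>b\<in>Basis. (to_wo u - to_wo l) \<bullet> b)"
    using le' by (intro emeasure_lborel_box)
      (auto simp: Basis_vec_def inner_axis to_wo_def)
  also have "(\<Prod>b\<in>Basis. (to_wo u - to_wo l) \<bullet> b) = (\<Prod>i\<in>UNIV. (to_wo u - to_wo l) $ i)"
    by (simp add: prod_Basis_vec inner_axis)
  also have "\<dots> = (\<Prod>i\<in>UNIV. (u - l) $ i)"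
    unfolding to_wo_def using prod.reindex_bij_betw[OF bij_Rep_wo, of "\<lambda>i. u $ i - l $ i"] by simp
  also have "\<dots> = (\<Prod>b\<in>Basis. (u - l) \<bullet> b)"
    by (simp add: prod_Basis_vec inner_axis)
  finally show "emeasure (distr lborel borel of_wo) (box l u) = ennreal (\<Prod>b\<in>Basis. (u - l) \<bullet> b)" .
qed simp

text \<open>Leibniz's expansion has n! terms, each a product of n entries. Only the order
  \<open>b ^ n\<close> matters later, so the factorial is harmless.\<close>

lemma abs_det_le: "\<bar>det (A :: real^'n^'n)\<bar> \<le> fact CARD('n) * b ^ CARD('n)"
  if "\<And>i j. \<bar>A $ i $ j\<bar> \<le> b"
proof -
  have "\<bar>det A\<bar> \<le> (\<Sum>p\<in>{p. p permutes UNIV}. \<bar>of_int (sign p) * (\<Prod>i\<in>UNIV. A $ i $ p i)\<bar>)"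
    unfolding det_def by (rule sum_abs)
  also have "\<dots> \<le> (\<Sum>p\<in>{p :: 'n \<Rightarrow> 'n. p permutes UNIV}. b ^ CARD('n))"
  proof (rule sum_mono)
    fix p :: "'n \<Rightarrow> 'n"
    have "\<bar>of_int (sign p) * (\<Prod>i\<in>UNIV. A $ i $ p i)\<bar> = (\<Prod>i\<in>UNIV. \<bar>A $ i $ p i\<bar>)"
      by (simp add: abs_mult abs_prod sign_def)
    also have "\<dots> \<le> (\<Prod>i\<in>(UNIV :: 'n set). b)"
      using that by (intro prod_mono) auto
    finally show "\<bar>of_int (sign p) * (\<Prod>i\<in>UNIV. A $ i $ p i)\<bar> \<le> b ^ CARD('n)"
      by simp
  qed
  also have "\<dots> = fact CARD('n) * b ^ CARD('n)"
    by (simp add: card_permutations)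
  finally show ?thesis .
qed

lemma matrix_entry_le_norm: "\<bar>(A :: real^'n^'m) $ i $ j\<bar> \<le> norm A"
  by (metis Finite_Cartesian_Product.norm_nth_le component_le_norm_cart order_trans)

text \<open>The area inequality gives the integral of the absolute Jacobian determinant, which is
  then majorized entrywise. The n-th power of the norm is the form in which Jensen's inequality
  later controls mollified Hessians.\<close>

lemma measure_image_le:
  fixes f :: "real^'n \<Rightarrow> real^'n" and M :: "real^'n \<Rightarrow> real^'n^'n"
  assumes "compact S" and cont: "continuous_on S M"
    and der: "\<And>x. x \<in> S \<Longrightarrow> (f has_derivative (\<lambda>h. M x *v h)) (at x)"
  shows "measure lborel (f ` S) \<le>
    fact CARD('n) * (LINT x|lborel. indicator S x * norm (M x) ^ CARD('n))"
proof -
  let ?S = "to_wo ` S" and ?g = "to_wo \<circ> f \<circ> of_wo"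
  define g' where "g' = (\<lambda>y h. to_wo (M (of_wo y) *v of_wo h))"
  have S': "compact ?S"
    by (intro compact_continuous_image continuous_on_to_wo assms(1))
  have "continuous_on S f"
    by (meson der differentiable_imp_continuous_within continuous_at_imp_continuous_on differentiableI)
  then have fS: "compact (f ` S)"
    using assms(1) compact_continuous_image by blast
  have ofS: "of_wo ` ?S = S"
    by (force simp: image_image)
  have contM: "continuous_on ?S (\<lambda>y. M (of_wo y))"
    by (rule continuous_on_compose2[OF cont continuous_on_of_wo]) (use ofS in auto)
  have der': "(?g has_derivative g' y) (at y within ?S)" if "y \<in> ?S" for y
  proof -
    have "of_wo y \<in> S" using that ofS by auto
    have "bounded_linear (to_wo :: real^'n \<Rightarrow> _)" "bounded_linear (of_wo :: _ \<Rightarrow> real^'n)"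
      using linear_to_wo linear_of_wo linear_conv_bounded_linear by blast+
    then have *: "(of_wo has_derivative of_wo) (at y within ?S)"
      "(to_wo has_derivative to_wo) (at (f (of_wo y)))"
      by (auto intro: bounded_linear_imp_has_derivative)
    have "((\<lambda>y. f (of_wo y)) has_derivative (\<lambda>h. M (of_wo y) *v of_wo h)) (at y within ?S)"
      by (rule has_derivative_compose[OF *(1) der[OF \<open>of_wo y \<in> S\<close>]])
    from has_derivative_compose[OF this *(2)] show ?thesis
      by (simp add: g'_def o_def)
  qed
  \<comment> \<open>The transported Jacobian has the same entries at relabelled places, so its
    entries are bounded by the norm of \<open>M\<close>.\<close>
  have entry: "matrix (g' y) $ i $ j = M (of_wo y) $ Rep_wo i $ Rep_wo j" for y i j
  proof -
    have "of_wo (axis j 1 :: real^('n wo)) = axis (Rep_wo j) 1"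
      by (simp add: of_wo_def vec_eq_iff axis_def) (metis Abs_wo_inverse Rep_wo_inverse UNIV_I)
    then show ?thesis
      by (simp add: matrix_def g'_def to_wo_def matrix_vector_mult_basis column_def)
  qed
  have entry_le: "\<bar>matrix (g' y) $ i $ j\<bar> \<le> norm (M (of_wo y))" for y i j
    unfolding entry by (rule matrix_entry_le_norm)
  have cont_det: "continuous_on ?S (\<lambda>y. det (matrix (g' y)))"
    unfolding det_def entry by (intro continuous_intros contM)
  have aint: "h absolutely_integrable_on ?S" if "continuous_on ?S h" for h :: "real^'n wo \<Rightarrow> real"
    using borel_integrable_compact[OF S' that]
    by (simp add: set_integrable_def integrable_completion)
  have "measure lebesgue (?g ` ?S) \<le> integral ?S (\<lambda>y. \<bar>det (matrix (g' y))\<bar>)"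
    using S' der' by (intro measure_differentiable_image)
      (auto intro!: aint[THEN set_lebesgue_integral_eq_integral(1)] continuous_intros cont_det
        simp: lmeasurable_compact fmeasurableD)
  also have "\<dots> \<le> integral ?S (\<lambda>y. fact CARD('n) * norm (M (of_wo y)) ^ CARD('n))"
    using abs_det_le[OF entry_le] card_wo[where ?'n='n]
    by (intro integral_le aint[THEN set_lebesgue_integral_eq_integral(1)] continuous_intros cont_det contM)
      auto
  also have "\<dots> = (LINT y:?S|lebesgue. fact CARD('n) * norm (M (of_wo y)) ^ CARD('n))"
    by (intro set_lebesgue_integral_eq_integral(2)[symmetric] aint continuous_intros contM)
  also have "\<dots> = (LINT y|lborel. indicator ?S y *\<^sub>R (fact CARD('n) * norm (M (of_wo y)) ^ CARD('n)))"
    unfolding set_lebesgue_integral_def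
    by (intro integral_completion borel_measurable_integrable borel_integrable_compact S'
        continuous_intros contM)
  also have "\<dots> = (LINT y|lborel. indicator S (of_wo y) * (fact CARD('n) * norm (M (of_wo y)) ^ CARD('n)))"
    by (intro Bochner_Integration.integral_cong) (auto simp: indicator_def image_iff, metis of_to_wo(2))
  also have "\<dots> = (LINT x|distr lborel borel of_wo. indicator S x * (fact CARD('n) * norm (M x) ^ CARD('n)))"
  proof (rule integral_distr[symmetric])
    show "of_wo \<in> lborel \<rightarrow>\<^sub>M (borel :: (real^'n) measure)"
      by (simp add: borel_measurable_continuous_onI continuous_on_of_wo)
    show "(\<lambda>x. indicator S x * (fact CARD('n) * norm (M x) ^ CARD('n))) \<in> borel_measurable borel"
    proof -
      have "integrable lborel (\<lambda>x. indicator S x *\<^sub>R (fact CARD('n) * norm (M x) ^ CARD('n)))"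
        by (intro borel_integrable_compact assms(1) continuous_intros cont)
      then show ?thesis
        by (auto dest!: borel_measurable_integrable)
    qed
  qed
  also have "\<dots> = fact CARD('n) * (LINT x|lborel. indicator S x * norm (M x) ^ CARD('n))"
    unfolding lborel_distr_of_wo by (simp add: mult.left_commute)
  finally have le: "measure lebesgue (?g ` ?S) \<le>
    fact CARD('n) * (LINT x|lborel. indicator S x * norm (M x) ^ CARD('n))" .
  have gS: "?g ` ?S = to_wo ` (f ` S)"
    by (simp add: image_image)
  have "measure lborel (f ` S) = measure (distr lborel borel of_wo) (f ` S)"
    by (simp add: lborel_distr_of_wo)
  also have "\<dots> = measure lborel (of_wo -` (f ` S))"
    using fS by (subst measure_distr)
      (auto intro!: borel_measurable_continuous_onI continuous_on_of_wo borel_compact)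
  also have "of_wo -` (f ` S) = to_wo ` (f ` S)"
    by (auto simp: image_iff) (metis of_to_wo(2))
  also have "measure lborel (to_wo ` (f ` S)) = measure lebesgue (?g ` ?S)"
    unfolding gS using fS compact_continuous_image[OF continuous_on_to_wo fS]
    by (simp add: borel_compact)
  finally show ?thesis using le by simp
qed

section \<open>A smooth compactly supported kernel\<close>

text \<open>Differentiating \<open>exp (- (1/t))\<close> produces powers of \<open>1/t\<close>. With
  the factor \<open>1 / t ^ m\<close> built in, the derivative of each \<open>flat m\<close> is a
  combination of other members of the family.\<close>

definition flat :: "nat \<Rightarrow> real \<Rightarrow> real" where
  "flat m t = (if t > 0 then exp (- (1/t)) / t ^ m else 0)"

lemma flat_nonneg: "flat m t \<ge> 0"
  by (simp add: flat_def)

lemma flat_pos: "t > 0 \<Longrightarrow> flat m t > 0"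
  by (simp add: flat_def)

lemma flat_nonpos: "t \<le> 0 \<Longrightarrow> flat m t = 0"
  by (simp add: flat_def)

lemma flat_has_derivative:
  "(flat m has_real_derivative flat (m + 2) t - real m * flat (m + 1) t) (at t)"
proof -
  consider "t > 0" | "t < 0" | "t = 0" by linarith
  then show ?thesis
  proof cases
    case 1
    have "((\<lambda>t. exp (- (1/t)) / t ^ m) has_real_derivative flat (m + 2) t - real m * flat (m + 1) t) (at t)"
    proof (cases m)
      case 0
      then show ?thesis
        using 1 by (auto intro!: derivative_eq_intros simp: flat_def field_simps power2_eq_square)
    next
      case (Suc k)
      show ?thesis
        unfolding Suc using 1
        by (auto intro!: derivative_eq_intros simp: flat_def divide_simps power2_eq_square)
          (cases k; auto simp: algebra_simps)
    qed
    then show ?thesis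
      by (rule has_field_derivative_transform_within_open[of _ _ _ "{0<..}"]) (use 1 in \<open>auto simp: flat_def\<close>)
  next
    case 2
    have "((\<lambda>t. 0) has_real_derivative flat (m + 2) t - real m * flat (m + 1) t) (at t)"
      using 2 by (auto simp: flat_def)
    then show ?thesis
      by (rule has_field_derivative_transform_within_open[of _ _ _ "{..<0}"]) (use 2 in \<open>auto simp: flat_def\<close>)
  next
    case 3
    \<comment> \<open>In the variable \<open>inverse h\<close> the quotient is a power divided by an
      exponential.\<close>
    have "((\<lambda>h. flat m h / h) \<longlongrightarrow> 0) (at_right 0)"
    proof (rule Lim_transform_eventually)
      show "((\<lambda>h::real. inverse h ^ (m + 1) / exp (inverse h)) \<longlongrightarrow> 0) (at_right 0)"
        by (rule filterlim_compose[OF tendsto_power_div_exp_0 filterlim_inverse_at_top_right])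
      show "\<forall>\<^sub>F h::real in at_right 0. inverse h ^ (m + 1) / exp (inverse h) = flat m h / h"
        unfolding eventually_at_right_field
        by (intro exI[of _ 1]) (auto simp: flat_def exp_minus field_simps)
    qed
    moreover have "((\<lambda>h. flat m h / h) \<longlongrightarrow> 0) (at_left 0)"
      by (rule Lim_transform_eventually[OF tendsto_const])
        (auto simp: eventually_at_left_field flat_nonpos intro!: exI[of _ "-1"])
    ultimately have "((\<lambda>h. flat m h / h) \<longlongrightarrow> 0) (at 0)"
      using filterlim_split_at by blast
    then show ?thesis
      using 3 by (simp add: DERIV_def flat_nonpos)
  qed
qed

lemma partial_deriv_eq:
  "(f has_derivative (\<lambda>h. G \<bullet> h)) (at x) \<Longrightarrow> partial_deriv i f x = G $ i"
  by (simp add: partial_deriv_def frechet_derivative_at[symmetric] inner_axis)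

text \<open>This family is closed under partial differentiation, so its members are smooth.\<close>

inductive flat_fam :: "(real^'n \<Rightarrow> real) \<Rightarrow> bool" where
  flat: "flat_fam (\<lambda>x. flat m (R - (x - a) \<bullet> (x - a)))"
| scale: "flat_fam f \<Longrightarrow> flat_fam (\<lambda>x. c * f x)"
| coord: "flat_fam f \<Longrightarrow> flat_fam (\<lambda>x. x $ i * f x)"
| add: "flat_fam f \<Longrightarrow> flat_fam g \<Longrightarrow> flat_fam (\<lambda>x. f x + g x)"

lemma flat_radial_derivative:
  fixes a :: "real^'n"
  shows "((\<lambda>x. flat m (R - (x - a) \<bullet> (x - a))) has_derivative
    (\<lambda>h. ((flat (m + 2) (R - (x - a) \<bullet> (x - a)) - real m * flat (m + 1) (R - (x - a) \<bullet> (x - a))) *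
      (-2)) *\<^sub>R (x - a) \<bullet> h)) (at x)"
proof -
  have "((\<lambda>x. R - (x - a) \<bullet> (x - a)) has_derivative (\<lambda>h. - 2 * ((x - a) \<bullet> h))) (at x)"
    by (auto intro!: derivative_eq_intros simp: inner_commute algebra_simps)
  from has_derivative_compose[OF this flat_has_derivative[unfolded has_field_derivative_def]]
  show ?thesis
    by (simp add: algebra_simps)
qed

lemma flat_fam_derivative:
  assumes "flat_fam f"
  shows "\<exists>G. (\<forall>x. (f has_derivative (\<lambda>h. G x \<bullet> h)) (at x)) \<and> (\<forall>i. flat_fam (\<lambda>x. G x $ i))"
  using assms
proof induction
  case (flat m R a)
  let ?r = "\<lambda>x. R - (x - a) \<bullet> (x - a)"
  let ?G = "\<lambda>x. ((flat (m + 2) (?r x) - real m * flat (m + 1) (?r x)) * (-2)) *\<^sub>R (x - a)"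
  have "flat_fam (\<lambda>x. ?G x $ i)" for i
  proof -
    have *: "flat_fam (\<lambda>x. flat (m + 2) (?r x) + (- real m) * flat (m + 1) (?r x))" (is "flat_fam ?f")
      by (intro flat_fam.intros)
    have "flat_fam (\<lambda>x. (-2) * (x $ i * ?f x) + (2 * a $ i) * ?f x)"
      by (intro flat_fam.scale flat_fam.add flat_fam.coord *)
    then show ?thesis
      by (rule back_subst[of flat_fam]) (simp add: algebra_simps)
  qed
  then show ?case
    by (intro exI[of _ ?G] conjI allI flat_radial_derivative)
next
  case (scale f c)
  then obtain G where "\<forall>x. (f has_derivative (\<lambda>h. G x \<bullet> h)) (at x)" "\<forall>i. flat_fam (\<lambda>x. G x $ i)"
    by blast
  then show ?case
    by (intro exI[of _ "\<lambda>x. c *\<^sub>R G x"])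
      (auto intro!: flat_fam.scale derivative_eq_intros)
next
  case (coord f j)
  then obtain G where G: "\<forall>x. (f has_derivative (\<lambda>h. G x \<bullet> h)) (at x)" "\<forall>i. flat_fam (\<lambda>x. G x $ i)"
    by blast
  let ?G = "\<lambda>x. x $ j *\<^sub>R G x + f x *\<^sub>R axis j 1"
  have "((\<lambda>x. x $ j * f x) has_derivative (\<lambda>h. ?G x \<bullet> h)) (at x)" for x
    using G(1) by (auto intro!: derivative_eq_intros bounded_linear_imp_has_derivative bounded_linear_vec_nth
        simp: inner_add_left inner_axis' algebra_simps)
  moreover have "flat_fam (\<lambda>x. ?G x $ i)" for i
  proof -
    have "flat_fam (\<lambda>x. x $ j * G x $ i + (axis j 1 $ i) * f x)"
      using G(2) coord by (intro flat_fam.intros) auto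
    then show ?thesis
      by (rule back_subst[of flat_fam]) (simp add: algebra_simps)
  qed
  ultimately show ?case by (intro exI[of _ ?G]) blast
next
  case (add f g)
  then obtain F G where "\<forall>x. (f has_derivative (\<lambda>h. F x \<bullet> h)) (at x)" "\<forall>i. flat_fam (\<lambda>x. F x $ i)"
    "\<forall>x. (g has_derivative (\<lambda>h. G x \<bullet> h)) (at x)" "\<forall>i. flat_fam (\<lambda>x. G x $ i)"
    by blast
  then show ?case
    by (intro exI[of _ "\<lambda>x. F x + G x"])
      (auto intro!: flat_fam.add derivative_eq_intros simp: inner_add_left)
qed

lemma Ck_flat_fam: "flat_fam f \<Longrightarrow> Ck k f"
proof (induction k arbitrary: f)
  case 0
  then obtain G where "\<forall>x. (f has_derivative (\<lambda>h. G x \<bullet> h)) (at x)"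
    using flat_fam_derivative by blast
  then show ?case
    by (auto intro!: continuous_at_imp_continuous_on has_derivative_continuous)
next
  case (Suc k)
  then obtain G where G: "\<forall>x. (f has_derivative (\<lambda>h. G x \<bullet> h)) (at x)" "\<forall>i. flat_fam (\<lambda>x. G x $ i)"
    using flat_fam_derivative by blast
  then have "partial_deriv i f = (\<lambda>x. G x $ i)" for i
    using partial_deriv_eq by blast
  then show ?case
    using G Suc.IH by (auto simp: differentiable_on_def differentiable_def)
qed

text \<open>The type argument carries the dimension, which \<open>r\<close> alone does not
  determine.\<close>

definition bump_mass :: "'n::finite itself \<Rightarrow> real \<Rightarrow> real" where
  "bump_mass _ r = (LINT y|lborel. flat 0 (r\<^sup>2 - y \<bullet> (y :: real^'n)))"

definition mker :: "real \<Rightarrow> real^'n \<Rightarrow> real" where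
  "mker r x = flat 0 (r\<^sup>2 - x \<bullet> x) / bump_mass TYPE('n) r"

text \<open>The gradient of \<open>mker r\<close>: \<open>flat 2\<close> is the derivative of
  \<open>flat 0\<close>, and the inner function \<open>r\<^sup>2 - x \<bullet> x\<close> contributes
  \<open>-2 x\<close>.\<close>

definition gker :: "real \<Rightarrow> real^'n \<Rightarrow> real^'n" where
  "gker r x = (flat 2 (r\<^sup>2 - x \<bullet> x) * (-2) / bump_mass TYPE('n) r) *\<^sub>R x"

lemma inner_ge_square: "r > 0 \<Longrightarrow> norm x \<ge> r \<Longrightarrow> r\<^sup>2 - x \<bullet> x \<le> 0"
  by (simp add: dot_square_norm power_mono)

lemma continuous_flat: "continuous_on A (flat m)"
  using flat_has_derivative by (meson DERIV_continuous continuous_at_imp_continuous_on)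

lemma integrable_compact_support:
  fixes f :: "real^'n \<Rightarrow> 'b::{banach, second_countable_topology}"
  assumes "continuous_on UNIV f" "\<And>x. norm x \<ge> r \<Longrightarrow> f x = 0"
  shows "integrable lborel f"
proof -
  have "integrable lborel (\<lambda>x. indicator (cball 0 r) x *\<^sub>R f x)"
    using assms(1) by (intro borel_integrable_compact) (auto intro: continuous_on_subset)
  moreover have "(\<lambda>x. indicator (cball 0 r) x *\<^sub>R f x) = f"
    using assms(2) by (auto simp: fun_eq_iff indicator_def)
  ultimately show ?thesis by simp
qed

lemma bump_mass_pos:
  assumes "r > 0"
  shows "bump_mass TYPE('n::finite) r > 0"
proof -
  let ?f = "\<lambda>y :: real^'n. flat 0 (r\<^sup>2 - y \<bullet> y)"
  have cont: "continuous_on UNIV ?f"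
    by (rule continuous_on_compose2[OF continuous_flat[of UNIV]]) (auto intro!: continuous_intros)
  have int: "integrable lborel ?f"
    by (intro integrable_compact_support[of _ r] cont flat_nonpos inner_ge_square assms)
  have "bump_mass TYPE('n) r \<noteq> 0"
  proof
    assume "bump_mass TYPE('n) r = 0"
    then have "AE y in lborel. ?f y = 0"
      unfolding bump_mass_def
      by (subst integral_nonneg_eq_0_iff_AE[OF int, symmetric]) (auto simp: flat_nonneg)
    then have "AE y in lborel. y \<notin> ball (0::real^'n) r"
    proof eventually_elim
      case (elim y)
      have False if "norm y < r"
      proof -
        have "(norm y)\<^sup>2 < r\<^sup>2" using that by (intro power_strict_mono) auto
        then have "?f y > 0" by (intro flat_pos) (simp add: dot_square_norm)
        with elim show False by simp
      qed
      then show ?case by auto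
    qed
    then have "ball (0::real^'n) r \<in> null_sets lborel"
      by (subst AE_iff_null_sets) auto
    then have "measure lborel (ball (0::real^'n) r) = 0"
      by (simp add: measure_def null_setsD1)
    moreover have "measure lborel (ball (0::real^'n) r) > 0"
      using content_ball_pos[OF assms, of "0::real^'n"] by simp
    ultimately show False by simp
  qed
  moreover have "bump_mass TYPE('n) r \<ge> 0"
    unfolding bump_mass_def by (intro integral_nonneg_AE) (auto simp: flat_nonneg)
  ultimately show ?thesis by linarith
qed

context
  fixes r :: real
  assumes r: "r > 0"
begin

lemma mker_nonneg: "mker r (x :: real^'n) \<ge> 0"
  using bump_mass_pos[OF r, where ?'n='n] by (simp add: mker_def flat_nonneg)

lemma mker_eq_0: "norm x \<ge> r \<Longrightarrow> mker r x = 0"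
  by (simp add: mker_def flat_nonpos[OF inner_ge_square[OF r]])

lemma gker_eq_0: "norm x \<ge> r \<Longrightarrow> gker r x = 0"
  by (simp add: gker_def flat_nonpos[OF inner_ge_square[OF r]])

lemma continuous_mker: "continuous_on A (mker r)"
  unfolding mker_def
  by (intro continuous_intros continuous_on_compose2[OF continuous_flat[of UNIV]])
    (auto simp: bump_mass_pos[OF r] less_imp_neq[symmetric])

lemma continuous_gker: "continuous_on A (gker r)"
  unfolding gker_def
  by (intro continuous_intros continuous_on_compose2[OF continuous_flat[of UNIV]])
    (auto simp: bump_mass_pos[OF r] less_imp_neq[symmetric])

lemma integrable_mker: "integrable lborel (mker r :: real^'n \<Rightarrow> real)"
  using continuous_mker mker_eq_0 by (rule integrable_compact_support)

lemma integral_mker: "(LINT x|lborel. mker r (x :: real^'n)) = 1"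
  using bump_mass_pos[OF r, where ?'n='n] by (simp add: mker_def bump_mass_def)

lemma mker_minus: "mker r (- x) = mker r x"
  by (simp add: mker_def)

lemma mker_has_derivative: "(mker r has_derivative (\<lambda>h. gker r x \<bullet> h)) (at (x :: real^'n))"
proof -
  have "((\<lambda>x :: real^'n. (1 / bump_mass TYPE('n) r) * flat 0 (r\<^sup>2 - (x - 0) \<bullet> (x - 0))) has_derivative
    (\<lambda>h. (1 / bump_mass TYPE('n) r) *
      ((flat 2 (r\<^sup>2 - (x - 0) \<bullet> (x - 0)) * (-2)) *\<^sub>R (x - 0) \<bullet> h))) (at x)"
    using flat_radial_derivative[of 0 "r\<^sup>2" 0 x]
    by (intro has_derivative_mult_right) (simp add: numeral_2_eq_2)
  then show ?thesis
    by (simp add: mker_def[abs_def] gker_def)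
qed

lemma flat_fam_mker_shift: "flat_fam (\<lambda>y :: real^'n. mker r (x - y))"
proof -
  have "flat_fam (\<lambda>y. (1 / bump_mass TYPE('n) r) * flat 0 (r\<^sup>2 - (y - x) \<bullet> (y - x)))"
    by (intro flat_fam.intros)
  then show ?thesis
    by (rule back_subst[of flat_fam]) (simp add: mker_def dot_square_norm norm_minus_commute)
qed

lemma partial_deriv_mker_shift: "partial_deriv i (\<lambda>y. mker r (x - y)) y = - gker r (x - y) $ i"
proof -
  have "((\<lambda>y. mker r (x - y)) has_derivative (\<lambda>h. gker r (x - y) \<bullet> (- h))) (at y)"
    by (rule has_derivative_compose[OF _ mker_has_derivative]) (auto intro!: derivative_eq_intros)
  then show ?thesis
    using partial_deriv_eq[of _ "- gker r (x - y)" y i] by simp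
qed

text \<open>Symmetry of the Hessian of a radial function, read off from its explicit form: a
  multiple of the identity plus a multiple of the dyadic square of \<open>x - y\<close>. The
  symmetry of weak Hessians rests on it.\<close>

lemma partial_deriv_gker_shift_sym:
  fixes x y :: "real^'n"
  shows "partial_deriv j (\<lambda>y. gker r (x - y) $ i) y = partial_deriv i (\<lambda>y. gker r (x - y) $ j) y"
proof -
  let ?c = "-2 / bump_mass TYPE('n) r"
  define A where "A = (\<lambda>y. flat 2 (r\<^sup>2 - (y - x) \<bullet> (y - x)))"
  \<comment> \<open>The difference is the derivative of \<open>flat 2\<close>; the factor
    \<open>-2\<close> comes from differentiating the square.\<close>
  define A' where "A' = (flat 4 (r\<^sup>2 - (y - x) \<bullet> (y - x)) - 2 * flat 3 (r\<^sup>2 - (y - x) \<bullet> (y - x))) * (-2)"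
  have sq: "(y - x) \<bullet> (y - x) = (x - y) \<bullet> (x - y)" for y :: "real^'n"
    by (metis inner_minus_left inner_minus_right minus_diff_eq minus_minus)
  have dA: "(A has_derivative (\<lambda>h. A' *\<^sub>R (y - x) \<bullet> h)) (at y)"
    using flat_radial_derivative[of 2 "r\<^sup>2" x y] by (simp add: A_def A'_def)
  have g: "(\<lambda>y. gker r (x - y) $ i) = (\<lambda>y. ?c * A y * (x - y) $ i)" for i
    by (simp add: gker_def A_def sq fun_eq_iff)
  have "((\<lambda>y. gker r (x - y) $ i) has_derivative
    (\<lambda>h. (?c *\<^sub>R (- A y *\<^sub>R axis i 1 + (A' * (x - y) $ i) *\<^sub>R (y - x))) \<bullet> h)) (at y)" for i
  proof -
    have "((\<lambda>y. x $ i - y $ i) has_derivative (\<lambda>h. 0 - h $ i)) (at y)"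
      by (intro has_derivative_diff has_derivative_const bounded_linear_imp_has_derivative
          bounded_linear_vec_nth)
    from has_derivative_mult[OF has_derivative_mult_right[OF dA, of ?c] this]
    show ?thesis
      unfolding g vector_minus_component by (rule has_derivative_eq_rhs) (auto simp: inner_axis' inner_add_left algebra_simps diff_divide_distrib add_divide_distrib)
  qed
  from partial_deriv_eq[OF this]
  have "partial_deriv j (\<lambda>y. gker r (x - y) $ i) y =
    ?c * (- A y * axis i 1 $ j + (A' * (x - y) $ i) * (y - x) $ j)" for i j
    by simp
  then show ?thesis
    by (simp add: axis_def mult.commute mult.left_commute right_diff_distrib left_diff_distrib)
qed

end

section \<open>Convolution with a kernel\<close>

text \<open>The completed measure is used because weak derivatives are only Lebesgue
  measurable.\<close>

definition conv :: "(real^'n \<Rightarrow> real) \<Rightarrow> (real^'n \<Rightarrow> real) \<Rightarrow> real^'n \<Rightarrow> real" where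
  "conv k f x = (LINT y|lebesgue. k (x - y) * f y)"

lemma lebesgue_measurable_cont: 
  fixes k :: "'a::euclidean_space \<Rightarrow> 'b::topological_space"
  shows "continuous_on UNIV k \<Longrightarrow> k \<in> lebesgue \<rightarrow>\<^sub>M borel"
  by (simp add: borel_measurable_continuous_onI measurable_completion)

lemma compact_support_bounded:
  fixes k :: "real^'n \<Rightarrow> 'b::real_normed_vector"
  assumes "continuous_on UNIV k" "\<And>x. norm x \<ge> R \<Longrightarrow> k x = 0"
  shows "\<exists>B>0. \<forall>x. norm (k x) \<le> B"
proof -
  have "compact (k ` cball 0 R)"
    by (rule compact_continuous_image) (use assms(1) continuous_on_subset in auto)
  then obtain B where "\<forall>y\<in>k ` cball 0 R. norm y \<le> B"
    using compact_imp_bounded bounded_iff by metis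
  then have "norm (k x) \<le> max B 1" for x
    using assms(2)[of x] by (cases "norm x \<le> R") (force simp: max_def)+
  then show ?thesis
    by (intro exI[of _ "max B 1"]) auto
qed

lemma compact_support_uniformly_continuous:
  fixes k :: "real^'n \<Rightarrow> 'b::real_normed_vector"
  assumes "continuous_on UNIV k" "\<And>x. norm x \<ge> R \<Longrightarrow> k x = 0" "e > 0"
  shows "\<exists>d>0. \<forall>x y. norm (x - y) < d \<longrightarrow> norm (k x - k y) < e"
proof -
  have "uniformly_continuous_on (cball 0 (R + 1)) k"
    by (rule compact_uniformly_continuous) (use assms(1) continuous_on_subset in auto)
  then obtain d where d: "d > 0"
    "\<And>x y. x \<in> cball 0 (R + 1) \<Longrightarrow> y \<in> cball 0 (R + 1) \<Longrightarrow> dist x y < d \<Longrightarrow> dist (k x) (k y) < e"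
    using assms(3) unfolding uniformly_continuous_on_def by (metis dist_commute)
  have "norm (k x - k y) < e" if "norm (x - y) < min d 1" for x y
  proof (cases "norm x \<le> R \<or> norm y \<le> R")
    case True
    have "norm x \<le> norm y + norm (x - y)" "norm y \<le> norm x + norm (x - y)"
      by (metis norm_triangle_sub) (metis norm_minus_commute norm_triangle_sub)
    then show ?thesis
      using True that d(2)[of x y] by (auto simp: dist_norm)
  next
    case False
    then show ?thesis using assms(2)[of x] assms(2)[of y] assms(3) by simp
  qed
  then show ?thesis
    using d(1) by (intro exI[of _ "min d 1"]) auto
qed

lemma conv_integrable:
  fixes k :: "real^'n \<Rightarrow> real"
  assumes "continuous_on UNIV k" "\<And>x. norm x \<ge> R \<Longrightarrow> k x = 0" "integrable lebesgue f"
  shows "integrable lebesgue (\<lambda>y. k (x - y) * f y)"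
proof -
  obtain B where B: "\<And>x. norm (k x) \<le> B"
    using compact_support_bounded[OF assms(1,2)] by blast
  have [measurable]: "(\<lambda>y. k (x - y)) \<in> borel_measurable lebesgue"
    by (intro lebesgue_measurable_cont continuous_on_compose2[OF assms(1)] continuous_intros) auto
  have [measurable]: "f \<in> borel_measurable lebesgue"
    using assms(3) by auto
  show ?thesis
  proof (rule Bochner_Integration.integrable_bound)
    show "integrable lebesgue (\<lambda>y. B * f y)"
      using assms(3) by auto
    have "norm (k (x - y) * f y) \<le> norm (B * f y)" for y
      using B[of "x - y"] by (auto simp: abs_mult intro!: mult_right_mono)
    then show "AE y in lebesgue. norm (k (x - y) * f y) \<le> norm (B * f y)" by simp
  qed simp
qed

lemma conv_diff_bound:
  fixes h :: "real^'n \<Rightarrow> real"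
  assumes "integrable lebesgue (\<lambda>y. h y * f y)" "integrable lebesgue f" "\<And>y. \<bar>h y\<bar> \<le> e"
  shows "\<bar>LINT y|lebesgue. h y * f y\<bar> \<le> e * (LINT y|lebesgue. \<bar>f y\<bar>)"
proof -
  have "norm (LINT y|lebesgue. h y * f y) \<le> (LINT y|lebesgue. e * \<bar>f y\<bar>)"
    using assms by (intro Bochner_Integration.integral_norm_bound_integral)
      (auto simp: abs_mult intro!: mult_right_mono)
  then show ?thesis by simp
qed

text \<open>Errors are divided by \<open>a + 1\<close>, with \<open>a\<close> an L^1 norm or a
  volume, so that \<open>a = 0\<close> needs no separate case.\<close>

lemma frac_mult_less: "e > 0 \<Longrightarrow> a \<ge> 0 \<Longrightarrow> e / (a + 1) * a < (e::real)"
  by (simp add: field_simps)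

lemma continuous_conv:
  fixes k :: "real^'n \<Rightarrow> real"
  assumes k: "continuous_on UNIV k" "\<And>x. norm x \<ge> R \<Longrightarrow> k x = 0" and f: "integrable lebesgue f"
  shows "continuous_on A (conv k f)"
proof -
  let ?I = "LINT y|lebesgue. \<bar>f y\<bar>"
  have "isCont (conv k f) x" for x
    unfolding continuous_at_eps_delta
  proof (intro allI impI)
    fix e :: real assume "e > 0"
    have I: "?I \<ge> 0" by simp
    obtain d where d: "d > 0" "\<And>x y. norm (x - y) < d \<Longrightarrow> norm (k x - k y) < e / (?I + 1)"
      using compact_support_uniformly_continuous[OF k divide_pos_pos[of e "?I + 1"]] \<open>e > 0\<close> I
      by (metis add_nonneg_pos zero_less_one)
    have "dist (conv k f x') (conv k f x) < e" if "dist x' x < d" for x'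
    proof -
      have "conv k f x' - conv k f x = (LINT y|lebesgue. k (x' - y) * f y - k (x - y) * f y)"
        unfolding conv_def
        by (subst Bochner_Integration.integral_diff) (auto intro!: conv_integrable k f)
      also have "\<dots> = (LINT y|lebesgue. (k (x' - y) - k (x - y)) * f y)"
        by (simp add: algebra_simps)
      finally have eq: "conv k f x' - conv k f x = \<dots>" .
      have "\<bar>conv k f x' - conv k f x\<bar> \<le> e / (?I + 1) * ?I"
        unfolding eq
      proof (rule conv_diff_bound[OF _ f])
        have "integrable lebesgue (\<lambda>y. k (x' - y) * f y - k (x - y) * f y)"
          by (intro Bochner_Integration.integrable_diff conv_integrable k f)
        then show "integrable lebesgue (\<lambda>y. (k (x' - y) - k (x - y)) * f y)"
          by (simp add: algebra_simps)
        show "\<bar>k (x' - y) - k (x - y)\<bar> \<le> e / (?I + 1)" for y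
          using d(2)[of "x' - y" "x - y"] that by (simp add: dist_norm)
      qed
      also have "\<dots> < e"
        by (rule frac_mult_less[OF \<open>e > 0\<close> I])
      finally show ?thesis by (simp add: dist_real_def)
    qed
    then show "\<exists>d>0. \<forall>x'. dist x' x < d \<longrightarrow> dist (conv k f x') (conv k f x) < e"
      using d(1) by blast
  qed
  then show ?thesis
    by (simp add: continuous_at_imp_continuous_on)
qed

text \<open>The gradient of the kernel is uniformly continuous, so the first-order Taylor error of
  the kernel is small uniformly in the integration variable; integrating it against \<open>f\<close>
  costs only the L^1 norm of \<open>f\<close>.\<close>

lemma conv_has_derivative:
  fixes k :: "real^'n \<Rightarrow> real" and g :: "real^'n \<Rightarrow> real^'n"
  assumes k: "continuous_on UNIV k" "\<And>x. norm x \<ge> R \<Longrightarrow> k x = 0"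
    and g: "continuous_on UNIV g" "\<And>x. norm x \<ge> R \<Longrightarrow> g x = 0"
    and der: "\<And>x. (k has_derivative (\<lambda>h. g x \<bullet> h)) (at x)"
    and f: "integrable lebesgue f"
  shows "(conv k f has_derivative (\<lambda>h. (\<chi> i. conv (\<lambda>z. g z $ i) f x) \<bullet> h)) (at x)"
proof -
  let ?I = "LINT y|lebesgue. \<bar>f y\<bar>"
  have I: "?I \<ge> 0" by simp
  have gi: "continuous_on UNIV (\<lambda>z. g z $ i)" "\<And>x. norm x \<ge> R \<Longrightarrow> g x $ i = 0" for i
    using g by (auto intro!: continuous_intros)
  have lin: "(\<chi> i. conv (\<lambda>z. g z $ i) f x) \<bullet> h = (LINT y|lebesgue. (g (x - y) \<bullet> h) * f y)"
    and int: "integrable lebesgue (\<lambda>y. (g (x - y) \<bullet> h) * f y)" for h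
  proof -
    have "(\<lambda>y. (g (x - y) \<bullet> h) * f y) = (\<lambda>y. \<Sum>i\<in>UNIV. h $ i * (g (x - y) $ i * f y))"
      by (auto simp: inner_vec_def sum_distrib_right intro!: sum.cong)
    moreover have "integrable lebesgue (\<lambda>y. h $ i * (g (x - y) $ i * f y))" for i
      by (intro integrable_mult_right conv_integrable[OF gi f])
    ultimately show "(\<chi> i. conv (\<lambda>z. g z $ i) f x) \<bullet> h = (LINT y|lebesgue. (g (x - y) \<bullet> h) * f y)"
      "integrable lebesgue (\<lambda>y. (g (x - y) \<bullet> h) * f y)"
      by (auto simp: inner_vec_def conv_def mult.commute)
  qed
  show ?thesis
    unfolding has_derivative_at_alt
  proof (intro conjI allI impI)
    show "bounded_linear (\<lambda>h. (\<chi> i. conv (\<lambda>z. g z $ i) f x) \<bullet> h)"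
      by (rule bounded_linear_inner_right)
    fix e :: real assume "e > 0"
    obtain d where d: "d > 0" "\<And>x y. norm (x - y) < d \<Longrightarrow> norm (g x - g y) < e / (?I + 1)"
      using compact_support_uniformly_continuous[OF g divide_pos_pos[of e "?I + 1"]] \<open>e > 0\<close> I
      by (metis add_nonneg_pos zero_less_one)
    \<comment> \<open>The mean value inequality on a ball turns the modulus of continuity of
      \<open>g\<close> into a uniform linearization error for \<open>k\<close>.\<close>
    have lin_k: "\<bar>k b - k a - g a \<bullet> (b - a)\<bar> \<le> norm (b - a) * (e / (?I + 1))" if ab: "norm (b - a) < d" for a b
    proof -
      have seg: "a + t *\<^sub>R (b - a) \<in> ball a d" if "t \<in> {0..1}" for t
      proof -
        have "t * norm (b - a) \<le> 1 * norm (b - a)"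
          using that by (intro mult_right_mono) auto
        then show ?thesis using ab that by (simp add: dist_norm)
      qed
      have on: "onorm (\<lambda>h. g x \<bullet> h - g a \<bullet> h) \<le> e / (?I + 1)" if "x \<in> ball a d" for x
      proof (rule onorm_bound)
        show "0 \<le> e / (?I + 1)" using \<open>e > 0\<close> I by simp
        fix h
        have "norm (g x \<bullet> h - g a \<bullet> h) \<le> norm (g x - g a) * norm h"
          by (metis Cauchy_Schwarz_ineq2 inner_diff_left real_norm_def)
        also have "\<dots> \<le> e / (?I + 1) * norm h"
          using d(2)[of x a] that by (intro mult_right_mono) (auto simp: dist_norm norm_minus_commute)
        finally show "norm (g x \<bullet> h - g a \<bullet> h) \<le> e / (?I + 1) * norm h" .
      qed
      have "norm (k b - k a - (\<lambda>h. g a \<bullet> h) (b - a)) \<le> norm (b - a) * (e / (?I + 1))"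
        by (rule differentiable_bound_linearization[where S = "ball a d" and f' = "\<lambda>x h. g x \<bullet> h", OF seg])
          (use on d(1) in \<open>auto intro: has_derivative_at_withinI[OF der] simp: fun_diff_def\<close>)
      then show ?thesis by simp
    qed
    have "norm (conv k f x' - conv k f x - (\<chi> i. conv (\<lambda>z. g z $ i) f x) \<bullet> (x' - x)) \<le> e * norm (x' - x)"
      if "norm (x' - x) < d" for x'
    proof -
      let ?h = "\<lambda>y. k (x' - y) - k (x - y) - g (x - y) \<bullet> (x' - x)"
      have i1: "integrable lebesgue (\<lambda>y. k (x' - y) * f y - k (x - y) * f y)"
        by (intro Bochner_Integration.integrable_diff conv_integrable k f)
      have i2: "integrable lebesgue (\<lambda>y. ?h y * f y)"
        using Bochner_Integration.integrable_diff[OF i1 int[of "x' - x"]]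
        by (simp add: algebra_simps)
      have "conv k f x' - conv k f x = (LINT y|lebesgue. k (x' - y) * f y - k (x - y) * f y)"
        unfolding conv_def
        by (subst Bochner_Integration.integral_diff) (auto intro!: conv_integrable k f)
      then have "conv k f x' - conv k f x - (\<chi> i. conv (\<lambda>z. g z $ i) f x) \<bullet> (x' - x) =
        (LINT y|lebesgue. (k (x' - y) * f y - k (x - y) * f y) - (g (x - y) \<bullet> (x' - x)) * f y)"
        unfolding lin using Bochner_Integration.integral_diff[OF i1 int[of "x' - x"]] by simp
      also have "\<dots> = (LINT y|lebesgue. ?h y * f y)"
        by (simp add: algebra_simps)
      finally have eq: "conv k f x' - conv k f x - (\<chi> i. conv (\<lambda>z. g z $ i) f x) \<bullet> (x' - x) = \<dots>" .
      have "\<bar>LINT y|lebesgue. ?h y * f y\<bar> \<le> norm (x' - x) * (e / (?I + 1)) * ?I"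
        using lin_k[of "x' - y" "x - y" for y] that by (intro conv_diff_bound i2 f) simp
      also have "\<dots> = norm (x' - x) * (e / (?I + 1) * ?I)"
        by simp
      also have "\<dots> \<le> norm (x' - x) * e"
        using frac_mult_less[OF \<open>e > 0\<close> I] by (intro mult_left_mono) auto
      finally show ?thesis using eq by (simp add: mult.commute)
    qed
    then show "\<exists>d>0. \<forall>x'. norm (x' - x) < d \<longrightarrow>
      norm (conv k f x' - conv k f x - (\<chi> i. conv (\<lambda>z. g z $ i) f x) \<bullet> (x' - x)) \<le> e * norm (x' - x)"
      using d(1) by blast
  qed
qed

section \<open>Convergence of mollifications\<close>

text \<open>Tonelli's theorem will be applied to a function that is Borel in both variables; this
  provides the Borel factor.\<close>

lemma integrable_borel_representative:
  fixes f :: "'a::euclidean_space \<Rightarrow> real"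
  assumes "integrable lebesgue f"
  obtains f' where "integrable lborel f'" "AE x in lebesgue. f x = f' x"
proof -
  have "f \<in> borel_measurable lebesgue" using assms by auto
  then obtain f' where f': "f' \<in> borel_measurable lborel" "AE x in lborel. f x = f' x"
    using completion_ex_borel_measurable_real by blast
  then have AE: "AE x in lebesgue. f x = f' x"
    using AE_completion by blast
  have "integrable lebesgue f'"
    using assms f' AE by (subst integrable_cong_AE[of _ _ f]) (auto simp: measurable_completion)
  then have "integrable lborel f'"
    using f'(1) integrable_completion by blast
  with AE show ?thesis using that by blast
qed

lemma nn_integral_translate:
  fixes k :: "real^'n \<Rightarrow> ennreal"
  assumes "k \<in> borel_measurable borel"
  shows "(\<integral>\<^sup>+x. k (x - y) \<partial>lborel) = (\<integral>\<^sup>+x. k x \<partial>lborel)"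
proof -
  have "(\<integral>\<^sup>+x. k x \<partial>lborel) = (\<integral>\<^sup>+x. k x \<partial>(distr lborel borel ((+) (-y))))"
    by (simp add: lborel_distr_plus)
  also have "\<dots> = (\<integral>\<^sup>+x. k (x - y) \<partial>lborel)"
    using assms by (subst nn_integral_distr) auto
  finally show ?thesis by simp
qed

lemma lebesgue_integral_translate:
  fixes k :: "real^'n \<Rightarrow> real"
  assumes "k \<in> borel_measurable borel"
  shows "(LINT x|lborel. k (x + y)) = (LINT x|lborel. k x)"
    "integrable lborel (\<lambda>x. k (x + y)) \<longleftrightarrow> integrable lborel k"
proof -
  have "(LINT x|lborel. k x) = (LINT x|distr lborel borel ((+) y). k x)"
    by (simp add: lborel_distr_plus)
  also have "\<dots> = (LINT x|lborel. k (x + y))"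
    using assms by (subst integral_distr) (auto simp: add.commute)
  finally show "(LINT x|lborel. k (x + y)) = (LINT x|lborel. k x)" by simp
  have "integrable (distr lborel borel ((+) y)) k \<longleftrightarrow> integrable lborel (\<lambda>x. k (x + y))"
    using assms by (subst integrable_distr_eq) (auto simp: add.commute)
  then show "integrable lborel (\<lambda>x. k (x + y)) \<longleftrightarrow> integrable lborel k"
    by (simp add: lborel_distr_plus)
qed

lemma conv_cong_AE:
  assumes "AE y in lebesgue. f y = g y" "continuous_on UNIV k"
    and [measurable]: "f \<in> borel_measurable lebesgue" "g \<in> borel_measurable lebesgue"
  shows "conv k f x = conv k g x"
  unfolding conv_def
proof (rule integral_cong_AE)
  have [measurable]: "(\<lambda>y. k (x - y)) \<in> borel_measurable lebesgue"
    by (intro lebesgue_measurable_cont continuous_on_compose2[OF assms(2)] continuous_intros) auto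
  show "(\<lambda>y. k (x - y) * f y) \<in> borel_measurable lebesgue"
    "(\<lambda>y. k (x - y) * g y) \<in> borel_measurable lebesgue" by measurable
  show "AE y in lebesgue. k (x - y) * f y = k (x - y) * g y"
    using assms(1) by eventually_elim simp
qed

text \<open>Tonelli: after exchanging the integrals, each translate of the kernel integrates to
  1.\<close>

lemma conv_L1_le:
  fixes k :: "real^'n \<Rightarrow> real"
  assumes k: "continuous_on UNIV k" "\<And>x. norm x \<ge> R \<Longrightarrow> k x = 0" "\<And>x. k x \<ge> 0"
    "(LINT x|lborel. k x) = 1"
    and f: "integrable lebesgue f"
  shows "integrable lebesgue (conv k f)"
    and "(LINT x|lebesgue. \<bar>conv k f x\<bar>) \<le> (LINT x|lebesgue. \<bar>f x\<bar>)"
proof -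
  obtain g where g: "integrable lborel g" "AE x in lebesgue. f x = g x"
    using integrable_borel_representative[OF f] .
  have gm [measurable]: "g \<in> borel_measurable borel"
    using borel_measurable_integrable[OF g(1)] by simp
  have km [measurable]: "k \<in> borel_measurable borel"
    by (rule borel_measurable_continuous_onI[OF k(1)])
  have gl: "integrable lebesgue g"
    using g(1) by (simp add: integrable_completion)
  have fm: "f \<in> borel_measurable lebesgue" using f by auto
  have eq: "conv k f x = conv k g x" for x
    by (rule conv_cong_AE[OF g(2) k(1) fm]) (use gl in auto)
  have ck [measurable]: "conv k g \<in> borel_measurable borel"
    by (intro borel_measurable_continuous_onI continuous_conv[OF k(1,2) gl])
  have k1: "(\<integral>\<^sup>+x. ennreal (k (x - y)) \<partial>lborel) = 1" for y
  proof -
    have "(\<integral>\<^sup>+x. ennreal (k (x - y)) \<partial>lborel) = (\<integral>\<^sup>+x. ennreal (k x) \<partial>lborel)"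
      by (rule nn_integral_translate) measurable
    also have "\<dots> = 1"
      using nn_integral_eq_integral[of lborel k] integrable_compact_support[OF k(1,2)] k(3,4) by simp
    finally show ?thesis .
  qed
  have bound: "ennreal (norm (conv k g x)) \<le> (\<integral>\<^sup>+y. ennreal (k (x - y)) * ennreal (norm (g y)) \<partial>lborel)" for x
  proof -
    have i: "integrable lborel (\<lambda>y. k (x - y) * g y)"
      using conv_integrable[OF k(1,2) gl, where x = x] by (subst (asm) integrable_completion) auto
    have "conv k g x = (LINT y|lborel. k (x - y) * g y)"
      unfolding conv_def by (rule integral_completion) measurable
    then have "ennreal (norm (conv k g x)) \<le> (\<integral>\<^sup>+y. ennreal (norm (k (x - y) * g y)) \<partial>lborel)"
      using integral_norm_bound_ennreal[OF i] by simp
    also have "\<dots> = (\<integral>\<^sup>+y. ennreal (k (x - y)) * ennreal (norm (g y)) \<partial>lborel)"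
      using k(3) by (intro nn_integral_cong) (simp add: abs_mult ennreal_mult)
    finally show ?thesis .
  qed
  have "(\<integral>\<^sup>+x. ennreal (norm (conv k g x)) \<partial>lborel) \<le>
      (\<integral>\<^sup>+x. (\<integral>\<^sup>+y. ennreal (k (x - y)) * ennreal (norm (g y)) \<partial>lborel) \<partial>lborel)"
    by (intro nn_integral_mono bound)
  also have "\<dots> = (\<integral>\<^sup>+y. (\<integral>\<^sup>+x. ennreal (k (x - y)) * ennreal (norm (g y)) \<partial>lborel) \<partial>lborel)"
    by (rule lborel_pair.Fubini') measurable
  also have "\<dots> = (\<integral>\<^sup>+y. ennreal (norm (g y)) \<partial>lborel)"
    by (subst nn_integral_multc) (auto simp: k1)
  finally have le: "(\<integral>\<^sup>+x. ennreal (norm (conv k g x)) \<partial>lborel) \<le> (\<integral>\<^sup>+y. ennreal (norm (g y)) \<partial>lborel)" .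
  have fin: "(\<integral>\<^sup>+y. ennreal (norm (g y)) \<partial>lborel) = ennreal (LINT y|lborel. norm (g y))"
    using g(1) by (intro nn_integral_eq_integral) auto
  have int: "integrable lborel (conv k g)"
    using le unfolding fin by (intro integrableI_bounded) (auto simp: top.not_eq_extremum le_less_trans)
  show "integrable lebesgue (conv k f)"
    using int unfolding eq[abs_def] by (simp add: integrable_completion)
  have "ennreal (LINT x|lborel. norm (conv k g x)) \<le> ennreal (LINT y|lborel. norm (g y))"
    using le unfolding fin using int by (subst (asm) nn_integral_eq_integral) auto
  then have "(LINT x|lborel. norm (conv k g x)) \<le> (LINT y|lborel. norm (g y))"
    by (subst (asm) ennreal_le_iff) auto
  moreover have "(LINT x|lebesgue. \<bar>conv k f x\<bar>) = (LINT x|lborel. norm (conv k g x))"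
    unfolding eq by (subst integral_completion) auto
  moreover have "(LINT x|lebesgue. \<bar>f x\<bar>) = (LINT x|lebesgue. \<bar>g x\<bar>)"
    using g(2) gl fm by (intro integral_cong_AE) auto
  moreover have "(LINT x|lebesgue. \<bar>g x\<bar>) = (LINT y|lborel. norm (g y))"
    by (subst integral_completion) auto
  ultimately show "(LINT x|lebesgue. \<bar>conv k f x\<bar>) \<le> (LINT x|lebesgue. \<bar>f x\<bar>)" by simp
qed

text \<open>Measurability already gives continuous functions converging almost everywhere.
  Truncating values and cutting off at infinity supplies the integrable majorant that upgrades this
  to L^1.\<close>

lemma L1_approx_continuous:
  fixes f :: "real^'n \<Rightarrow> real"
  assumes f: "integrable lebesgue f" and "e > 0"
  obtains g R where "continuous_on UNIV g" "\<And>x. norm x \<ge> R \<Longrightarrow> g x = 0"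
    "(LINT x|lebesgue. \<bar>f x - g x\<bar>) < e"
proof -
  have fm [measurable]: "f \<in> borel_measurable lebesgue" using f by auto
  then have "f measurable_on UNIV"
    by (intro lebesgue_measurable_imp_measurable_on_real) auto
  then obtain N g where N: "negligible N" and g: "\<And>n. continuous_on UNIV (g n)"
    "\<And>x. x \<notin> N \<Longrightarrow> (\<lambda>n::nat. g n x) \<longlonglongrightarrow> f x"
    unfolding measurable_on_def by auto
  have AE: "AE x in lebesgue. (\<lambda>n. g n x) \<longlonglongrightarrow> f x"
    using N g(2) by (intro AE_I'[of N]) (auto simp: negligible_iff_null_sets)
  \<comment> \<open>\<open>cut m\<close> is a continuous cutoff, 1 on the ball of radius
    \<open>m\<close> and 0 outside that of radius \<open>m + 1\<close>; \<open>clip m\<close>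
    truncates values to the interval from \<open>-m\<close> to \<open>m\<close>. Both preserve
    continuity.\<close>
  define cut where "cut = (\<lambda>(m::nat) (x::real^'n). max 0 (min 1 (real m + 1 - norm x)))"
  define clip where "clip = (\<lambda>(m::nat) (t::real). max (- real m) (min (real m) t))"
  have cut: "continuous_on UNIV (cut m)" "0 \<le> cut m x" "cut m x \<le> 1" for m x
    unfolding cut_def by (auto intro!: continuous_intros)
  have [measurable]: "cut m \<in> borel_measurable lebesgue" for m
    by (rule lebesgue_measurable_cont[OF cut(1)])
  have [measurable]: "clip m \<in> borel_measurable borel" for m
    unfolding clip_def by measurable
  have [measurable]: "g n \<in> borel_measurable lebesgue" for n
    by (rule lebesgue_measurable_cont[OF g(1)])
  have clip: "\<bar>clip m t\<bar> \<le> \<bar>t\<bar>" "\<bar>clip m t\<bar> \<le> real m" for m t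
    unfolding clip_def by auto
  have prod_le: "\<bar>clip m t * cut m x\<bar> \<le> \<bar>clip m t\<bar>" for m t x
    using cut(2,3)[of m x] by (simp add: abs_mult mult_left_le)
  have "(\<lambda>m. LINT x|lebesgue. \<bar>f x - clip m (f x) * cut m x\<bar>) \<longlonglongrightarrow> (LINT x::real^'n|lebesgue. (0::real))"
  proof (rule integral_dominated_convergence[where w = "\<lambda>x. 2 * \<bar>f x\<bar>"])
    show "AE x in lebesgue. (\<lambda>m. \<bar>f x - clip m (f x) * cut m x\<bar>) \<longlonglongrightarrow> 0"
    proof (rule AE_I2)
      fix x
      obtain M :: nat where M: "max \<bar>f x\<bar> (norm x) \<le> real M"
        using real_arch_simple by blast
      have "\<bar>f x - clip m (f x) * cut m x\<bar> = 0" if "m \<ge> M" for m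
      proof -
        have "real M \<le> real m" using that by simp
        then have "clip m (f x) = f x" "cut m x = 1"
          using M unfolding clip_def cut_def by auto
        then show ?thesis by simp
      qed
      then show "(\<lambda>m. \<bar>f x - clip m (f x) * cut m x\<bar>) \<longlonglongrightarrow> 0"
        by (intro tendsto_eventually) (auto simp: eventually_sequentially)
    qed
    show "AE x in lebesgue. norm \<bar>f x - clip m (f x) * cut m x\<bar> \<le> 2 * \<bar>f x\<bar>" for m
    proof (rule AE_I2)
      fix x show "norm \<bar>f x - clip m (f x) * cut m x\<bar> \<le> 2 * \<bar>f x\<bar>"
        using prod_le[of m "f x" x] clip(1)[of m "f x"] by simp
    qed
  qed (use f in auto)
  then have "eventually (\<lambda>m. (LINT x|lebesgue. \<bar>f x - clip m (f x) * cut m x\<bar>) < e / 2) sequentially"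
    using \<open>e > 0\<close> by (intro order_tendstoD(2)[of _ 0]) auto
  then obtain m where m: "(LINT x|lebesgue. \<bar>f x - clip m (f x) * cut m x\<bar>) < e / 2"
    by (auto simp: eventually_sequentially)
  have wint: "integrable lebesgue (\<lambda>x. 2 * real m * indicat_real (cball 0 (real m + 1)) (x::real^'n))"
    by (intro integrable_mult_right integrable_real_indicator) (use emeasure_bounded_finite[of "cball (0::real^'n) (real m + 1)"] in auto)
  have cut0: "cut m x = 0" if "norm x \<ge> real m + 1" for x
    using that by (simp add: cut_def)
  have dom: "\<bar>clip m t * cut m x\<bar> \<le> real m * indicator (cball 0 (real m + 1)) x" for t x
    using prod_le[of m t x] clip(2)[of m t] cut0[of x] by (auto simp: indicator_def)
  \<comment> \<open>With \<open>m\<close> fixed, everything is bounded and supported in one ball, so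
    dominated convergence applies along \<open>n\<close>.\<close>
  have "(\<lambda>n. LINT x|lebesgue. \<bar>clip m (f x) * cut m x - clip m (g n x) * cut m x\<bar>) \<longlonglongrightarrow>
    (LINT x::real^'n|lebesgue. (0::real))"
  proof (rule integral_dominated_convergence[OF _ _ wint])
    show "AE x in lebesgue. (\<lambda>n. \<bar>clip m (f x) * cut m x - clip m (g n x) * cut m x\<bar>) \<longlonglongrightarrow> 0"
      using AE
    proof eventually_elim
      case (elim x)
      then have "(\<lambda>n. \<bar>clip m (f x) * cut m x - clip m (g n x) * cut m x\<bar>) \<longlonglongrightarrow>
        \<bar>clip m (f x) * cut m x - clip m (f x) * cut m x\<bar>"
        unfolding clip_def by (intro tendsto_intros)
      then show ?case by simp
    qed
    show "AE x in lebesgue. norm \<bar>clip m (f x) * cut m x - clip m (g n x) * cut m x\<bar> \<le>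
      2 * real m * indicator (cball 0 (real m + 1)) x" for n
    proof (rule AE_I2)
      fix x show "norm \<bar>clip m (f x) * cut m x - clip m (g n x) * cut m x\<bar> \<le>
        2 * real m * indicator (cball 0 (real m + 1)) x"
        using dom[of "f x" x] dom[of "g n x" x] by simp
    qed
  qed auto
  then have "eventually (\<lambda>n. (LINT x|lebesgue. \<bar>clip m (f x) * cut m x - clip m (g n x) * cut m x\<bar>) < e / 2)
    sequentially"
    using \<open>e > 0\<close> by (intro order_tendstoD(2)[of _ 0]) auto
  then obtain n where n: "(LINT x|lebesgue. \<bar>clip m (f x) * cut m x - clip m (g n x) * cut m x\<bar>) < e / 2"
    by (auto simp: eventually_sequentially)
  have int: "integrable lebesgue (\<lambda>x. clip m (h x) * cut m x)" if [measurable]: "h \<in> borel_measurable lebesgue"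
    for h
  proof (rule Bochner_Integration.integrable_bound[OF wint])
    show "AE x in lebesgue. norm (clip m (h x) * cut m x) \<le>
      norm (2 * real m * indicat_real (cball 0 (real m + 1)) x)"
    proof (rule AE_I2)
      fix x :: "real^'n"
      have "real m * indicat_real (cball 0 (real m + 1)) x \<le> 2 * real m * indicat_real (cball 0 (real m + 1)) x"
        by (simp add: indicator_def)
      then show "norm (clip m (h x) * cut m x) \<le> norm (2 * real m * indicat_real (cball 0 (real m + 1)) x)"
        using dom[of "h x" x] by simp
    qed
  qed measurable
  have "(LINT x|lebesgue. \<bar>f x - clip m (g n x) * cut m x\<bar>) \<le>
    (LINT x|lebesgue. \<bar>f x - clip m (f x) * cut m x\<bar> +
       \<bar>clip m (f x) * cut m x - clip m (g n x) * cut m x\<bar>)"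
    by (intro integral_mono) (auto intro!: integrable_abs Bochner_Integration.integrable_diff int f)
  also have "\<dots> < e"
    using m n by (subst Bochner_Integration.integral_add)
      (auto intro!: integrable_abs Bochner_Integration.integrable_diff int f)
  finally have "(LINT x|lebesgue. \<bar>f x - clip m (g n x) * cut m x\<bar>) < e" .
  moreover have "continuous_on UNIV (\<lambda>x. clip m (g n x) * cut m x)"
    unfolding clip_def by (intro continuous_intros g cut)
  ultimately show ?thesis
    using that[of "\<lambda>x. clip m (g n x) * cut m x" "real m + 1"] cut0 by simp
qed


section \<open>The mollification operator\<close>

definition moll :: "real \<Rightarrow> (real^'n \<Rightarrow> real) \<Rightarrow> real^'n \<Rightarrow> real" where
  "moll r = conv (mker r)"

lemma integrable_moll:
  assumes "r > 0" "integrable lebesgue f"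
  shows "integrable lebesgue (moll r f)" "(LINT x|lebesgue. \<bar>moll r f x\<bar>) \<le> (LINT x|lebesgue. \<bar>f x\<bar>)"
  unfolding moll_def
  using conv_L1_le[OF continuous_mker[OF assms(1)] mker_eq_0[OF assms(1)] mker_nonneg[OF assms(1)]
      integral_mker[OF assms(1)] assms(2)] by auto

lemma moll_diff:
  assumes "r > 0" "integrable lebesgue f" "integrable lebesgue g"
  shows "moll r (\<lambda>x. f x - g x) x = moll r f x - moll r g x"
proof -
  have "integrable lebesgue (\<lambda>y. mker r (x - y) * f y)" if "integrable lebesgue f" for f
    by (rule conv_integrable[OF continuous_mker[OF assms(1)] mker_eq_0[OF assms(1)] that])
  from Bochner_Integration.integral_diff[OF this this, OF assms(2,3)]
  show ?thesis
    by (simp add: moll_def conv_def right_diff_distrib)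
qed

lemma integral_mker_shift:
  assumes "r > 0"
  shows "integrable lebesgue (\<lambda>y. mker r (x - y))" "(LINT y|lebesgue. mker r (x - y)) = 1"
proof -
  have m: "mker r \<in> borel_measurable borel"
    by (intro borel_measurable_continuous_onI continuous_mker assms)
  have eq: "mker r (x - y) = mker r (y + (- x))" for y
    using mker_minus[OF assms, of "x - y"] by simp
  have [measurable]: "(\<lambda>y. mker r (y + (- x))) \<in> borel_measurable borel"
    using m by measurable
  show "integrable lebesgue (\<lambda>y. mker r (x - y))" "(LINT y|lebesgue. mker r (x - y)) = 1"
    unfolding eq
    using lebesgue_integral_translate[OF m, of "- x"] integrable_mker[OF assms] integral_mker[OF assms]
    by (auto simp: integrable_completion integral_completion simp del: add_uminus_conv_diff)
qed

text \<open>A mollification is an average over the ball of radius \<open>r\<close> with weights of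
  total mass 1, so it sees only nearby values.\<close>

lemma moll_near:
  assumes r: "r > 0" and g: "integrable lebesgue g" and e: "\<And>y. norm (x - y) < r \<Longrightarrow> \<bar>g y - c\<bar> \<le> e"
  shows "\<bar>moll r g x - c\<bar> \<le> e"
proof -
  note k = continuous_mker[OF r, of UNIV] mker_eq_0[OF r]
  have i1: "integrable lebesgue (\<lambda>y. mker r (x - y) * g y)"
    by (rule conv_integrable[OF k g])
  have i2: "integrable lebesgue (\<lambda>y. mker r (x - y) * c)"
    by (intro integrable_mult_left integral_mker_shift r)
  have "moll r g x - c = (LINT y|lebesgue. mker r (x - y) * g y) - (LINT y|lebesgue. mker r (x - y) * c)"
    by (simp add: moll_def conv_def integral_mker_shift[OF r])
  also have "\<dots> = (LINT y|lebesgue. mker r (x - y) * (g y - c))"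
    using Bochner_Integration.integral_diff[OF i1 i2] by (simp add: right_diff_distrib)
  also have "norm \<dots> \<le> (LINT y|lebesgue. mker r (x - y) * e)"
  proof (rule Bochner_Integration.integral_norm_bound_integral)
    show "integrable lebesgue (\<lambda>y. mker r (x - y) * (g y - c))"
      using Bochner_Integration.integrable_diff[OF i1 i2] by (simp add: right_diff_distrib)
    show "integrable lebesgue (\<lambda>y. mker r (x - y) * e)"
      by (intro integrable_mult_left integral_mker_shift r)
    fix y
    show "norm (mker r (x - y) * (g y - c)) \<le> mker r (x - y) * e"
    proof (cases "norm (x - y) < r")
      case True
      then show ?thesis
        using e[OF True] mker_nonneg[OF r, of "x - y"] by (simp add: abs_mult mult_left_mono)
    next
      case False
      then show ?thesis using mker_eq_0[OF r, of "x - y"] by simp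
    qed
  qed
  also have "\<dots> = e"
    by (simp add: integral_mker_shift[OF r])
  finally show ?thesis by simp
qed

text \<open>For compactly supported continuous \<open>g\<close> the convergence is uniform. The
  general case follows by density, since mollification does not increase the L^1 norm of
  \<open>f - g\<close>.\<close>

lemma moll_tendsto_L1:
  assumes f: "integrable lebesgue f"
  shows "((\<lambda>r. LINT x|lebesgue. \<bar>moll r f x - f x\<bar>) \<longlongrightarrow> 0) (at_right 0)"
proof (rule tendstoI)
  fix e :: real assume "e > 0"
  obtain g R where g: "continuous_on UNIV g" "\<And>x. norm x \<ge> R \<Longrightarrow> g x = 0"
    and fg: "(LINT x|lebesgue. \<bar>f x - g x\<bar>) < e / 4"
    using L1_approx_continuous[OF f, of "e / 4"] \<open>e > 0\<close> by (metis divide_pos_pos zero_less_numeral)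
  have gi: "integrable lebesgue g"
    using integrable_compact_support[OF g] g(1)
    by (subst integrable_completion) (auto intro: borel_measurable_continuous_onI)
  \<comment> \<open>For radii below 1, both \<open>g\<close> and its mollification vanish outside
    this ball.\<close>
  let ?B = "cball 0 (R + 1) :: (real^'a) set"
  let ?V = "measure lebesgue ?B"
  obtain d where d: "d > 0" "\<And>x y. norm (x - y) < d \<Longrightarrow> norm (g x - g y) < e / 4 / (?V + 1)"
    using compact_support_uniformly_continuous[OF g divide_pos_pos[of "e/4" "?V + 1"]] \<open>e > 0\<close>
    by (metis add_nonneg_pos divide_pos_pos measure_nonneg zero_less_numeral zero_less_one)
  have "(LINT x|lebesgue. \<bar>moll r f x - f x\<bar>) < e" if r: "0 < r" "r < min d 1" for r
  proof -
    have bi: "integrable lebesgue (\<lambda>x. e / 4 / (?V + 1) * indicat_real ?B x)"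
      by (intro integrable_mult_right integrable_real_indicator)
        (use emeasure_bounded_finite[of ?B] in auto)
    have gb: "\<bar>moll r g x - g x\<bar> \<le> e / 4 / (?V + 1) * indicator ?B x" for x
    proof (cases "x \<in> ?B")
      case True
      have "\<bar>moll r g x - g x\<bar> \<le> e / 4 / (?V + 1)"
      proof (rule moll_near[OF r(1) gi])
        fix y assume "norm (x - y) < r"
        then show "\<bar>g y - g x\<bar> \<le> e / 4 / (?V + 1)"
          using d(2)[of y x] r(2) by (simp add: norm_minus_commute)
      qed
      with True show ?thesis by simp
    next
      case False
      have "\<bar>g y - g x\<bar> \<le> 0" if "norm (x - y) < r" for y
      proof -
        have "norm x \<le> norm y + norm (x - y)" by (metis norm_triangle_sub)
        then show ?thesis using g(2)[of x] g(2)[of y] False that r(2) by simp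
      qed
      from moll_near[OF r(1) gi this] False show ?thesis by simp
    qed
    have fgi: "integrable lebesgue (\<lambda>x. f x - g x)" using f gi by auto
    have ints: "integrable lebesgue (\<lambda>x. \<bar>moll r (\<lambda>x. f x - g x) x\<bar>)"
      "integrable lebesgue (\<lambda>x. \<bar>moll r g x - g x\<bar>)" "integrable lebesgue (\<lambda>x. \<bar>f x - g x\<bar>)"
      using integrable_moll[OF r(1) fgi] integrable_moll[OF r(1) gi] gi fgi by auto
    have "(LINT x|lebesgue. \<bar>moll r g x - g x\<bar>) \<le> (LINT x|lebesgue. e / 4 / (?V + 1) * indicator ?B x)"
      by (intro integral_mono ints bi gb)
    also have "\<dots> = e / 4 / (?V + 1) * ?V" by simp
    also have "\<dots> < e / 4"
      by (rule frac_mult_less) (use \<open>e > 0\<close> in auto)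
    finally have 2: "(LINT x|lebesgue. \<bar>moll r g x - g x\<bar>) < e / 4" .
    have "(LINT x|lebesgue. \<bar>moll r f x - f x\<bar>) \<le>
      (LINT x|lebesgue. \<bar>moll r (\<lambda>x. f x - g x) x\<bar> + \<bar>moll r g x - g x\<bar> + \<bar>f x - g x\<bar>)"
    proof (rule integral_mono)
      show "integrable lebesgue (\<lambda>x. \<bar>moll r f x - f x\<bar>)"
        using integrable_moll[OF r(1) f] f by auto
      show "integrable lebesgue (\<lambda>x. \<bar>moll r (\<lambda>x. f x - g x) x\<bar> + \<bar>moll r g x - g x\<bar> + \<bar>f x - g x\<bar>)"
        using ints by auto
      show "\<bar>moll r f x - f x\<bar> \<le> \<bar>moll r (\<lambda>x. f x - g x) x\<bar> + \<bar>moll r g x - g x\<bar> + \<bar>f x - g x\<bar>" for x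
        unfolding moll_diff[OF r(1) f gi] by linarith
    qed
    also have "\<dots> = (LINT x|lebesgue. \<bar>moll r (\<lambda>x. f x - g x) x\<bar>) +
      (LINT x|lebesgue. \<bar>moll r g x - g x\<bar>) + (LINT x|lebesgue. \<bar>f x - g x\<bar>)"
      using ints by simp
    also have "\<dots> < e"
      using integrable_moll(2)[OF r(1) fgi] 2 fg \<open>e > 0\<close> by linarith
    finally show ?thesis .
  qed
  then have "dist (LINT x|lebesgue. \<bar>moll r f x - f x\<bar>) 0 < e" if "0 < r" "r < min d 1" for r
    using that by simp
  then show "\<forall>\<^sub>F r in at_right 0. dist (LINT x|lebesgue. \<bar>moll r f x - f x\<bar>) 0 < e"
    using d(1) unfolding eventually_at_right_field by (intro exI[of _ "min d 1"]) auto
qed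

text \<open>One sequence of radii serves all functions: a subsequence is extracted for the sum of
  the errors, which dominates each of them.\<close>

lemma moll_tendsto_AE:
  fixes f :: "'j \<Rightarrow> real^'n \<Rightarrow> real"
  assumes "finite J" and f: "\<And>j. j \<in> J \<Longrightarrow> integrable lebesgue (f j)" and "d > 0"
  shows "\<exists>r :: nat \<Rightarrow> real. (\<forall>k. 0 < r k \<and> r k < d) \<and> r \<longlonglongrightarrow> 0 \<and>
    (\<forall>j\<in>J. (AE x in lebesgue. (\<lambda>k. moll (r k) (f j) x) \<longlonglongrightarrow> f j x) \<and>
      (\<lambda>k. LINT x|lebesgue. \<bar>moll (r k) (f j) x - f j x\<bar>) \<longlonglongrightarrow> 0)"
proof -
  define s where "s k = d / 2 / real (Suc k)" for k
  have s: "0 < s k" "s k < d" for k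
    using \<open>d > 0\<close> by (auto simp: s_def field_simps intro: add_pos_nonneg)
  have s0: "s \<longlonglongrightarrow> 0"
    unfolding s_def by (rule LIMSEQ_Suc[OF lim_const_over_n])
  have s_right: "filterlim s (at_right 0) sequentially"
    using s0 s(1) by (auto simp: filterlim_at eventually_sequentially less_imp_neq[OF s(1), symmetric])
  have L1: "(\<lambda>k. LINT x|lebesgue. \<bar>moll (s k) (f j) x - f j x\<bar>) \<longlonglongrightarrow> 0" if "j \<in> J" for j
    by (rule filterlim_compose[OF moll_tendsto_L1[OF f[OF that]] s_right])
  define u where "u k x = (\<Sum>j\<in>J. \<bar>moll (s k) (f j) x - f j x\<bar>)" for k x
  have int: "integrable lebesgue (\<lambda>x. \<bar>moll (s k) (f j) x - f j x\<bar>)" if "j \<in> J" for j k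
    using integrable_moll[OF s(1) f[OF that]] f[OF that] by auto
  have "\<exists>q::nat\<Rightarrow>nat. strict_mono q \<and> (AE x in lebesgue. (\<lambda>n. u (q n) x) \<longlonglongrightarrow> 0)"
  proof (rule tendsto_L1_AE_subseq)
    show "integrable lebesgue (u n)" for n
      unfolding u_def by (intro Bochner_Integration.integrable_sum int)
    have "(LINT x|lebesgue. norm (u n x)) = (\<Sum>j\<in>J. LINT x|lebesgue. \<bar>moll (s n) (f j) x - f j x\<bar>)" for n
      unfolding u_def by (simp add: Bochner_Integration.integral_sum int sum_nonneg)
    moreover have "(\<lambda>n. \<Sum>j\<in>J. LINT x|lebesgue. \<bar>moll (s n) (f j) x - f j x\<bar>) \<longlonglongrightarrow> (\<Sum>j\<in>J. 0)"
      by (intro tendsto_sum L1)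
    ultimately show "(\<lambda>n. LINT x|lebesgue. norm (u n x)) \<longlonglongrightarrow> 0" by simp
  qed
  then obtain q :: "nat \<Rightarrow> nat" where q: "strict_mono q" "AE x in lebesgue. (\<lambda>n. u (q n) x) \<longlonglongrightarrow> 0"
    by blast
  show ?thesis
  proof (intro exI[of _ "\<lambda>k. s (q k)"] conjI ballI)
    show "(\<lambda>k. s (q k)) \<longlonglongrightarrow> 0"
      using LIMSEQ_subseq_LIMSEQ[OF s0 q(1)] by (simp add: o_def)
    fix j assume j: "j \<in> J"
    show "(\<lambda>k. LINT x|lebesgue. \<bar>moll (s (q k)) (f j) x - f j x\<bar>) \<longlonglongrightarrow> 0"
      using LIMSEQ_subseq_LIMSEQ[OF L1[OF j] q(1)] by (simp add: o_def)
    show "AE x in lebesgue. (\<lambda>k. moll (s (q k)) (f j) x) \<longlonglongrightarrow> f j x"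
      using q(2)
    proof eventually_elim
      case (elim x)
      have "(\<lambda>k. moll (s (q k)) (f j) x - f j x) \<longlonglongrightarrow> 0"
      proof (rule Lim_null_comparison[OF _ elim])
        show "\<forall>\<^sub>F k in sequentially. norm (moll (s (q k)) (f j) x - f j x) \<le> u (q k) x"
          using member_le_sum[OF j, of "\<lambda>j. \<bar>moll (s (q k)) (f j) x - f j x\<bar>" for k] \<open>finite J\<close>
          by (auto simp: u_def)
      qed
      then show ?case by (simp add: LIM_zero_iff)
    qed
  qed (use s in auto)
qed

section \<open>Mollification and weak derivatives\<close>

text \<open>Convexity of the n-th power in tangent form, which is Bernoulli's inequality for the
  ratio \<open>t / s\<close>.\<close>

lemma power_tangent_le:
  fixes s t :: real
  assumes "s \<ge> 0" "t \<ge> 0" "n \<ge> 1"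
  shows "s ^ n + real n * s ^ (n - 1) * (t - s) \<le> t ^ n"
proof (cases "s = 0")
  case True
  then show ?thesis using assms by (cases "n = 1") (auto simp: zero_power)
next
  case False
  then have "s > 0" using assms by simp
  have "1 + real n * ((t - s) / s) \<le> (1 + (t - s) / s) ^ n"
    using \<open>s > 0\<close> assms by (intro Bernoulli_inequality) (simp add: field_simps)
  also have "1 + (t - s) / s = t / s"
    using \<open>s > 0\<close> by (simp add: field_simps)
  finally have "s ^ n * (1 + real n * ((t - s) / s)) \<le> s ^ n * (t / s) ^ n"
    using \<open>s > 0\<close> by (intro mult_left_mono) auto
  moreover have "s ^ n * (t / s) ^ n = t ^ n"
    using \<open>s > 0\<close> by (simp add: power_divide)
  moreover have "s ^ n * (1 + real n * ((t - s) / s)) = s ^ n + real n * s ^ (n - 1) * (t - s)"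
    using \<open>s > 0\<close> assms(3) by (cases n) (auto simp: field_simps)
  ultimately show ?thesis by simp
qed

text \<open>Jensen's inequality for the probability density \<open>mker r (x - y)\<close>: the power
  is compared with its tangent at the mean of \<open>\<bar>f\<bar>\<close>.\<close>

lemma moll_power_le:
  fixes f :: "real^'n \<Rightarrow> real"
  assumes r: "r > 0" and n: "n \<ge> 1" and f: "integrable lebesgue f" "integrable lebesgue (\<lambda>x. \<bar>f x\<bar> ^ n)"
  shows "\<bar>moll r f x\<bar> ^ n \<le> moll r (\<lambda>y. \<bar>f y\<bar> ^ n) x"
proof -
  note k = continuous_mker[OF r, of UNIV] mker_eq_0[OF r]
  have i: "integrable lebesgue (\<lambda>y. mker r (x - y) * h y)" if "integrable lebesgue h" for h
    by (rule conv_integrable[OF k that])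
  have fa: "integrable lebesgue (\<lambda>y. \<bar>f y\<bar>)" using f by auto
  define s where "s = moll r (\<lambda>y. \<bar>f y\<bar>) x"
  have s: "s = (LINT y|lebesgue. mker r (x - y) * \<bar>f y\<bar>)"
    by (simp add: s_def moll_def conv_def)
  have s0: "s \<ge> 0"
    unfolding s by (intro integral_nonneg_AE) (simp add: mker_nonneg[OF r])
  have "\<bar>moll r f x\<bar> \<le> (LINT y|lebesgue. norm (mker r (x - y) * f y))"
    unfolding moll_def conv_def using integral_norm_bound[of lebesgue "\<lambda>y. mker r (x - y) * f y"] by simp
  also have "\<dots> = s"
    unfolding s by (simp add: abs_mult mker_nonneg[OF r])
  finally have "\<bar>moll r f x\<bar> ^ n \<le> s ^ n"
    by (intro power_mono) auto
  \<comment> \<open>The tangent is affine, so its average is its value at the mean \<open>s\<close>,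
    namely \<open>s ^ n\<close>.\<close>
  also have "s ^ n = (LINT y|lebesgue. (s ^ n - real n * s ^ (n - 1) * s) * mker r (x - y) +
      (real n * s ^ (n - 1)) * (mker r (x - y) * \<bar>f y\<bar>))"
  proof -
    have "integrable lebesgue (\<lambda>y. (s ^ n - real n * s ^ (n - 1) * s) * mker r (x - y))"
      "integrable lebesgue (\<lambda>y. (real n * s ^ (n - 1)) * (mker r (x - y) * \<bar>f y\<bar>))"
      by (intro integrable_mult_right i[OF fa] integral_mker_shift[OF r])+
    from Bochner_Integration.integral_add[OF this] show ?thesis
      by (simp add: s[symmetric] integral_mker_shift[OF r])
  qed
  also have "\<dots> \<le> (LINT y|lebesgue. mker r (x - y) * \<bar>f y\<bar> ^ n)"
  proof (rule integral_mono)
    show "integrable lebesgue (\<lambda>y. (s ^ n - real n * s ^ (n - 1) * s) * mker r (x - y) +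
      (real n * s ^ (n - 1)) * (mker r (x - y) * \<bar>f y\<bar>))"
      by (intro Bochner_Integration.integrable_add integrable_mult_right i[OF fa] integral_mker_shift[OF r])
    show "integrable lebesgue (\<lambda>y. mker r (x - y) * \<bar>f y\<bar> ^ n)"
      by (rule i[OF f(2)])
    fix y
    have "mker r (x - y) * (s ^ n + real n * s ^ (n - 1) * (\<bar>f y\<bar> - s)) \<le> mker r (x - y) * \<bar>f y\<bar> ^ n"
      by (intro mult_left_mono power_tangent_le mker_nonneg[OF r] s0 n) auto
    then show "(s ^ n - real n * s ^ (n - 1) * s) * mker r (x - y) +
      (real n * s ^ (n - 1)) * (mker r (x - y) * \<bar>f y\<bar>) \<le> mker r (x - y) * \<bar>f y\<bar> ^ n"
      by (simp add: algebra_simps)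
  qed
  finally show ?thesis
    by (simp add: moll_def conv_def)
qed

text \<open>Extension by zero turns a locally integrable function into one integrable on the whole
  space, as convolution requires.\<close>

definition restr :: "(real^'n) set \<Rightarrow> (real^'n \<Rightarrow> real) \<Rightarrow> real^'n \<Rightarrow> real" where
  "restr S f x = indicator S x * f x"

lemma restr_in [simp]: "x \<in> S \<Longrightarrow> restr S f x = f x" and restr_out [simp]: "x \<notin> S \<Longrightarrow> restr S f x = 0"
  by (simp_all add: restr_def)

section \<open>Local Lebesgue spaces through compact restrictions\<close>

lemma Lp_compact_iff:
  assumes "compact C"
  shows "f \<in> Lp p C \<longleftrightarrow> restr C f \<in> borel_measurable lebesgue \<and>
    integrable lebesgue (\<lambda>x. indicator C x * \<bar>f x\<bar> ^ p)"
proof -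
  have C: "C \<in> sets lebesgue" "C \<inter> space lebesgue \<in> sets lebesgue"
    using assms by (auto simp: lmeasurable_compact fmeasurableD)
  show ?thesis
    unfolding Lp_def restr_def
    using C by (auto simp: borel_measurable_restrict_space_iff integrable_restrict_space)
qed

lemma Lp_loc_iff:
  "f \<in> Lp_loc p U \<longleftrightarrow> (\<forall>C. compact C \<and> C \<subseteq> U \<longrightarrow> restr C f \<in> borel_measurable lebesgue \<and>
    integrable lebesgue (\<lambda>x. indicator C x * \<bar>f x\<bar> ^ p))"
  by (auto simp: Lp_loc_def Lp_compact_iff)

lemma Lp_loc_1_integrable:
  assumes "f \<in> Lp_loc 1 U" "compact C" "C \<subseteq> U"
  shows "integrable lebesgue (restr C f)"
proof (rule Bochner_Integration.integrable_bound)
  show "integrable lebesgue (\<lambda>x. indicator C x * \<bar>f x\<bar> ^ 1)" "restr C f \<in> borel_measurable lebesgue"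
    using assms by (auto simp: Lp_loc_iff)
qed (auto simp: restr_def abs_mult)

lemma Lp_loc_integrable_power:
  assumes "f \<in> Lp_loc p U" "compact C" "C \<subseteq> U" "p \<ge> 1"
  shows "integrable lebesgue (\<lambda>x. \<bar>restr C f x\<bar> ^ p)"
proof -
  have "(\<lambda>x. \<bar>restr C f x\<bar> ^ p) = (\<lambda>x. indicator C x * \<bar>f x\<bar> ^ p)"
    using assms(4) by (auto simp: restr_def indicator_def fun_eq_iff zero_power)
  then show ?thesis using assms by (auto simp: Lp_loc_iff)
qed

lemma Lp_loc_1I:
  assumes "\<And>C. compact C \<Longrightarrow> C \<subseteq> U \<Longrightarrow> integrable lebesgue (restr C f)"
  shows "f \<in> Lp_loc 1 U"
  unfolding Lp_loc_iff
proof (intro allI impI)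
  fix C assume C: "compact C \<and> C \<subseteq> U"
  then have "integrable lebesgue (\<lambda>x. \<bar>restr C f x\<bar>)" "restr C f \<in> borel_measurable lebesgue"
    using assms[of C] by auto
  moreover have "(\<lambda>x. \<bar>restr C f x\<bar>) = (\<lambda>x. indicator C x * \<bar>f x\<bar> ^ 1)"
    by (auto simp: restr_def indicator_def)
  ultimately show "restr C f \<in> borel_measurable lebesgue \<and> integrable lebesgue (\<lambda>x. indicator C x * \<bar>f x\<bar> ^ 1)"
    by simp
qed

text \<open>An open set is a countable union of compact subsets, and countably many null sets can be
  collected.\<close>

lemma AE_lebesgue_on_open:
  fixes U :: "(real^'n) set"
  assumes "open U" "\<And>S. compact S \<Longrightarrow> S \<subseteq> U \<Longrightarrow> AE x in lebesgue. x \<in> S \<longrightarrow> P x"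
  shows "AE x in lebesgue_on U. P x"
proof -
  have "\<exists>D :: nat \<Rightarrow> (real^'n) set. (\<forall>n. compact (D n) \<and> D n \<subseteq> U) \<and> \<Union> (range D) = U"
  proof (rule open_Union_compact_subsets[OF assms(1)])
    fix D :: "nat \<Rightarrow> (real^'n) set"
    assume "\<And>n. compact (D n)" "\<And>n. D n \<subseteq> U" "\<Union> (range D) = U"
    then show ?thesis by (intro exI[of _ D]) simp
  qed
  then obtain D :: "nat \<Rightarrow> (real^'n) set" where D: "\<forall>n. compact (D n) \<and> D n \<subseteq> U" "\<Union> (range D) = U"
    by (elim exE conjE)
  have "AE x in lebesgue. \<forall>n. x \<in> D n \<longrightarrow> P x"
    unfolding AE_all_countable using assms(2) D by blast
  then have "AE x in lebesgue. x \<in> U \<longrightarrow> P x"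
    by eventually_elim (use D(2) in blast)
  moreover have "U \<inter> space lebesgue \<in> sets lebesgue" using assms(1) by auto
  ultimately show ?thesis by (subst AE_restrict_space_iff) auto
qed

lemma AE_lebesgue_on_iff:
  assumes "open (U :: (real^'n) set)"
  shows "(AE x in lebesgue_on U. P x) \<longleftrightarrow> (AE x in lebesgue. x \<in> U \<longrightarrow> P x)"
  by (subst AE_restrict_space_iff) (use assms in auto)

text \<open>Makes room for mollification: for radii below \<open>d\<close>, a mollification at a
  point of \<open>S\<close> only uses values on the compact set \<open>T\<close>.\<close>

lemma compact_enlarge:
  fixes S :: "(real^'n) set"
  assumes "compact S" "open U" "S \<subseteq> U"
  obtains T d where "d > 0" "compact T" "T \<subseteq> U" "\<forall>x\<in>S. cball x d \<subseteq> T"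
proof (cases "S = {}")
  case True
  then show ?thesis using that[of 1 "{}"] by auto
next
  case False
  obtain e where e: "e > 0" "(\<Union>x\<in>S. cball x e) \<subseteq> U"
    using compact_subset_open_imp_cball_epsilon_subset[OF assms] by auto
  have "compact {x + y | x y. x \<in> S \<and> y \<in> cball 0 e}"
    using assms(1) by (intro compact_sums) auto
  moreover have "{x + y | x y. x \<in> S \<and> y \<in> cball 0 e} = (\<Union>x\<in>S. cball x e)"
  proof (intro set_eqI iffI)
    fix z assume "z \<in> (\<Union>x\<in>S. cball x e)"
    then obtain x where x: "x \<in> S" "dist x z \<le> e" by auto
    then have "z = x + (z - x)" "z - x \<in> cball 0 e" by (auto simp: dist_norm norm_minus_commute)
    with x show "z \<in> {x + y | x y. x \<in> S \<and> y \<in> cball 0 e}" by blast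
  next
    fix z assume "z \<in> {x + y | x y. x \<in> S \<and> y \<in> cball 0 e}"
    then obtain x y where "x \<in> S" "norm y \<le> e" "z = x + y" by auto
    then show "z \<in> (\<Union>x\<in>S. cball x e)" by (intro UN_I[of x]) (auto simp: dist_norm)
  qed
  ultimately show ?thesis using that[of e "\<Union>x\<in>S. cball x e"] e by auto
qed

text \<open>Testing a weak derivative with the first function mollifies it; the second allows one
  more derivative to be moved over.\<close>

lemma test_mker:
  fixes x :: "real^'n"
  assumes "r > 0" "cball x r \<subseteq> U"
  shows "(\<lambda>y. mker r (x - y)) \<in> test_functions U" "(\<lambda>y. gker r (x - y) $ i) \<in> test_functions U"
proof -
  have supp: "closure {y. f y \<noteq> 0} \<subseteq> cball x r" if "\<And>y. norm (x - y) \<ge> r \<Longrightarrow> f y = 0" for f :: "real^'n \<Rightarrow> real"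
    by (rule closure_minimal) (use that in \<open>force simp: dist_norm\<close>, simp)
  have test: "f \<in> test_functions U" if "flat_fam f" "\<And>y. norm (x - y) \<ge> r \<Longrightarrow> f y = 0" for f :: "real^'n \<Rightarrow> real"
  proof -
    note s = supp[of f, OF that(2)]
    then have "bounded (closure {y. f y \<noteq> 0})" by (rule bounded_subset[OF bounded_cball])
    then have "compact (closure {y. f y \<noteq> 0})"
      by (simp only: compact_eq_bounded_closed closed_closure conj_absorb simp_thms)
    then show ?thesis
      unfolding test_functions_def using Ck_flat_fam[OF that(1)] s assms(2) by blast
  qed
  show "(\<lambda>y. mker r (x - y)) \<in> test_functions U"
    by (rule test[OF flat_fam_mker_shift[OF assms(1)]]) (rule mker_eq_0[OF assms(1)])
  obtain G where G: "\<And>y. ((\<lambda>y. mker r (x - y)) has_derivative (\<lambda>h. G y \<bullet> h)) (at y)"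
      "\<And>i. flat_fam (\<lambda>y. G y $ i)"
    using flat_fam_derivative[OF flat_fam_mker_shift[OF assms(1), of x]] by blast
  have "G y $ i = - gker r (x - y) $ i" for y
    using partial_deriv_eq[OF G(1)] partial_deriv_mker_shift[OF assms(1)] by metis
  then have "flat_fam (\<lambda>y. gker r (x - y) $ i)"
    using flat_fam.scale[OF G(2)[of i], of "-1"] by simp
  then show "(\<lambda>y. gker r (x - y) $ i) \<in> test_functions U"
    by (rule test) (simp add: gker_eq_0[OF assms(1)])
qed

lemma LINT_local:
  fixes f g :: "real^'n \<Rightarrow> real"
  assumes "U \<in> sets lebesgue" "S \<subseteq> U" "\<And>y. y \<notin> S \<Longrightarrow> g y = 0"
  shows "(LINT y|lebesgue_on U. f y * g y) = (LINT y|lebesgue. restr S f y * g y)"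
proof -
  have "(LINT y|lebesgue_on U. f y * g y) = (LINT y|lebesgue. indicator U y *\<^sub>R (f y * g y))"
    using assms(1) by (intro integral_restrict_space) auto
  also have "\<dots> = (LINT y|lebesgue. restr S f y * g y)"
    using assms(2,3) by (intro Bochner_Integration.integral_cong) (auto simp: restr_def indicator_def)
  finally show ?thesis .
qed

text \<open>The kernel as a function of \<open>y\<close> is a test function with derivative
  \<open>- gker\<close>, and the two minus signs cancel. Combined with \<open>moll_smooth\<close>:
  the gradient of a mollification is the mollification of the weak gradient wherever the ball fits
  into \<open>S\<close>.\<close>

lemma weak_deriv_moll:
  assumes w: "has_weak_deriv U i f g" and "open U" "S \<subseteq> U" "r > 0" "cball x r \<subseteq> S"
  shows "conv (\<lambda>z. gker r z $ i) (restr S f) x = moll r (restr S g) x"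
proof -
  have U: "U \<in> sets lebesgue" using assms(2) by auto
  have x: "y \<in> S" if "norm (x - y) < r" for y
    using assms(5) that by (auto simp: dist_norm subset_iff)
  have m0: "mker r (x - y) = 0" "gker r (x - y) $ i = 0" if "y \<notin> S" for y
  proof -
    have "norm (x - y) \<ge> r" using x[of y] that by linarith
    then show "mker r (x - y) = 0" "gker r (x - y) $ i = 0"
      by (simp_all add: mker_eq_0[OF assms(4)] gker_eq_0[OF assms(4)])
  qed
  have "(\<lambda>y. mker r (x - y)) \<in> test_functions U"
    using assms by (intro test_mker) auto
  then have "(LINT y|lebesgue_on U. f y * partial_deriv i (\<lambda>y. mker r (x - y)) y) =
      - (LINT y|lebesgue_on U. g y * mker r (x - y))"
    using w unfolding has_weak_deriv_def by blast
  moreover have "(LINT y|lebesgue_on U. f y * partial_deriv i (\<lambda>y. mker r (x - y)) y) =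
      - (LINT y|lebesgue. restr S f y * gker r (x - y) $ i)"
    unfolding partial_deriv_mker_shift[OF assms(4)]
    using m0 by (subst LINT_local[OF U assms(3)]) auto
  moreover have "(LINT y|lebesgue_on U. g y * mker r (x - y)) = (LINT y|lebesgue. restr S g y * mker r (x - y))"
    using m0 by (intro LINT_local[OF U assms(3)]) auto
  ultimately show ?thesis
    by (simp add: conv_def moll_def mult.commute)
qed

lemma moll_smooth:
  assumes "r > 0" "integrable lebesgue f"
  shows "(moll r f has_derivative (\<lambda>h. (\<chi> i. conv (\<lambda>z. gker r z $ i) f x) \<bullet> h)) (at x)"
    "continuous_on A (moll r f)" "continuous_on A (conv (\<lambda>z. gker r z $ i) f)"
proof -
  show "(moll r f has_derivative (\<lambda>h. (\<chi> i. conv (\<lambda>z. gker r z $ i) f x) \<bullet> h)) (at x)"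
    unfolding moll_def
    by (rule conv_has_derivative[OF continuous_mker mker_eq_0 continuous_gker gker_eq_0 mker_has_derivative])
      (use assms in auto)
  show "continuous_on A (moll r f)"
    unfolding moll_def by (rule continuous_conv[OF continuous_mker mker_eq_0]) (use assms in auto)
  show "continuous_on A (conv (\<lambda>z. gker r z $ i) f)"
    by (rule continuous_conv[where R = r])
      (auto intro!: continuous_intros continuous_gker assms simp: gker_eq_0[OF assms(1)])
qed

text \<open>The fundamental lemma of the calculus of variations: the mollifications vanish on
  \<open>S\<close> for all small radii, and along some radii they converge to \<open>f\<close>
  almost everywhere.\<close>

lemma AE_zero_if_mker:
  assumes "open U" "f \<in> Lp_loc 1 U"
    and z: "\<And>x r. r > 0 \<Longrightarrow> cball x r \<subseteq> U \<Longrightarrow> (LINT y|lebesgue_on U. f y * mker r (x - y)) = 0"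
  shows "AE x in lebesgue_on U. f x = 0"
proof (rule AE_lebesgue_on_open[OF assms(1)])
  fix S assume S: "compact S" "S \<subseteq> U"
  obtain T d where T: "d > 0" "compact T" "T \<subseteq> U" "\<forall>x\<in>S. cball x d \<subseteq> T"
    by (rule compact_enlarge[OF S(1) assms(1) S(2)])
  have int: "integrable lebesgue (restr T f)"
    using Lp_loc_1_integrable assms(2) T by blast
  obtain r :: "nat \<Rightarrow> real" where r': "\<forall>k. 0 < r k \<and> r k < d"
    and AE: "AE x in lebesgue. (\<lambda>k. moll (r k) (restr T f) x) \<longlonglongrightarrow> restr T f x"
    using moll_tendsto_AE[of "{()}" "\<lambda>_. restr T f" d] int T(1) by auto
  have r: "0 < r k" "r k < d" for k
    using r' by auto
  from AE show "AE x in lebesgue. x \<in> S \<longrightarrow> f x = 0"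
  proof eventually_elim
    case (elim x)
    show ?case
    proof
      assume x: "x \<in> S"
      have "moll (r k) (restr T f) x = 0" for k
      proof -
        have sub: "cball x (r k) \<subseteq> T" using bspec[OF T(4) x] r(2)[of k] by (meson less_imp_le order_trans subset_cball)
        have "(LINT y|lebesgue_on U. f y * mker (r k) (x - y)) = (LINT y|lebesgue. restr T f y * mker (r k) (x - y))"
        proof (rule LINT_local)
          fix y assume "y \<notin> T"
          then have "y \<notin> cball x (r k)" using sub by blast
          then show "mker (r k) (x - y) = 0" by (intro mker_eq_0 r) (auto simp: dist_norm)
        qed (use assms(1) T in auto)
        then show ?thesis
          using z[OF r(1)[of k], of x] sub T(3) by (simp add: moll_def conv_def mult.commute)
      qed
      then have "restr T f x = 0" using elim by (simp add: LIMSEQ_const_iff)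
      moreover have "x \<in> T" using T(1,4) x by fastforce
      ultimately show "f x = 0" by simp
    qed
  qed
qed

section \<open>Calculus of weak derivatives\<close>

lemma restr_diff: "restr C (\<lambda>x. f x - g x) = (\<lambda>x. restr C f x - restr C g x)"
  by (auto simp: restr_def algebra_simps)

lemma Lp_loc_dominated:
  assumes g: "g \<in> Lp_loc p U" and f: "\<And>C. compact C \<Longrightarrow> C \<subseteq> U \<Longrightarrow> restr C f \<in> borel_measurable lebesgue"
    and le: "\<And>x. \<bar>f x\<bar> ^ p \<le> c * \<bar>g x\<bar> ^ p"
  shows "f \<in> Lp_loc p U"
  unfolding Lp_loc_iff
proof (intro allI impI conjI)
  fix C assume C: "compact C \<and> C \<subseteq> U"
  then show 1: "restr C f \<in> borel_measurable lebesgue" using f by blast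
  have Cm [measurable]: "C \<in> sets lebesgue" using C by (auto simp: lmeasurable_compact fmeasurableD)
  have "(\<lambda>x. indicator C x * \<bar>restr C f x\<bar> ^ p) = (\<lambda>x. indicator C x * \<bar>f x\<bar> ^ p)"
    by (auto simp: restr_def indicator_def)
  moreover have "(\<lambda>x. indicator C x * \<bar>restr C f x\<bar> ^ p) \<in> borel_measurable lebesgue"
    using 1 by measurable
  ultimately have m: "(\<lambda>x. indicator C x * \<bar>f x\<bar> ^ p) \<in> borel_measurable lebesgue" by simp
  have "integrable lebesgue (\<lambda>x. c * (indicator C x * \<bar>g x\<bar> ^ p))"
    using g C unfolding Lp_loc_iff by (intro integrable_mult_right) blast
  then show "integrable lebesgue (\<lambda>x. indicator C x * \<bar>f x\<bar> ^ p)"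
  proof (rule Bochner_Integration.integrable_bound[OF _ m], intro AE_I2)
    fix x
    have "0 \<le> c * \<bar>g x\<bar> ^ p" using le[of x] by (meson abs_ge_zero order_trans zero_le_power)
    then show "norm (indicator C x * \<bar>f x\<bar> ^ p) \<le> norm (c * (indicator C x * \<bar>g x\<bar> ^ p))"
      using le[of x] by (auto simp: indicator_def)
  qed
qed

lemma Lp_loc_measurable: "f \<in> Lp_loc p U \<Longrightarrow> compact C \<Longrightarrow> C \<subseteq> U \<Longrightarrow> restr C f \<in> borel_measurable lebesgue"
  by (auto simp: Lp_loc_iff)

lemma Lp_loc_add:
  assumes f: "f \<in> Lp_loc p U" and g: "g \<in> Lp_loc p U"
  shows "(\<lambda>x. f x + g x) \<in> Lp_loc p U"
  unfolding Lp_loc_iff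
proof (intro allI impI conjI)
  fix C assume C: "compact C \<and> C \<subseteq> U"
  have Cm [measurable]: "C \<in> sets lebesgue" using C by (auto simp: lmeasurable_compact fmeasurableD)
  have "restr C (\<lambda>x. f x + g x) = (\<lambda>x. restr C f x + restr C g x)"
    by (auto simp: restr_def algebra_simps)
  then show 1: "restr C (\<lambda>x. f x + g x) \<in> borel_measurable lebesgue"
    using Lp_loc_measurable[OF f] Lp_loc_measurable[OF g] C by simp
  have "(\<lambda>x. indicator C x * \<bar>restr C (\<lambda>x. f x + g x) x\<bar> ^ p) = (\<lambda>x. indicator C x * \<bar>f x + g x\<bar> ^ p)"
    by (auto simp: restr_def indicator_def)
  moreover have "(\<lambda>x. indicator C x * \<bar>restr C (\<lambda>x. f x + g x) x\<bar> ^ p) \<in> borel_measurable lebesgue"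
    using 1 by measurable
  ultimately have m: "(\<lambda>x. indicator C x * \<bar>f x + g x\<bar> ^ p) \<in> borel_measurable lebesgue" by simp
  have "integrable lebesgue (\<lambda>x. 2 ^ p * (indicator C x * \<bar>f x\<bar> ^ p + indicator C x * \<bar>g x\<bar> ^ p))"
    using f g C unfolding Lp_loc_iff by (intro integrable_mult_right Bochner_Integration.integrable_add) blast+
  then show "integrable lebesgue (\<lambda>x. indicator C x * \<bar>f x + g x\<bar> ^ p)"
  proof (rule Bochner_Integration.integrable_bound[OF _ m], intro AE_I2)
    fix x
    \<comment> \<open>Bounding the sum by twice the maximum gives a quasi-triangle inequality for
      every exponent.\<close>
    have "\<bar>f x + g x\<bar> ^ p \<le> (2 * max \<bar>f x\<bar> \<bar>g x\<bar>) ^ p"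
      by (intro power_mono) auto
    also have "\<dots> = 2 ^ p * max \<bar>f x\<bar> \<bar>g x\<bar> ^ p" by (rule power_mult_distrib)
    also have "\<dots> \<le> 2 ^ p * (\<bar>f x\<bar> ^ p + \<bar>g x\<bar> ^ p)"
      by (intro mult_left_mono) (auto simp: max_def)
    finally show "norm (indicator C x * \<bar>f x + g x\<bar> ^ p) \<le>
      norm (2 ^ p * (indicator C x * \<bar>f x\<bar> ^ p + indicator C x * \<bar>g x\<bar> ^ p))"
      by (simp add: indicator_def)
  qed
qed

lemma Lp_loc_cmult:
  assumes f: "f \<in> Lp_loc p U"
  shows "(\<lambda>x. c * f x) \<in> Lp_loc p U"
proof (rule Lp_loc_dominated[OF f, where c = "\<bar>c\<bar> ^ p"])
  fix C assume C: "compact C" "C \<subseteq> U"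
  have "restr C (\<lambda>x. c * f x) = (\<lambda>x. c * restr C f x)" by (auto simp: restr_def)
  then show "restr C (\<lambda>x. c * f x) \<in> borel_measurable lebesgue"
    using Lp_loc_measurable[OF f C] by simp
qed (simp add: abs_mult power_mult_distrib)

lemma Lp_loc_abs:
  assumes f: "f \<in> Lp_loc p U"
  shows "(\<lambda>x. \<bar>f x\<bar>) \<in> Lp_loc p U"
proof (rule Lp_loc_dominated[OF f, where c = 1])
  fix C assume C: "compact C" "C \<subseteq> U"
  have "restr C (\<lambda>x. \<bar>f x\<bar>) = (\<lambda>x. \<bar>restr C f x\<bar>)" by (auto simp: restr_def indicator_def)
  then show "restr C (\<lambda>x. \<bar>f x\<bar>) \<in> borel_measurable lebesgue"
    using Lp_loc_measurable[OF f C] by simp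
qed simp

lemma Lp_loc_const: "(\<lambda>x. c) \<in> Lp_loc p U"
  unfolding Lp_loc_iff
proof (intro allI impI)
  fix C assume C: "compact C \<and> C \<subseteq> U"
  then have "C \<in> lmeasurable" by (simp add: lmeasurable_compact)
  then have Cm: "C \<in> sets lebesgue" "emeasure lebesgue C < \<infinity>"
    unfolding fmeasurable_def by (simp_all only: mem_Collect_eq)
  then have "integrable lebesgue (indicator C :: _ \<Rightarrow> real)" by (intro integrable_real_indicator)
  then show "restr C (\<lambda>x. c) \<in> borel_measurable lebesgue \<and> integrable lebesgue (\<lambda>x. indicator C x * \<bar>c\<bar> ^ p)"
    unfolding restr_def[abs_def] by (auto intro!: integrable_mult_left)
qed

lemma Lp_loc_sum:
  "finite I \<Longrightarrow> (\<And>i. i \<in> I \<Longrightarrow> f i \<in> Lp_loc p U) \<Longrightarrow> (\<lambda>x. \<Sum>i\<in>I. f i x) \<in> Lp_loc p U"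
  by (induction I rule: finite_induct) (auto intro: Lp_loc_const Lp_loc_add)

lemma Lp_loc_diff: "f \<in> Lp_loc p U \<Longrightarrow> g \<in> Lp_loc p U \<Longrightarrow> (\<lambda>x. f x - g x) \<in> Lp_loc p U"
  using Lp_loc_add[of f p U "\<lambda>x. (-1) * g x"] Lp_loc_cmult[of g p U "-1"] by simp

text \<open>Both candidates have the same integral against every mollifying kernel, so
  \<open>AE_zero_if_mker\<close> applies to their difference.\<close>

lemma weak_deriv_unique:
  assumes "open U" "has_weak_deriv U i f g" "has_weak_deriv U i f h"
  shows "AE x in lebesgue_on U. g x = h x"
proof -
  have gh: "g \<in> Lp_loc 1 U" "h \<in> Lp_loc 1 U"
    using assms unfolding has_weak_deriv_def by auto
  have U: "U \<in> sets lebesgue" using assms(1) by auto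
  have "AE x in lebesgue_on U. g x - h x = 0"
  proof (rule AE_zero_if_mker[OF assms(1)])
    show "(\<lambda>x. g x - h x) \<in> Lp_loc 1 U"
      by (rule Lp_loc_diff[OF gh])
    fix x :: "real^'a" and r :: real assume r: "r > 0" "cball x r \<subseteq> U"
    have loc: "(LINT y|lebesgue_on U. q y * mker r (x - y)) = (LINT y|lebesgue. restr (cball x r) q y * mker r (x - y))" for q
      by (rule LINT_local[OF U r(2)]) (auto simp: dist_norm intro!: mker_eq_0 r)
    have i: "integrable lebesgue (\<lambda>y. restr (cball x r) q y * mker r (x - y))" if "q \<in> Lp_loc 1 U" for q
      using conv_integrable[OF continuous_mker[OF r(1)] mker_eq_0[OF r(1)] Lp_loc_1_integrable[OF that _ r(2)], where x = x]
      by (simp add: mult.commute)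
    have "(LINT y|lebesgue_on U. g y * mker r (x - y)) = (LINT y|lebesgue_on U. h y * mker r (x - y))"
      using assms(2,3) test_mker(1)[OF r] unfolding has_weak_deriv_def by fastforce
    then have "(LINT y|lebesgue. restr (cball x r) g y * mker r (x - y)) - (LINT y|lebesgue. restr (cball x r) h y * mker r (x - y)) = 0"
      by (simp add: loc)
    then show "(LINT y|lebesgue_on U. (g y - h y) * mker r (x - y)) = 0"
      unfolding loc using Bochner_Integration.integral_diff[OF i[OF gh(1)] i[OF gh(2)]]
      by (simp add: restr_def algebra_simps)
  qed
  then show ?thesis by simp
qed

text \<open>Completeness: a set that differs from a measurable one only by a null set is
  measurable.\<close>

lemma lebesgue_measurable_cong_AE:
  fixes f g :: "'a::euclidean_space \<Rightarrow> real"
  assumes "f \<in> borel_measurable lebesgue" "AE x in lebesgue. f x = g x"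
  shows "g \<in> borel_measurable lebesgue"
proof (rule measurableI)
  fix A :: "real set" assume "A \<in> sets borel"
  then have A: "f -` A \<inter> space lebesgue \<in> sets lebesgue"
    using assms(1) by (rule measurable_sets[rotated])
  show "g -` A \<inter> space lebesgue \<in> sets lebesgue"
    by (rule complete_measure.in_sets_AE[OF completion.complete_measure_axioms _ A]) (use assms(2) in auto)
qed simp

lemma Lp_loc_cong_AE:
  assumes "open U" "f \<in> Lp_loc p U" "AE x in lebesgue_on U. f x = g x"
  shows "g \<in> Lp_loc p U"
  unfolding Lp_loc_iff
proof (intro allI impI)
  fix C assume C: "compact C \<and> C \<subseteq> U"
  have AE: "AE x in lebesgue. x \<in> U \<longrightarrow> f x = g x"
    using assms(3) unfolding AE_lebesgue_on_iff[OF assms(1)] .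
  have f: "restr C f \<in> borel_measurable lebesgue" "integrable lebesgue (\<lambda>x. indicator C x * \<bar>f x\<bar> ^ p)"
    using assms(2) C unfolding Lp_loc_iff by auto
  have "AE x in lebesgue. restr C f x = restr C g x"
    using AE by eventually_elim (use C in \<open>auto simp: restr_def indicator_def\<close>)
  then have 1: "restr C g \<in> borel_measurable lebesgue"
    by (rule lebesgue_measurable_cong_AE[OF f(1)])
  have AE2: "AE x in lebesgue. indicator C x * \<bar>f x\<bar> ^ p = indicator C x * \<bar>g x\<bar> ^ p"
    using AE by eventually_elim (use C in \<open>auto simp: indicator_def\<close>)
  have "(\<lambda>x. indicator C x * \<bar>g x\<bar> ^ p) \<in> borel_measurable lebesgue"
    by (rule lebesgue_measurable_cong_AE[OF borel_measurable_integrable[OF f(2)] AE2])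
  then have "integrable lebesgue (\<lambda>x. indicator C x * \<bar>g x\<bar> ^ p)"
    using f(2) AE2 by (subst integrable_cong_AE[of _ _ "\<lambda>x. indicator C x * \<bar>f x\<bar> ^ p"]) auto
  with 1 show "restr C g \<in> borel_measurable lebesgue \<and> integrable lebesgue (\<lambda>x. indicator C x * \<bar>g x\<bar> ^ p)"
    by simp
qed

lemma linear_eq_inner_vec:
  fixes f :: "real^'n \<Rightarrow> real"
  assumes "linear f"
  shows "f h = (\<chi> i. f (axis i 1)) \<bullet> h"
proof -
  have "f h = f (\<Sum>i\<in>UNIV. h $ i *\<^sub>R axis i 1)"
    using basis_expansion[of h] by (simp add: scalar_mult_eq_scaleR)
  also have "\<dots> = (\<Sum>i\<in>UNIV. h $ i * f (axis i 1))"
    using assms by (simp add: linear_sum linear_cmul)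
  finally show ?thesis by (simp add: inner_vec_def mult.commute)
qed

section \<open>Test functions and integrals against them\<close>

definition supp :: "(real^'n \<Rightarrow> real) \<Rightarrow> (real^'n) set" where
  "supp \<psi> = closure {x. \<psi> x \<noteq> 0}"

lemma test_functionD:
  assumes "\<psi> \<in> test_functions U"
  shows "compact (supp \<psi>)" "supp \<psi> \<subseteq> U" "x \<notin> supp \<psi> \<Longrightarrow> \<psi> x = 0"
    "x \<notin> supp \<psi> \<Longrightarrow> partial_deriv i \<psi> x = 0"
    "continuous_on UNIV \<psi>" "continuous_on UNIV (partial_deriv i \<psi>)"
    "(\<psi> has_derivative (\<lambda>h. (\<chi> i. partial_deriv i \<psi> x) \<bullet> h)) (at x)"
proof -
  show "compact (supp \<psi>)" "supp \<psi> \<subseteq> U"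
    using assms by (auto simp: test_functions_def supp_def)
  have out: "\<psi> x = 0" if "x \<notin> supp \<psi>" for x
  proof (rule ccontr)
    assume "\<psi> x \<noteq> 0"
    then have "x \<in> supp \<psi>" unfolding supp_def by (intro closure_subset[THEN subsetD]) simp
    with that show False by simp
  qed
  then show "x \<notin> supp \<psi> \<Longrightarrow> \<psi> x = 0" .
  have Ck: "Ck k \<psi>" for k
    using assms by (simp add: test_functions_def)
  from Ck[of 0] show "continuous_on UNIV \<psi>" by simp
  from Ck[of 1] show "continuous_on UNIV (partial_deriv i \<psi>)" by simp
  from Ck[of 1] have d: "\<psi> differentiable (at x)" for x
    by (simp add: differentiable_on_def)
  then have "(\<psi> has_derivative frechet_derivative \<psi> (at x)) (at x)"
    by (simp add: frechet_derivative_works)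
  moreover have "frechet_derivative \<psi> (at x) = (\<lambda>h. (\<chi> i. partial_deriv i \<psi> x) \<bullet> h)"
    unfolding partial_deriv_def by (rule ext, rule linear_eq_inner_vec[OF linear_frechet_derivative[OF d]])
  ultimately show "(\<psi> has_derivative (\<lambda>h. (\<chi> i. partial_deriv i \<psi> x) \<bullet> h)) (at x)"
    by simp
  assume x: "x \<notin> supp \<psi>"
  have "((\<lambda>x. 0) has_derivative (\<lambda>h. 0 \<bullet> h)) (at x)" by simp
  then have "(\<psi> has_derivative (\<lambda>h. 0 \<bullet> h)) (at x)"
  proof (rule has_derivative_transform_within_open)
    show "open (- supp \<psi>)" by (simp add: supp_def open_Compl)
    show "x \<in> - supp \<psi>" using x by simp
    show "0 = \<psi> y" if "y \<in> - supp \<psi>" for y using out[of y] that by simp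
  qed
  from partial_deriv_eq[OF this] show "partial_deriv i \<psi> x = 0" by simp
qed

lemma test_LINT:
  assumes "open U" "\<psi> \<in> test_functions U"
  shows "(LINT x|lebesgue_on U. f x * \<psi> x) = (LINT x|lebesgue. restr (supp \<psi>) f x * \<psi> x)"
    "(LINT x|lebesgue_on U. f x * partial_deriv i \<psi> x) = (LINT x|lebesgue. restr (supp \<psi>) f x * partial_deriv i \<psi> x)"
  by (rule LINT_local; use assms test_functionD[OF assms(2)] in auto)+

lemma test_integrable:
  fixes \<psi> :: "real^'n \<Rightarrow> real"
  assumes "\<psi> \<in> test_functions U" "integrable lebesgue f"
  shows "integrable lebesgue (\<lambda>x. f x * \<psi> x)" "integrable lebesgue (\<lambda>x. f x * partial_deriv i \<psi> x)"
proof -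
  note t = test_functionD[OF assms(1)]
  have *: "integrable lebesgue (\<lambda>x. f x * q x)" if q: "continuous_on UNIV q" "\<And>x. x \<notin> supp \<psi> \<Longrightarrow> q x = 0"
    for q :: "real^'n \<Rightarrow> real"
  proof -
    obtain R where R: "supp \<psi> \<subseteq> ball 0 R"
      using compact_imp_bounded[OF t(1)] bounded_subset_ballD by blast
    have "q x = 0" if "norm x \<ge> R" for x
      using that R by (intro q(2)) auto
    then obtain B where B: "\<And>x. norm (q x) \<le> B"
      using compact_support_bounded[OF q(1)] by metis
    have [measurable]: "q \<in> borel_measurable lebesgue" by (rule lebesgue_measurable_cont[OF q(1)])
    have [measurable]: "f \<in> borel_measurable lebesgue" using assms(2) by auto
    show ?thesis
    proof (rule Bochner_Integration.integrable_bound)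
      show "integrable lebesgue (\<lambda>x. B * f x)" using assms(2) by auto
      have "norm (f x * q x) \<le> norm (B * f x)" for x
        using mult_mono[OF order_refl[of "\<bar>f x\<bar>"] B[of x]] order_trans[OF norm_ge_zero B[of x]]
        by (simp add: abs_mult mult.commute)
      then show "AE x in lebesgue. norm (f x * q x) \<le> norm (B * f x)" by simp
    qed simp
  qed
  show "integrable lebesgue (\<lambda>x. f x * \<psi> x)" "integrable lebesgue (\<lambda>x. f x * partial_deriv i \<psi> x)"
    using t by (auto intro!: *)
qed

lemma test_LINT_cong_AE:
  assumes U: "open U" and \<psi>: "\<psi> \<in> test_functions U" and f: "f \<in> Lp_loc 1 U" "g \<in> Lp_loc 1 U"
    and AE: "AE x in lebesgue_on U. f x = g x"
  shows "(LINT x|lebesgue_on U. f x * \<psi> x) = (LINT x|lebesgue_on U. g x * \<psi> x)"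
    "(LINT x|lebesgue_on U. f x * partial_deriv i \<psi> x) = (LINT x|lebesgue_on U. g x * partial_deriv i \<psi> x)"
proof -
  note t = test_functionD[OF \<psi>]
  have "integrable lebesgue (restr (supp \<psi>) f)" "integrable lebesgue (restr (supp \<psi>) g)"
    using Lp_loc_1_integrable f t(1,2) by blast+
  note i = this[THEN test_integrable(1)[OF \<psi>], THEN borel_measurable_integrable]
    this[THEN test_integrable(2)[OF \<psi>], THEN borel_measurable_integrable]
  have "AE x in lebesgue. x \<in> U \<longrightarrow> f x = g x"
    using AE unfolding AE_lebesgue_on_iff[OF U] .
  then have "AE x in lebesgue. restr (supp \<psi>) f x = restr (supp \<psi>) g x"
    by eventually_elim (use t(2) in \<open>auto simp: restr_def indicator_def\<close>)
  then show "(LINT x|lebesgue_on U. f x * \<psi> x) = (LINT x|lebesgue_on U. g x * \<psi> x)"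
    "(LINT x|lebesgue_on U. f x * partial_deriv i \<psi> x) = (LINT x|lebesgue_on U. g x * partial_deriv i \<psi> x)"
    unfolding test_LINT[OF U \<psi>] using i
    by (auto intro!: integral_cong_AE)
qed

text \<open>Lets second derivatives be taken of the representative that \<open>weak_deriv\<close>
  happens to choose.\<close>

lemma has_weak_deriv_cong_AE:
  assumes "open U" "has_weak_deriv U i f g" "f' \<in> Lp_loc 1 U" "AE x in lebesgue_on U. f x = f' x"
  shows "has_weak_deriv U i f' g"
  using assms(2) test_LINT_cong_AE(2)[OF assms(1) _ _ assms(3,4)] assms(3)
  unfolding has_weak_deriv_def by auto

lemma has_weak_deriv_subset:
  assumes "open U" "open V" "V \<subseteq> U" "has_weak_deriv U i f g"
  shows "has_weak_deriv V i f g"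
proof -
  have "Lp_loc 1 U \<subseteq> (Lp_loc 1 V :: ((real^'a) \<Rightarrow> real) set)"
    using assms(3) by (auto simp: Lp_loc_def)
  moreover have "test_functions V \<subseteq> (test_functions U :: ((real^'a) \<Rightarrow> real) set)"
    using assms(3) by (auto simp: test_functions_def)
  ultimately show ?thesis
    using assms unfolding has_weak_deriv_def by (auto simp: test_LINT subset_iff)
qed

lemma has_weak_deriv_diff:
  assumes "open U" "has_weak_deriv U i f g" "has_weak_deriv U i f' g'"
  shows "has_weak_deriv U i (\<lambda>x. f x - f' x) (\<lambda>x. g x - g' x)"
proof -
  have L: "f \<in> Lp_loc 1 U" "f' \<in> Lp_loc 1 U" "g \<in> Lp_loc 1 U" "g' \<in> Lp_loc 1 U"
    using assms unfolding has_weak_deriv_def by auto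
  have "(LINT x|lebesgue_on U. (f x - f' x) * partial_deriv i \<psi> x) = - (LINT x|lebesgue_on U. (g x - g' x) * \<psi> x)"
    if \<psi>: "\<psi> \<in> test_functions U" for \<psi>
  proof -
    note t = test_functionD[OF \<psi>]
    have i: "integrable lebesgue (restr (supp \<psi>) q)" if "q \<in> Lp_loc 1 U" for q
      using Lp_loc_1_integrable that t(1,2) by blast
    have "(LINT x|lebesgue_on U. f x * partial_deriv i \<psi> x) = - (LINT x|lebesgue_on U. g x * \<psi> x)"
      "(LINT x|lebesgue_on U. f' x * partial_deriv i \<psi> x) = - (LINT x|lebesgue_on U. g' x * \<psi> x)"
      using assms(2,3) \<psi> unfolding has_weak_deriv_def by auto
    then show ?thesis
      unfolding test_LINT[OF assms(1) \<psi>] restr_diff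
      using i[OF L(1)] i[OF L(2)] i[OF L(3)] i[OF L(4)]
      by (simp add: left_diff_distrib test_integrable[OF \<psi>])
  qed
  then show ?thesis
    using Lp_loc_diff[OF L(1,2)] Lp_loc_diff[OF L(3,4)] unfolding has_weak_deriv_def by simp
qed

text \<open>Moving both derivatives onto the mollifying kernel reduces the claim to the symmetry of
  the kernel's own second derivatives.\<close>

lemma weak_deriv_symmetric:
  assumes U: "open U" and P: "has_weak_deriv U i f p" "has_weak_deriv U j f q"
    and M: "has_weak_deriv U j p m" "has_weak_deriv U i q m'"
  shows "AE x in lebesgue_on U. m x = m' x"
proof -
  have L: "m \<in> Lp_loc 1 U" "m' \<in> Lp_loc 1 U"
    using M unfolding has_weak_deriv_def by auto
  have "AE x in lebesgue_on U. m x - m' x = 0"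
  proof (rule AE_zero_if_mker[OF U])
    show "(\<lambda>x. m x - m' x) \<in> Lp_loc 1 U"
      by (rule Lp_loc_diff[OF L])
    fix x :: "real^'a" and \<rho> :: real assume \<rho>: "\<rho> > 0" "cball x \<rho> \<subseteq> U"
    let ?\<psi> = "\<lambda>y. mker \<rho> (x - y)" and ?\<theta> = "\<lambda>i y. gker \<rho> (x - y) $ i"
    have \<psi>: "?\<psi> \<in> test_functions U" and \<theta>: "?\<theta> i \<in> test_functions U" for i
      using test_mker[OF \<rho>] by auto
    \<comment> \<open>The first derivative of the kernel is, up to sign, a test function again, so
      the definition applies twice.\<close>
    have *: "(LINT y|lebesgue_on U. m y * ?\<psi> y) = - (LINT y|lebesgue_on U. f y * partial_deriv i (?\<theta> j) y)"
      if "has_weak_deriv U i f p" "has_weak_deriv U j p m" for i j p m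
    proof -
      have "(LINT y|lebesgue_on U. p y * partial_deriv j ?\<psi> y) = - (LINT y|lebesgue_on U. m y * ?\<psi> y)"
        using that(2) \<psi> unfolding has_weak_deriv_def by blast
      moreover have "(LINT y|lebesgue_on U. f y * partial_deriv i (?\<theta> j) y) = - (LINT y|lebesgue_on U. p y * ?\<theta> j y)"
        using that(1) \<theta>[of j] unfolding has_weak_deriv_def by blast
      ultimately show ?thesis
        by (simp add: partial_deriv_mker_shift[OF \<rho>(1)])
    qed
    have "(LINT y|lebesgue_on U. m y * ?\<psi> y) = (LINT y|lebesgue_on U. m' y * ?\<psi> y)"
      using *[OF P(1) M(1)] *[OF P(2) M(2)] partial_deriv_gker_shift_sym[OF \<rho>(1), of i x j] by simp
    moreover have "integrable lebesgue (restr (supp ?\<psi>) m)" "integrable lebesgue (restr (supp ?\<psi>) m')"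
      using Lp_loc_1_integrable L test_functionD(1,2)[OF \<psi>] by blast+
    ultimately show "(LINT y|lebesgue_on U. (m y - m' y) * ?\<psi> y) = 0"
      unfolding test_LINT[OF U \<psi>] restr_diff by (simp add: left_diff_distrib test_integrable[OF \<psi>])
  qed
  then show ?thesis by simp
qed

section \<open>Translations\<close>

lemma distr_lebesgue_translate: "distr lebesgue lebesgue (\<lambda>x. x + h) = (lebesgue :: (real^'n) measure)"
  and measurable_lebesgue_translate: "(\<lambda>x. x + h) \<in> lebesgue \<rightarrow>\<^sub>M (lebesgue :: (real^'n) measure)"
proof -
  have "(\<lambda>x. h + (\<Sum>j\<in>Basis. (1 * (x \<bullet> j)) *\<^sub>R j)) = (\<lambda>x :: real^'n. x + h)"
    by (simp add: euclidean_representation add.commute)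
  then show "distr lebesgue lebesgue (\<lambda>x. x + h) = (lebesgue :: (real^'n) measure)"
    "(\<lambda>x. x + h) \<in> lebesgue \<rightarrow>\<^sub>M (lebesgue :: (real^'n) measure)"
    using lebesgue_affine_euclidean[of "\<lambda>_. 1" h] lebesgue_affine_measurable[of "\<lambda>_. 1" h]
    by (simp_all add: density_1)
qed

lemma LINT_lebesgue_translate:
  fixes f :: "real^'n \<Rightarrow> real"
  assumes "f \<in> borel_measurable lebesgue"
  shows "(LINT x|lebesgue. f (x + h)) = (LINT x|lebesgue. f x)"
    "integrable lebesgue (\<lambda>x. f (x + h)) \<longleftrightarrow> integrable lebesgue f"
    "(\<lambda>x. f (x + h)) \<in> borel_measurable lebesgue"
  using integral_distr[OF measurable_lebesgue_translate[of h] assms]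
    integrable_distr_eq[OF measurable_lebesgue_translate[of h] assms]
    measurable_compose[OF measurable_lebesgue_translate[of h] assms]
  by (simp_all add: distr_lebesgue_translate)

lemma AE_lebesgue_translate:
  assumes "AE x in (lebesgue :: (real^'n) measure). P x"
  shows "AE x in lebesgue. P (x + h)"
proof -
  obtain N :: "(real^'n) set" where N: "{x \<in> space lebesgue. \<not> P x} \<subseteq> N" "N \<in> null_sets lebesgue"
    using assms unfolding eventually_ae_filter by (elim bexE)
  have "(\<lambda>x. x + h) -` N \<inter> space lebesgue \<in> sets lebesgue"
    using N(2) by (intro measurable_sets[OF measurable_lebesgue_translate]) auto
  moreover have "emeasure lebesgue ((\<lambda>x. x + h) -` N \<inter> space lebesgue) = emeasure (distr lebesgue lebesgue (\<lambda>x. x + h)) N"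
    using N(2) by (intro emeasure_distr[symmetric] measurable_lebesgue_translate) auto
  ultimately have "(\<lambda>x. x + h) -` N \<inter> space lebesgue \<in> null_sets lebesgue"
    using N(2) unfolding distr_lebesgue_translate by (auto simp: null_sets_def)
  then show ?thesis
    by (rule AE_I') (use N(1) in auto)
qed

text \<open>Shifting a test function on \<open>V\<close> forward by \<open>h\<close> gives a test
  function on \<open>U\<close>, and translation invariance carries the two integrals over. This is
  what makes a translate of \<open>u\<close> comparable with \<open>u\<close>.\<close>

lemma has_weak_deriv_translate:
  assumes U: "open U" and w: "has_weak_deriv U i f g" and V: "V = (\<lambda>x. x + h) -` U"
  shows "has_weak_deriv V i (\<lambda>x. f (x + h)) (\<lambda>x. g (x + h))"
proof -
  have oV: "open V"
    unfolding V by (intro open_vimage U continuous_intros)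
  have compact_shift: "compact ((\<lambda>x. x + h) ` C)" if "compact C" for C :: "(real^'a) set"
    using that by (intro compact_continuous_image continuous_intros)
  have restr_shift: "restr C (\<lambda>x. f (x + h)) x = restr ((\<lambda>x. x + h) ` C) f (x + h)" for C x and f :: "real^'a \<Rightarrow> real"
    by (auto simp: restr_def indicator_def image_iff)
  have L: "(\<lambda>x. f (x + h)) \<in> Lp_loc 1 V" if f: "f \<in> Lp_loc 1 U" for f :: "real^'a \<Rightarrow> real"
  proof (rule Lp_loc_1I)
    fix C assume C: "compact C" "C \<subseteq> V"
    have "integrable lebesgue (restr ((\<lambda>x. x + h) ` C) f)"
      by (rule Lp_loc_1_integrable[OF f compact_shift[OF C(1)]]) (use C(2) V in auto)
    then show "integrable lebesgue (restr C (\<lambda>x. f (x + h)))"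
      unfolding restr_shift[abs_def] by (subst LINT_lebesgue_translate(2)) auto
  qed
  have fg: "f \<in> Lp_loc 1 U" "g \<in> Lp_loc 1 U"
    using w unfolding has_weak_deriv_def by auto
  have "(LINT x|lebesgue_on V. f (x + h) * partial_deriv i \<psi> x) = - (LINT x|lebesgue_on V. g (x + h) * \<psi> x)"
    if \<psi>: "\<psi> \<in> test_functions V" for \<psi>
  proof -
    note t = test_functionD[OF \<psi>]
    let ?\<psi> = "\<lambda>y. \<psi> (y - h)"
    have der: "((\<lambda>y. \<phi> (y - h)) has_derivative frechet_derivative \<phi> (at (y - h))) (at y)"
      if "\<phi> differentiable_on UNIV" for \<phi> :: "real^'a \<Rightarrow> real" and y
    proof -
      have "(\<phi> has_derivative frechet_derivative \<phi> (at (y - h))) (at (y - h))"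
        using that by (simp add: differentiable_on_def frechet_derivative_works)
      moreover have "((\<lambda>y. y - h) has_derivative (\<lambda>k. k)) (at y)"
        using has_derivative_diff[OF has_derivative_ident has_derivative_const, of h "at y"] by simp
      ultimately show ?thesis
        by (rule has_derivative_compose[where f = "\<lambda>y. y - h", rotated])
    qed
    have pd: "partial_deriv i (\<lambda>y. \<phi> (y - h)) = (\<lambda>y. partial_deriv i \<phi> (y - h))"
      if "\<phi> differentiable_on UNIV" for \<phi> :: "real^'a \<Rightarrow> real" and i
      using frechet_derivative_at[OF der[OF that]] by (simp add: partial_deriv_def fun_eq_iff)
    have Ck_shift: "Ck k (\<lambda>y. \<phi> (y - h))" if "Ck k \<phi>" for k and \<phi> :: "real^'a \<Rightarrow> real"
      using that
    proof (induction k arbitrary: \<phi>)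
      case 0
      then show ?case by (auto intro!: continuous_on_compose2[of UNIV \<phi>] continuous_intros)
    next
      case (Suc k)
      then have d: "\<phi> differentiable_on UNIV" by simp
      have "(\<lambda>y. \<phi> (y - h)) differentiable (at y)" for y
        using der[OF d] by (rule differentiableI)
      then show ?case
        using Suc by (simp add: pd[OF d] differentiable_on_def)
    qed
    have supp_shift: "closure {y. ?\<psi> y \<noteq> 0} \<subseteq> (\<lambda>x. x + h) ` supp \<psi>"
    proof (rule closure_minimal)
      show "{y. ?\<psi> y \<noteq> 0} \<subseteq> (\<lambda>x. x + h) ` supp \<psi>"
      proof
        fix y assume "y \<in> {y. ?\<psi> y \<noteq> 0}"
        then have "y - h \<in> supp \<psi>" using t(3)[of "y - h"] by auto
        then show "y \<in> (\<lambda>x. x + h) ` supp \<psi>" by (intro image_eqI[of _ _ "y - h"]) auto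
      qed
      show "closed ((\<lambda>x. x + h) ` supp \<psi>)"
        using compact_shift[OF t(1)] compact_imp_closed by blast
    qed
    have sub: "(\<lambda>x. x + h) ` supp \<psi> \<subseteq> U" using t(2) V by auto
    have "compact (closure {y. ?\<psi> y \<noteq> 0})"
      using compact_Int_closed[OF compact_shift[OF t(1)] closed_closure, of "{y. ?\<psi> y \<noteq> 0}"] supp_shift
      by (simp add: Int_absorb1)
    then have test: "?\<psi> \<in> test_functions U"
      using Ck_shift \<psi> supp_shift sub unfolding test_functions_def by blast
    have d: "\<psi> differentiable_on UNIV"
      using t(7) by (auto simp: differentiable_on_def differentiable_def)
    let ?S = "(\<lambda>x. x + h) ` supp \<psi>"
    have out: "?\<psi> y = 0" "partial_deriv i \<psi> (y - h) = 0" if "y \<notin> ?S" for y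
    proof -
      have "y - h \<notin> supp \<psi>" using that by (auto simp: image_iff)
      then show "?\<psi> y = 0" "partial_deriv i \<psi> (y - h) = 0" using t(3,4) by auto
    qed
    have U': "U \<in> sets lebesgue" using U by auto
    have mU: "restr ?S q \<in> borel_measurable lebesgue" if "q \<in> Lp_loc 1 U" for q
      using Lp_loc_1_integrable[OF that compact_shift[OF t(1)] sub] by auto
    have m2: "(\<lambda>y. \<psi> (y - h)) \<in> borel_measurable lebesgue" "(\<lambda>y. partial_deriv i \<psi> (y - h)) \<in> borel_measurable lebesgue"
      by (auto intro!: lebesgue_measurable_cont continuous_intros continuous_on_compose2[OF t(5)]
          continuous_on_compose2[OF t(6)])
    have "(LINT x|lebesgue_on U. f x * partial_deriv i ?\<psi> x) = - (LINT x|lebesgue_on U. g x * ?\<psi> x)"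
      using w test unfolding has_weak_deriv_def by blast
    then have "(LINT x|lebesgue. restr ?S f x * partial_deriv i \<psi> (x - h)) = - (LINT x|lebesgue. restr ?S g x * ?\<psi> x)"
      unfolding pd[OF d] using LINT_local[OF U' sub] out by simp
    moreover have "(LINT x|lebesgue. restr ?S f x * partial_deriv i \<psi> (x - h)) =
        (LINT x|lebesgue_on V. f (x + h) * partial_deriv i \<psi> x)"
      using LINT_lebesgue_translate(1)[OF borel_measurable_times[OF mU[OF fg(1)] m2(2)], of h]
      unfolding test_LINT[OF oV \<psi>] restr_shift by simp
    moreover have "(LINT x|lebesgue. restr ?S g x * ?\<psi> x) = (LINT x|lebesgue_on V. g (x + h) * \<psi> x)"
      using LINT_lebesgue_translate(1)[OF borel_measurable_times[OF mU[OF fg(2)] m2(1)], of h]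
      unfolding test_LINT[OF oV \<psi>] restr_shift by simp
    ultimately show ?thesis by simp
  qed
  then show ?thesis
    using L fg unfolding has_weak_deriv_def by auto
qed

text \<open>By translation invariance every difference quotient of \<open>f\<close> has integral 0;
  dominated convergence passes this to the partial derivative.\<close>

lemma integral_gradient_zero:
  fixes f :: "real^'n \<Rightarrow> real"
  assumes der: "\<And>x. (f has_derivative (\<lambda>h. G x \<bullet> h)) (at x)" and G: "continuous_on UNIV G"
    and f0: "\<And>x. norm x \<ge> R \<Longrightarrow> f x = 0"
  shows "(LINT x|lebesgue. G x $ i) = 0"
proof -
  define e :: "real^'n" where "e = axis i 1"
  have e: "norm e = 1" by (simp add: e_def)
  have f: "continuous_on UNIV f"
    using der by (auto intro!: continuous_at_imp_continuous_on has_derivative_continuous)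
  \<comment> \<open>The radius grows by 1 so that \<open>f\<close> vanishes on a neighbourhood of
    the point; the same margin absorbs steps of length at most 1 below.\<close>
  have G0: "G x = 0" if "norm x \<ge> R + 1" for x
  proof -
    have "((\<lambda>x. 0) has_derivative (\<lambda>h. 0 \<bullet> h)) (at x)" by simp
    then have "(f has_derivative (\<lambda>h. 0 \<bullet> h)) (at x)"
    proof (rule has_derivative_transform_within_open)
      show "open {x. norm x > R}" by (intro open_Collect_less continuous_intros)
      show "x \<in> {x. norm x > R}" using that by simp
    qed (use f0 in auto)
    from partial_deriv_eq[OF this] partial_deriv_eq[OF der[of x]] show "G x = 0"
      by (simp add: vec_eq_iff)
  qed
  obtain B where B: "B > 0" "\<And>x. norm (G x) \<le> B"
    using compact_support_bounded[OF G G0] by metis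
  define s where "s k = 1 / real (Suc k)" for k
  have s: "0 < s k" "s k \<le> 1" for k by (auto simp: s_def)
  have s0: "s \<longlonglongrightarrow> 0"
    unfolding s_def by (rule LIMSEQ_Suc[OF lim_1_over_n])
  define q where "q k x = (f (x + s k *\<^sub>R e) - f x) / s k" for k x
  have fm: "f \<in> borel_measurable borel" by (rule borel_measurable_continuous_onI[OF f])
  have fi: "integrable lborel f" by (rule integrable_compact_support[OF f f0])
  have "(LINT x|lborel. q k x) = 0" for k
    unfolding q_def using lebesgue_integral_translate[OF fm, of "s k *\<^sub>R e"] fi by simp
  moreover have "(\<lambda>k. LINT x|lborel. q k x) \<longlonglongrightarrow> (LINT x|lborel. G x $ i)"
  proof (rule integral_dominated_convergence)
    show "(\<lambda>x. G x $ i) \<in> borel_measurable lborel"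
      using G by (auto intro!: borel_measurable_continuous_onI continuous_intros)
    show "q k \<in> borel_measurable lborel" for k
      unfolding q_def using s(1)[of k]
      by (auto intro!: borel_measurable_continuous_onI continuous_intros continuous_on_compose2[OF f] f)
    show "integrable lborel (\<lambda>x. B * indicat_real (cball 0 (R + 1)) (x :: real^'n))"
      by (intro integrable_mult_right integrable_real_indicator)
        (use emeasure_bounded_finite[of "cball (0 :: real^'n) (R + 1)"] in auto)
    show "AE x in lborel. (\<lambda>k. q k x) \<longlonglongrightarrow> G x $ i"
    proof (rule AE_I2)
      fix x
      have "((\<lambda>t. f (x + t *\<^sub>R e)) has_derivative (\<lambda>t. G x \<bullet> (t *\<^sub>R e))) (at 0)"
        by (rule has_derivative_compose[where f = "\<lambda>t. x + t *\<^sub>R e"]) (auto intro!: derivative_eq_intros simp: der)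
      then have "((\<lambda>t. f (x + t *\<^sub>R e)) has_real_derivative G x $ i) (at 0)"
        by (simp add: has_field_derivative_def e_def inner_axis mult_commute_abs)
      then have "(\<lambda>t. (f (x + t *\<^sub>R e) - f x) / t) \<midarrow>0\<rightarrow> G x $ i"
        by (simp add: DERIV_def)
      moreover have "filterlim s (at 0) sequentially"
        using s0 s(1) by (auto simp: filterlim_at less_imp_neq[OF s(1), symmetric])
      ultimately show "(\<lambda>k. q k x) \<longlonglongrightarrow> G x $ i"
        unfolding q_def by (rule filterlim_compose)
    qed
    show "AE x in lborel. norm (q k x) \<le> B * indicator (cball 0 (R + 1)) x" for k
    proof (rule AE_I2)
      fix x
      show "norm (q k x) \<le> B * indicator (cball 0 (R + 1)) x"
      proof (cases "x \<in> cball 0 (R + 1)")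
        case True
        have "norm (f (x + s k *\<^sub>R e) - f x) \<le> B * norm (x + s k *\<^sub>R e - x)"
        proof (rule differentiable_bound[OF convex_UNIV])
          show "onorm (\<lambda>h. G y \<bullet> h) \<le> B" for y
            using B by (intro onorm_bound) (auto intro!: order_trans[OF Cauchy_Schwarz_ineq2] mult_right_mono)
        qed (use der in \<open>auto intro: has_derivative_at_withinI\<close>)
        also have "\<dots> = B * s k" using e s[of k] by simp
        finally show ?thesis using True s(1)[of k] by (simp add: q_def field_simps)
      next
        case False
        have "norm x \<le> norm (x + s k *\<^sub>R e) + norm (s k *\<^sub>R e)"
          by (metis add_diff_cancel norm_triangle_ineq4)
        then have "norm (x + s k *\<^sub>R e) \<ge> R" using False e s[of k] by simp
        then show ?thesis using f0 False by (simp add: q_def)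
      qed
    qed
  qed
  ultimately have "(\<lambda>k. 0) \<longlonglongrightarrow> (LINT x|lborel. G x $ i)"
    by simp
  then have "(LINT x|lborel. G x $ i) = 0"
    by (simp add: LIMSEQ_const_iff)
  then show ?thesis
    using G by (subst integral_completion) (auto intro!: borel_measurable_continuous_onI continuous_intros)
qed

text \<open>\<open>U\<close> and the complement of \<open>T\<close> are open and cover the space,
  and on the latter everything is 0. Hence differentiability on \<open>U\<close> becomes
  differentiability everywhere.\<close>

lemma integral_compact_gradient_zero:
  fixes f :: "real^'n \<Rightarrow> real"
  assumes "open U" "compact T" "T \<subseteq> U"
    and der: "\<And>x. x \<in> U \<Longrightarrow> (f has_derivative (\<lambda>h. G x \<bullet> h)) (at x)" and G: "continuous_on U G"
    and f0: "\<And>x. x \<notin> T \<Longrightarrow> f x = 0" "\<And>x. x \<notin> T \<Longrightarrow> G x = 0"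
  shows "(LINT x|lebesgue. G x $ i) = 0"
proof -
  have oT: "open (- T)" using assms(2) by (simp add: compact_imp_closed open_Compl)
  have "continuous_on (- T) G"
    by (rule continuous_on_eq[OF continuous_on_const]) (use f0 in auto)
  from continuous_on_open_Un[OF assms(1) oT G this] have "continuous_on UNIV G"
    by (rule continuous_on_subset) (use assms(3) in auto)
  moreover obtain R where R: "T \<subseteq> ball 0 R"
    using compact_imp_bounded[OF assms(2)] bounded_subset_ballD by blast
  have "(f has_derivative (\<lambda>h. G x \<bullet> h)) (at x)" for x
  proof (cases "x \<in> T")
    case False
    have "((\<lambda>x. 0) has_derivative (\<lambda>h. G x \<bullet> h)) (at x)"
      using f0(2)[OF False] by simp
    then show ?thesis
      by (rule has_derivative_transform_within_open[OF _ oT]) (use False f0 in auto)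
  qed (use der assms(3) in auto)
  moreover have "f x = 0" if "norm x \<ge> R" for x
    using R that by (intro f0) auto
  ultimately show ?thesis
    by (intro integral_gradient_zero[where f = f and R = R])
qed

text \<open>The product of \<open>u\<close> with a test function is continuously differentiable with
  compact support in \<open>U\<close>, so its gradient integrates to 0; the product rule gives the
  claim.\<close>

lemma classical_has_weak_deriv:
  fixes u :: "real^'n \<Rightarrow> real"
  assumes U: "open U" and der: "\<And>x. x \<in> U \<Longrightarrow> (u has_derivative (\<lambda>h. G x \<bullet> h)) (at x)"
    and G: "continuous_on U G"
  shows "has_weak_deriv U i u (\<lambda>x. G x $ i)"
proof -
  have u: "continuous_on U u"
    using der by (auto intro!: continuous_at_imp_continuous_on has_derivative_continuous)
  have L: "f \<in> Lp_loc 1 U" if "continuous_on U f" for f :: "real^'n \<Rightarrow> real"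
  proof (rule Lp_loc_1I)
    fix C assume C: "compact C" "C \<subseteq> U"
    have "integrable lborel (\<lambda>x. indicator C x *\<^sub>R f x)"
      by (rule borel_integrable_compact[OF C(1)]) (use C that continuous_on_subset in blast)
    then show "integrable lebesgue (restr C f)"
      unfolding restr_def[abs_def] by (subst integrable_completion) auto
  qed
  have Gi: "continuous_on U (\<lambda>x. G x $ i)"
    using G by (intro continuous_intros)
  have "(LINT x|lebesgue_on U. u x * partial_deriv i \<psi> x) = - (LINT x|lebesgue_on U. G x $ i * \<psi> x)"
    if \<psi>: "\<psi> \<in> test_functions U" for \<psi>
  proof -
    note t = test_functionD[OF \<psi>]
    let ?D = "\<lambda>x. \<chi> i. partial_deriv i \<psi> x"
    \<comment> \<open>Nothing is known about \<open>u\<close> and \<open>G\<close> outside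
      \<open>U\<close>, so they are cut off; the other factors vanish there.\<close>
    let ?G = "\<lambda>x. restr (supp \<psi>) u x *\<^sub>R ?D x + \<psi> x *\<^sub>R (if x \<in> U then G x else 0)"
    have out: "?D x = 0" if "x \<notin> supp \<psi>" for x
      using t(4)[OF that] by (simp add: vec_eq_iff)
    have Geq: "?G x = u x *\<^sub>R ?D x + \<psi> x *\<^sub>R G x" if "x \<in> U" for x
      using that out[of x] by (cases "x \<in> supp \<psi>") auto
    have "(LINT x|lebesgue. ?G x $ i) = 0"
    proof (rule integral_compact_gradient_zero[OF U t(1,2)])
      show "((\<lambda>x. u x * \<psi> x) has_derivative (\<lambda>h. ?G x \<bullet> h)) (at x)" if "x \<in> U" for x
        unfolding Geq[OF that]
        by (rule has_derivative_eq_rhs[OF has_derivative_mult[OF der[OF that] t(7)]])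
          (simp add: inner_add_left fun_eq_iff algebra_simps)
      have "continuous_on U ?D"
        by (intro continuous_on_vec_lambda continuous_on_subset[OF t(6)]) auto
      then have "continuous_on U (\<lambda>x. u x *\<^sub>R ?D x + \<psi> x *\<^sub>R G x)"
        by (intro continuous_on_add continuous_on_scaleR u G continuous_on_subset[OF t(5)]) auto
      then show "continuous_on U ?G"
        by (rule continuous_on_eq) (rule Geq[symmetric])
      show "?G x = 0" "u x * \<psi> x = 0" if "x \<notin> supp \<psi>" for x
        using t(3)[OF that] that by auto
    qed
    moreover have "?G x $ i = restr (supp \<psi>) u x * partial_deriv i \<psi> x + restr (supp \<psi>) (\<lambda>x. G x $ i) x * \<psi> x" for x
      using t(2) t(3)[of x] by (cases "x \<in> supp \<psi>") auto
    moreover have "integrable lebesgue (restr (supp \<psi>) u)" "integrable lebesgue (restr (supp \<psi>) (\<lambda>x. G x $ i))"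
      using Lp_loc_1_integrable L[OF u] L[OF Gi] t(1,2) by blast+
    ultimately have "(LINT x|lebesgue. restr (supp \<psi>) u x * partial_deriv i \<psi> x) +
      (LINT x|lebesgue. restr (supp \<psi>) (\<lambda>x. G x $ i) x * \<psi> x) = 0"
      by (subst Bochner_Integration.integral_add[symmetric])
        (simp_all only: test_integrable[OF \<psi>])
    then show ?thesis
      unfolding test_LINT[OF U \<psi>] by (simp add: eq_neg_iff_add_eq_0)
  qed
  then show ?thesis
    using L[OF u] L[OF Gi] unfolding has_weak_deriv_def by auto
qed

section \<open>Weak derivatives on a level set\<close>

lemma abs_inverse_quadratic_le: "\<bar>1 / (1 + s\<^sup>2)\<bar> \<le> (1::real)"
proof -
  have "1 + s\<^sup>2 \<ge> 1" by simp
  then have "1 / (1 + s\<^sup>2) \<le> 1" "1 / (1 + s\<^sup>2) \<ge> 0" by (auto simp only: divide_le_eq_1 zero_le_divide_iff)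
  then show ?thesis by linarith
qed

text \<open>With \<open>h(t) = \<epsilon> arctan (t / \<epsilon>)\<close> one has \<open>\<integral> h'(w) g \<psi> = - \<integral> h(w) \<partial>\<^sub>i\<psi>\<close>. As \<open>\<epsilon> \<rightarrow> 0\<close> the right-hand
  side vanishes, while \<open>h'(w)\<close> converges to the indicator of \<open>{w = 0}\<close>.\<close>

lemma weak_deriv_zero_set:
  fixes w :: "real^'n \<Rightarrow> real"
  assumes U: "open U" and wg: "has_weak_deriv U i w g"
  shows "AE x in lebesgue_on U. w x = 0 \<longrightarrow> g x = 0"
proof -
  have L: "w \<in> Lp_loc 1 U" "g \<in> Lp_loc 1 U"
    using wg unfolding has_weak_deriv_def by auto
  define z where "z = (\<lambda>x. if w x = 0 then g x else 0)"
  have "AE x in lebesgue_on U. z x = 0"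
  proof (rule AE_zero_if_mker[OF U])
    show zL: "z \<in> Lp_loc 1 U"
    proof (rule Lp_loc_1I)
      fix C assume C: "compact C" "C \<subseteq> U"
      have i: "integrable lebesgue (restr C w)" "integrable lebesgue (restr C g)"
        using L C Lp_loc_1_integrable by blast+
      then have [measurable]: "restr C w \<in> borel_measurable lebesgue" "restr C g \<in> borel_measurable lebesgue"
        by auto
      have "restr C z = (\<lambda>x. if restr C w x = 0 then restr C g x else 0)"
        by (auto simp: restr_def z_def indicator_def)
      then have "restr C z \<in> borel_measurable lebesgue" by simp
      then show "integrable lebesgue (restr C z)"
        by (rule Bochner_Integration.integrable_bound[OF i(2)]) (auto simp: restr_def z_def)
    qed
    fix x0 :: "real^'n" and \<rho> :: real assume \<rho>: "\<rho> > 0" "cball x0 \<rho> \<subseteq> U"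
    define \<psi> where "\<psi> = (\<lambda>y. mker \<rho> (x0 - y))"
    have \<psi>: "\<psi> \<in> test_functions U" unfolding \<psi>_def by (rule test_mker(1)[OF \<rho>])
    note t = test_functionD[OF \<psi>]
    obtain T d where T: "d > 0" "compact T" "T \<subseteq> U" "\<forall>x\<in>supp \<psi>. cball x d \<subseteq> T"
      by (rule compact_enlarge[OF t(1) U t(2)])
    have sT: "supp \<psi> \<subseteq> T" using T(1,4) by fastforce
    define W where "W = restr T w"
    define Q where "Q = restr T g"
    have Wi: "integrable lebesgue W" and Qi: "integrable lebesgue Q"
      unfolding W_def Q_def using L T(2,3) Lp_loc_1_integrable by blast+
    have [measurable]: "W \<in> borel_measurable lebesgue" "Q \<in> borel_measurable lebesgue"
      using Wi Qi by auto
    have [measurable]: "\<psi> \<in> borel_measurable lebesgue" "partial_deriv i \<psi> \<in> borel_measurable lebesgue"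
      using t(5,6) lebesgue_measurable_cont by blast+
    obtain R where R: "supp \<psi> \<subseteq> ball 0 R"
      using compact_imp_bounded[OF t(1)] bounded_subset_ballD by blast
    have \<psi>R: "\<psi> x = 0" "partial_deriv i \<psi> x = 0" if "norm x \<ge> R" for x
      using R that by (auto intro!: t)
    have \<psi>i: "integrable lebesgue (partial_deriv i \<psi>)"
      using integrable_compact_support[OF t(6) \<psi>R(2)] t(6)
      by (subst integrable_completion) (auto intro: borel_measurable_continuous_onI)
    obtain B where B: "\<And>x. norm (\<psi> x) \<le> B"
      using compact_support_bounded[OF t(5) \<psi>R(1)] by metis
    have B0: "B \<ge> 0" using order_trans[OF norm_ge_zero B] .
    \<comment> \<open>The chain rule is classical only for mollified \<open>w\<close>. The radius
      therefore tends to 0 inside this claim, for fixed \<epsilon>, and \<epsilon> tends to 0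
      afterwards. The factor 2 bounds \<open>arctan\<close>.\<close>
    have main: "\<bar>LINT x|lebesgue. (1 / (1 + (W x / \<epsilon>)\<^sup>2)) * Q x * \<psi> x\<bar> \<le> \<epsilon> * 2 * (LINT x|lebesgue. \<bar>partial_deriv i \<psi> x\<bar>)"
      if \<epsilon>: "\<epsilon> > 0" for \<epsilon>
    proof -
      define h where "h t = \<epsilon> * arctan (t / \<epsilon>)" for t
      define h' where "h' t = 1 / (1 + (t / \<epsilon>)\<^sup>2)" for t
      have dh: "(h has_real_derivative h' t) (at t)" for t
      proof -
        have "(arctan has_real_derivative inverse (1 + (t / \<epsilon>)\<^sup>2)) (at (t / \<epsilon>))"
          by (rule DERIV_arctan)
        moreover have "((\<lambda>t. t / \<epsilon>) has_real_derivative 1 / \<epsilon>) (at t)"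
          by (rule DERIV_cdivide[OF DERIV_ident])
        ultimately have "((\<lambda>t. arctan (t / \<epsilon>)) has_real_derivative inverse (1 + (t / \<epsilon>)\<^sup>2) * (1 / \<epsilon>)) (at t)"
          by (rule DERIV_chain2)
        moreover have "\<epsilon> * (D * (1 / \<epsilon>)) = D" for D
          using \<epsilon> by simp
        ultimately show ?thesis
          using DERIV_cmult[of "\<lambda>t. arctan (t / \<epsilon>)" "inverse (1 + (t / \<epsilon>)\<^sup>2) * (1 / \<epsilon>)" t UNIV \<epsilon>]
          by (simp only: h_def[abs_def] h'_def inverse_eq_divide)
      qed
      have h_bound: "\<bar>h t\<bar> \<le> \<epsilon> * 2" for t
      proof -
        have "\<bar>arctan (t / \<epsilon>)\<bar> \<le> 2"
          using arctan_bounded[of "t / \<epsilon>"] pi_half_less_two by linarith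
        then show ?thesis using \<epsilon> unfolding h_def by (simp add: abs_mult mult_left_mono)
      qed
      have den: "1 + (t / \<epsilon>)\<^sup>2 \<noteq> 0" for t
        using zero_le_power2[of "t / \<epsilon>"] by linarith
      have h'_bound: "\<bar>h' t\<bar> \<le> 1" for t
        unfolding h'_def by (rule abs_inverse_quadratic_le)
      have ch: "continuous_on UNIV h" "continuous_on UNIV h'"
        unfolding h_def h'_def by (intro continuous_intros; use \<epsilon> den in auto)+
      have [measurable]: "h \<in> borel_measurable borel" "h' \<in> borel_measurable borel"
        using ch by (auto intro: borel_measurable_continuous_onI)
      \<comment> \<open>The same radii serve both functions, because on the support of the test
        function the mollified \<open>Q\<close> must be the derivative of the mollified
        \<open>W\<close>.\<close>
      have "integrable lebesgue (if b then W else Q)" for b using Wi Qi by simp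
      from moll_tendsto_AE[where J = UNIV and f = "\<lambda>b. if b then W else Q", OF finite this T(1)]
      obtain r :: "nat \<Rightarrow> real" where r': "\<forall>k. 0 < r k \<and> r k < d"
        and c: "\<forall>b\<in>UNIV. (AE x in lebesgue. (\<lambda>k. moll (r k) (if b then W else Q) x) \<longlonglongrightarrow> (if b then W else Q) x) \<and>
          (\<lambda>k. LINT x|lebesgue. \<bar>moll (r k) (if b then W else Q) x - (if b then W else Q) x\<bar>) \<longlonglongrightarrow> 0"
        by (elim exE conjE)
      have AE: "AE x in lebesgue. (\<lambda>k. moll (r k) W x) \<longlonglongrightarrow> W x"
        and L1: "(\<lambda>k. LINT x|lebesgue. \<bar>moll (r k) Q x - Q x\<bar>) \<longlonglongrightarrow> 0"
        using bspec[OF c, of True] bspec[OF c, of False] by auto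
      have r: "0 < r k" "r k < d" for k using r' by auto
      have Mi: "integrable lebesgue (moll (r k) Q)" for k by (rule integrable_moll(1)[OF r(1) Qi])
      have [measurable]: "moll (r k) W \<in> borel_measurable lebesgue" "moll (r k) Q \<in> borel_measurable lebesgue" for k
        using integrable_moll(1)[OF r(1) Wi] Mi by auto
      have bi: "integrable lebesgue (\<lambda>x. h' (moll (r k) W x) * f x * \<psi> x)"
        and bb: "\<bar>h' (moll (r k) W x) * f x * \<psi> x\<bar> \<le> B * \<bar>f x\<bar>"
        if "integrable lebesgue f" for f k x
      proof -
        have [measurable]: "f \<in> borel_measurable lebesgue" using that by auto
        have *: "\<bar>h' (moll (r k) W x) * f x * \<psi> x\<bar> \<le> B * \<bar>f x\<bar>" for x
        proof -
          have "\<bar>h' (moll (r k) W x)\<bar> * (\<bar>f x\<bar> * \<bar>\<psi> x\<bar>) \<le> 1 * (\<bar>f x\<bar> * B)"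
            using B[of x] h'_bound by (intro mult_mono) auto
          then show ?thesis by (simp add: abs_mult mult.commute mult.left_commute)
        qed
        then show "\<bar>h' (moll (r k) W x) * f x * \<psi> x\<bar> \<le> B * \<bar>f x\<bar>" .
        show "integrable lebesgue (\<lambda>x. h' (moll (r k) W x) * f x * \<psi> x)"
        proof (rule Bochner_Integration.integrable_bound)
          show "integrable lebesgue (\<lambda>x. B * f x)" using that by auto
          show "AE x in lebesgue. norm (h' (moll (r k) W x) * f x * \<psi> x) \<le> norm (B * f x)"
            using * B0 by (simp add: abs_mult)
        qed measurable
      qed
      have bound: "\<bar>LINT x|lebesgue. h' (moll (r k) W x) * moll (r k) Q x * \<psi> x\<bar> \<le>
        \<epsilon> * 2 * (LINT x|lebesgue. \<bar>partial_deriv i \<psi> x\<bar>)" for k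
      proof -
        let ?D = "\<lambda>x. \<chi> i. partial_deriv i \<psi> x" and ?E = "\<lambda>x. \<chi> i. conv (\<lambda>z. gker (r k) z $ i) W x"
        let ?G = "\<lambda>x. (h' (moll (r k) W x) * \<psi> x) *\<^sub>R ?E x + h (moll (r k) W x) *\<^sub>R ?D x"
        note ms = moll_smooth[OF r(1) Wi]
        have "(LINT x|lebesgue. ?G x $ i) = 0"
        proof (rule integral_compact_gradient_zero[OF open_UNIV t(1)])
          fix x
          have "((\<lambda>x. h (moll (r k) W x)) has_derivative (\<lambda>v. h' (moll (r k) W x) * (?E x \<bullet> v))) (at x)"
            using has_derivative_compose[OF ms(1) dh[unfolded has_field_derivative_def]] by simp
          from has_derivative_mult[OF this t(7)]
          show "((\<lambda>x. h (moll (r k) W x) * \<psi> x) has_derivative (\<lambda>h. ?G x \<bullet> h)) (at x)"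
            by (rule has_derivative_eq_rhs) (simp add: inner_add_left fun_eq_iff algebra_simps)
          show "?G x = 0" "h (moll (r k) W x) * \<psi> x = 0" if "x \<notin> supp \<psi>"
            using t(3,4)[OF that] by (auto simp: vec_eq_iff)
        next
          have cD: "continuous_on UNIV ?D" "continuous_on UNIV ?E"
            by (intro continuous_on_vec_lambda t(6) ms(3))+
          show "continuous_on UNIV ?G"
            by (intro continuous_on_add continuous_on_scaleR continuous_on_mult cD t(5) continuous_on_compose2[OF ch(1) ms(2)]
                continuous_on_compose2[OF ch(2) ms(2)]) auto
        qed simp
        moreover have "?G x $ i = h' (moll (r k) W x) * moll (r k) Q x * \<psi> x + h (moll (r k) W x) * partial_deriv i \<psi> x" for x
        proof (cases "x \<in> supp \<psi>")
          case True
          then have "cball x (r k) \<subseteq> T"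
            using T(4) r(2)[of k] by (meson less_imp_le order_trans subset_cball)
          from weak_deriv_moll[OF wg U T(3) r(1) this] show ?thesis
            by (simp add: W_def Q_def)
        next
          case False
          then show ?thesis using t(3) by simp
        qed
        moreover have hi: "integrable lebesgue (\<lambda>x. h (moll (r k) W x) * partial_deriv i \<psi> x)"
        proof (rule Bochner_Integration.integrable_bound)
          show "integrable lebesgue (\<lambda>x. \<epsilon> * 2 * partial_deriv i \<psi> x)" using \<psi>i by auto
          show "AE x in lebesgue. norm (h (moll (r k) W x) * partial_deriv i \<psi> x) \<le> norm (\<epsilon> * 2 * partial_deriv i \<psi> x)"
            using mult_right_mono[OF h_bound abs_ge_zero] \<epsilon> by (simp add: abs_mult)
        qed measurable
        ultimately have "(LINT x|lebesgue. h' (moll (r k) W x) * moll (r k) Q x * \<psi> x) +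
          (LINT x|lebesgue. h (moll (r k) W x) * partial_deriv i \<psi> x) = 0"
          by (subst Bochner_Integration.integral_add[OF bi[OF Mi] hi, symmetric]) (simp only:)
        then have "(LINT x|lebesgue. h' (moll (r k) W x) * moll (r k) Q x * \<psi> x) =
          - (LINT x|lebesgue. h (moll (r k) W x) * partial_deriv i \<psi> x)"
          by simp
        moreover have "\<bar>LINT x|lebesgue. h (moll (r k) W x) * partial_deriv i \<psi> x\<bar> \<le>
          \<epsilon> * 2 * (LINT x|lebesgue. \<bar>partial_deriv i \<psi> x\<bar>)"
          by (rule conv_diff_bound[OF hi \<psi>i h_bound])
        ultimately show ?thesis by simp
      qed
      have "(\<lambda>k. LINT x|lebesgue. h' (moll (r k) W x) * Q x * \<psi> x) \<longlonglongrightarrow> (LINT x|lebesgue. h' (W x) * Q x * \<psi> x)"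
      proof (rule integral_dominated_convergence)
        show "integrable lebesgue (\<lambda>x. B * \<bar>Q x\<bar>)" using Qi by auto
        show "AE x in lebesgue. norm (h' (moll (r k) W x) * Q x * \<psi> x) \<le> B * \<bar>Q x\<bar>" for k
          using bb[OF Qi] by simp
        show "AE x in lebesgue. (\<lambda>k. h' (moll (r k) W x) * Q x * \<psi> x) \<longlonglongrightarrow> h' (W x) * Q x * \<psi> x"
          using AE
        proof eventually_elim
          case (elim x)
          have "isCont h' (W x)" using ch(2) by (simp add: continuous_on_eq_continuous_at)
          from isCont_tendsto_compose[OF this elim] show ?case by (intro tendsto_intros)
        qed
      qed measurable
      \<comment> \<open>The product is split since the factors converge differently:
        \<open>W\<close> almost everywhere, inside the bounded function \<open>h'\<close>, and
        \<open>Q\<close> in L^1.\<close>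
      moreover have "(\<lambda>k. LINT x|lebesgue. h' (moll (r k) W x) * (moll (r k) Q x - Q x) * \<psi> x) \<longlonglongrightarrow> 0"
      proof (rule Lim_null_comparison)
        have "norm (LINT x|lebesgue. h' (moll (r k) W x) * (moll (r k) Q x - Q x) * \<psi> x) \<le>
          (LINT x|lebesgue. B * \<bar>moll (r k) Q x - Q x\<bar>)" for k
          using Mi Qi bb[of "\<lambda>x. moll (r k) Q x - Q x" k]
          by (intro Bochner_Integration.integral_norm_bound_integral bi) auto
        then show "\<forall>\<^sub>F k in sequentially. norm (LINT x|lebesgue. h' (moll (r k) W x) * (moll (r k) Q x - Q x) * \<psi> x) \<le>
          B * (LINT x|lebesgue. \<bar>moll (r k) Q x - Q x\<bar>)" by simp
        show "(\<lambda>k. B * (LINT x|lebesgue. \<bar>moll (r k) Q x - Q x\<bar>)) \<longlonglongrightarrow> 0"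
          using tendsto_mult[OF tendsto_const L1, of B] by simp
      qed
      ultimately have "(\<lambda>k. (LINT x|lebesgue. h' (moll (r k) W x) * Q x * \<psi> x) +
        (LINT x|lebesgue. h' (moll (r k) W x) * (moll (r k) Q x - Q x) * \<psi> x)) \<longlonglongrightarrow>
        (LINT x|lebesgue. h' (W x) * Q x * \<psi> x) + 0"
        by (rule tendsto_add)
      moreover have "(LINT x|lebesgue. h' (moll (r k) W x) * Q x * \<psi> x) +
        (LINT x|lebesgue. h' (moll (r k) W x) * (moll (r k) Q x - Q x) * \<psi> x) =
        (LINT x|lebesgue. h' (moll (r k) W x) * moll (r k) Q x * \<psi> x)" for k
        using Bochner_Integration.integral_add[OF bi[OF Qi, of k] bi[OF Bochner_Integration.integrable_diff[OF Mi[of k] Qi], of k]]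
        by (simp add: algebra_simps)
      ultimately have "(\<lambda>k. LINT x|lebesgue. h' (moll (r k) W x) * moll (r k) Q x * \<psi> x) \<longlonglongrightarrow>
        (LINT x|lebesgue. h' (W x) * Q x * \<psi> x)"
        by simp
      from tendsto_rabs[OF this] have "\<bar>LINT x|lebesgue. h' (W x) * Q x * \<psi> x\<bar> \<le>
        \<epsilon> * 2 * (LINT x|lebesgue. \<bar>partial_deriv i \<psi> x\<bar>)"
        using bound by (intro LIMSEQ_le_const2) auto
      then show ?thesis by (simp add: h'_def)
    qed
    define \<epsilon> where "\<epsilon> k = 1 / real (Suc k)" for k
    have \<epsilon>: "\<epsilon> k > 0" for k by (simp add: \<epsilon>_def)
    have \<epsilon>0: "\<epsilon> \<longlonglongrightarrow> 0" unfolding \<epsilon>_def by (rule LIMSEQ_Suc[OF lim_1_over_n])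
    let ?I = "\<lambda>k. LINT x|lebesgue. (1 / (1 + (W x / \<epsilon> k)\<^sup>2)) * Q x * \<psi> x"
    \<comment> \<open>The weight equals 1 where \<open>w = 0\<close>, for every \<open>k\<close>,
      and tends to 0 elsewhere; this produces \<open>z\<close>.\<close>
    have "?I \<longlonglongrightarrow> (LINT x|lebesgue. restr (supp \<psi>) z x * \<psi> x)"
    proof (rule integral_dominated_convergence)
      show "integrable lebesgue (\<lambda>x. B * \<bar>Q x\<bar>)" using Qi by auto
      have "integrable lebesgue (restr (supp \<psi>) z)"
        by (rule Lp_loc_1_integrable[OF zL t(1,2)])
      then show "(\<lambda>x. restr (supp \<psi>) z x * \<psi> x) \<in> borel_measurable lebesgue" by measurable
      show "AE x in lebesgue. norm (1 / (1 + (W x / \<epsilon> k)\<^sup>2) * Q x * \<psi> x) \<le> B * \<bar>Q x\<bar>" for k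
      proof (rule AE_I2)
        fix x
        have "\<bar>1 / (1 + (W x / \<epsilon> k)\<^sup>2)\<bar> \<le> 1" by (rule abs_inverse_quadratic_le)
        then have "\<bar>1 / (1 + (W x / \<epsilon> k)\<^sup>2)\<bar> * (\<bar>Q x\<bar> * \<bar>\<psi> x\<bar>) \<le> 1 * (\<bar>Q x\<bar> * B)"
          using B[of x] by (intro mult_mono) auto
        then show "norm (1 / (1 + (W x / \<epsilon> k)\<^sup>2) * Q x * \<psi> x) \<le> B * \<bar>Q x\<bar>"
          by (simp add: abs_mult mult.commute mult.left_commute)
      qed
      show "AE x in lebesgue. (\<lambda>k. 1 / (1 + (W x / \<epsilon> k)\<^sup>2) * Q x * \<psi> x) \<longlonglongrightarrow> restr (supp \<psi>) z x * \<psi> x"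
      proof (rule AE_I2)
        fix x
        show "(\<lambda>k. 1 / (1 + (W x / \<epsilon> k)\<^sup>2) * Q x * \<psi> x) \<longlonglongrightarrow> restr (supp \<psi>) z x * \<psi> x"
        proof (cases "x \<in> supp \<psi>")
          case False
          then show ?thesis using t(3) by simp
        next
          case True
          then have eq: "W x = w x" "Q x = g x" "restr (supp \<psi>) z x = z x"
            using sT by (auto simp: W_def Q_def)
          show ?thesis
          proof (cases "w x = 0")
            case True
            then show ?thesis unfolding eq by (simp add: z_def)
          next
            case False
            have "(\<lambda>k. 1 / (1 + (w x * real (Suc k))\<^sup>2)) \<longlonglongrightarrow> 0"
              using False by real_asymp
            then have "(\<lambda>k. 1 / (1 + (w x / \<epsilon> k)\<^sup>2) * g x * \<psi> x) \<longlonglongrightarrow> 0 * g x * \<psi> x"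
              unfolding \<epsilon>_def by (intro tendsto_intros) simp
            with False show ?thesis unfolding eq by (simp add: z_def)
          qed
        qed
      qed
    qed measurable
    moreover have "?I \<longlonglongrightarrow> 0"
    proof (rule Lim_null_comparison)
      show "\<forall>\<^sub>F k in sequentially. norm (?I k) \<le> \<epsilon> k * 2 * (LINT x|lebesgue. \<bar>partial_deriv i \<psi> x\<bar>)"
        using main[OF \<epsilon>] by simp
      have "(\<lambda>k. \<epsilon> k * 2 * (LINT x|lebesgue. \<bar>partial_deriv i \<psi> x\<bar>)) \<longlonglongrightarrow> 0 * 2 * (LINT x|lebesgue. \<bar>partial_deriv i \<psi> x\<bar>)"
        by (intro tendsto_intros \<epsilon>0)
      then show "(\<lambda>k. \<epsilon> k * 2 * (LINT x|lebesgue. \<bar>partial_deriv i \<psi> x\<bar>)) \<longlonglongrightarrow> 0" by simp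
    qed
    ultimately have "(LINT x|lebesgue. restr (supp \<psi>) z x * \<psi> x) = 0"
      by (rule LIMSEQ_unique)
    then show "(LINT y|lebesgue_on U. z y * mker \<rho> (x0 - y)) = 0"
      using test_LINT(1)[OF U \<psi>, of z] by (simp add: \<psi>_def)
  qed
  then show ?thesis
    by eventually_elim (auto simp: z_def split: if_splits)
qed

section \<open>The maximum principle of Alexandrov, Bakelman and Pucci\<close>

text \<open>Evaluating the form at the sum and at the difference of two basis vectors bounds twice
  the entry by two diagonal entries, each at most the trace.\<close>

lemma psd_entry_le_trace:
  assumes "N \<in> psd_mats"
  shows "\<bar>N $ i $ j\<bar> \<le> trace N"
proof -
  have sym: "N $ j $ i = N $ i $ j" for i j
    using assms unfolding psd_mats_def sym_mats_def by (auto simp: vec_eq_iff transpose_def)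
  have q: "0 \<le> N $ i $ i + c * N $ i $ j + c * N $ j $ i + c\<^sup>2 * N $ j $ j" for i j c
  proof -
    let ?x = "axis i 1 + c *\<^sub>R axis j (1::real)"
    have "0 \<le> ?x \<bullet> (N *v ?x)"
      using assms unfolding psd_mats_def by blast
    also have "\<dots> = N $ i $ i + c * N $ i $ j + c * N $ j $ i + c\<^sup>2 * N $ j $ j"
      by (simp add: matrix_vector_right_distrib matrix_vector_mult_scaleR matrix_vector_mult_basis
          column_def inner_add_left inner_add_right inner_axis' power2_eq_square algebra_simps)
    finally show ?thesis .
  qed
  have diag: "N $ k $ k \<ge> 0" for k
    using q[of k 0 k] by simp
  have "N $ k $ k \<le> trace N" for k
    unfolding trace_def by (rule member_le_sum) (auto simp: diag)
  from this[of i] this[of j] q[of i 1 j] q[of i "-1" j] sym[of i j] show ?thesis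
    by (simp add: abs_le_iff)
qed

lemma norm_matrix_le:
  fixes M :: "real^'n^'n"
  assumes "\<And>i j. \<bar>M $ i $ j\<bar> \<le> b"
  shows "norm M \<le> real (CARD('n) ^ 2) * b"
proof -
  have "norm M \<le> (\<Sum>i\<in>UNIV. norm (M $ i))"
    unfolding norm_vec_def by (rule L2_set_le_sum) simp
  also have "\<dots> \<le> (\<Sum>i\<in>(UNIV :: 'n set). \<Sum>j\<in>(UNIV :: 'n set). b)"
    by (intro sum_mono order_trans[OF norm_le_l1_cart] assms)
  finally show ?thesis by (simp add: power2_eq_square)
qed

text \<open>The sum of the n-th powers of the entries is convenient because Jensen's inequality acts
  on each mollified entry separately.\<close>

lemma norm_matrix_power_le:
  fixes M :: "real^'n^'n"
  shows "norm M ^ n \<le> real (CARD('n) ^ 2) ^ n * (\<Sum>(i, j)\<in>UNIV. \<bar>M $ i $ j\<bar> ^ n)"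
proof -
  let ?a = "\<lambda>(i, j). \<bar>M $ i $ j\<bar>"
  have "Max (range ?a) \<in> range ?a"
    by (rule Max_in) auto
  then obtain ij where ij: "Max (range ?a) = ?a ij"
    by (rule rangeE)
  have "\<bar>M $ i $ j\<bar> \<le> ?a ij" for i j
  proof -
    have "?a (i, j) \<le> Max (range ?a)" by (rule Max_ge) auto
    then show ?thesis unfolding ij by simp
  qed
  then have "norm M \<le> real (CARD('n) ^ 2) * ?a ij"
    by (rule norm_matrix_le)
  then have "norm M ^ n \<le> (real (CARD('n) ^ 2) * ?a ij) ^ n"
    by (intro power_mono) auto
  also have "\<dots> = real (CARD('n) ^ 2) ^ n * ?a ij ^ n"
    by (rule power_mult_distrib)
  also have "?a ij ^ n \<le> (\<Sum>ij\<in>UNIV. ?a ij ^ n)"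
    by (rule member_le_sum) auto
  finally show ?thesis
    by (simp add: mult_left_mono case_prod_unfold)
qed

text \<open>If the quadratic form were positive in a direction \<open>h\<close>, the derivative of
  \<open>f\<close> along \<open>h\<close> would vanish at \<open>x\<close> and be positive just
  after it, so \<open>f\<close> would increase. The gradient need be differentiable only at the
  point \<open>x\<close>.\<close>

lemma second_derivative_test:
  fixes f :: "real^'n \<Rightarrow> real"
  assumes e: "e > 0" and f: "\<And>y. y \<in> ball x e \<Longrightarrow> (f has_derivative (\<lambda>h. Q y \<bullet> h)) (at y)"
    and Q: "(Q has_derivative (\<lambda>h. N *v h)) (at x)" and max: "\<And>y. y \<in> ball x e \<Longrightarrow> f y \<le> f x"
  shows "Q x = 0" "h \<bullet> (N *v h) \<le> 0"
proof -
  have "(\<lambda>h. Q x \<bullet> h) = (\<lambda>h. 0)"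
    by (rule differential_zero_maxmin[of x "ball x e" f]) (use e f max in auto)
  then have "Q x \<bullet> Q x = 0" by (rule fun_cong)
  then show Q0: "Q x = 0" by simp
  show "h \<bullet> (N *v h) \<le> 0"
  proof (rule ccontr)
    assume neg: "\<not> h \<bullet> (N *v h) \<le> 0"
    then have h: "h \<noteq> 0" by auto
    define q where "q t = Q (x + t *\<^sub>R h) \<bullet> h" for t
    have "((\<lambda>t. x + t *\<^sub>R h) has_derivative (\<lambda>t. t *\<^sub>R h)) (at 0)"
      by (auto intro!: derivative_eq_intros)
    then have "((\<lambda>t. Q (x + t *\<^sub>R h)) has_derivative (\<lambda>t. N *v (t *\<^sub>R h))) (at 0)"
      by (rule has_derivative_compose) (simp add: Q)
    then have "(q has_derivative (\<lambda>t. (N *v (t *\<^sub>R h)) \<bullet> h)) (at 0)"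
      unfolding q_def by (auto intro!: derivative_eq_intros)
    then have "(q has_real_derivative h \<bullet> (N *v h)) (at 0)"
      by (simp add: has_field_derivative_def matrix_vector_mult_scaleR inner_commute mult_commute_abs)
    from DERIV_pos_inc_right[OF this] neg Q0
    obtain d where d: "d > 0" "\<And>t. 0 < t \<Longrightarrow> t < d \<Longrightarrow> 0 < q t"
      by (auto simp: q_def)
    define t1 where "t1 = min (d / 2) (e / (2 * norm h))"
    have t1: "0 < t1" "t1 < d" "t1 * norm h < e"
    proof -
      show "0 < t1" "t1 < d" using d e h by (auto simp: t1_def)
      have "t1 * norm h \<le> e / (2 * norm h) * norm h" by (intro mult_right_mono) (auto simp: t1_def)
      then show "t1 * norm h < e" using e h by simp
    qed
    have seg: "x + t *\<^sub>R h \<in> ball x e" if "0 \<le> t" "t \<le> t1" for t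
      using mult_right_mono[OF that(2), of "norm h"] t1(3) that by (simp add: dist_norm)
    have der: "((\<lambda>t. f (x + t *\<^sub>R h)) has_real_derivative q t) (at t)" if "0 \<le> t" "t \<le> t1" for t
    proof -
      have "((\<lambda>t. x + t *\<^sub>R h) has_derivative (\<lambda>t. t *\<^sub>R h)) (at t)"
        by (auto intro!: derivative_eq_intros)
      from has_derivative_compose[OF this f[OF seg[OF that]]] show ?thesis
        by (simp add: has_field_derivative_def q_def mult_commute_abs)
    qed
    have "f (x + 0 *\<^sub>R h) < f (x + t1 *\<^sub>R h)"
    proof (rule DERIV_pos_imp_increasing_open[OF t1(1)])
      fix t assume "0 < t" "t < t1"
      then show "\<exists>y. ((\<lambda>t. f (x + t *\<^sub>R h)) has_real_derivative y) (at t) \<and> y > 0"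
        using der[of t] d(2)[of t] t1(2) by (intro exI[of _ "q t"]) auto
    next
      show "continuous_on {0..t1} (\<lambda>t. f (x + t *\<^sub>R h))"
        using der by (auto intro!: continuous_at_imp_continuous_on DERIV_isCont)
    qed
    with max[OF seg[of t1]] t1(1) show False by simp
  qed
qed

text \<open>A reverse Fatou lemma with varying majorants: only the part of \<open>u k\<close> above
  \<open>v\<close> has to vanish in the limit, and the majorants have to converge in L^1.\<close>

lemma integral_limsup_le:
  fixes u :: "nat \<Rightarrow> 'a \<Rightarrow> real"
  assumes H: "integrable M H" "\<And>k. integrable M (H' k)" "(\<lambda>k. LINT x|M. \<bar>H' k x - H x\<bar>) \<longlonglongrightarrow> 0"
    and u: "\<And>k. u k \<in> borel_measurable M" "\<And>k x. 0 \<le> u k x" "\<And>k x. u k x \<le> H' k x"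
    and v: "v \<in> borel_measurable M" "\<And>x. 0 \<le> v x" "\<And>x. v x \<le> H x"
    and lim: "AE x in M. (\<lambda>k. max (u k x - v x) 0) \<longlonglongrightarrow> 0"
    and c: "eventually (\<lambda>k. c \<le> (LINT x|M. u k x)) sequentially"
  shows "c \<le> (LINT x|M. v x)"
proof -
  note [measurable] = u(1) v(1)
  have [measurable]: "H \<in> borel_measurable M" using H(1) by auto
  \<comment> \<open>Capping at \<open>H\<close> makes dominated convergence applicable; what is cut
    off is at most \<open>\<bar>H' k - H\<bar>\<close>.\<close>
  define m where "m k x = max (min (u k x) (H x) - v x) 0" for k x
  have m_le: "\<bar>m k x\<bar> \<le> H x" for k x
    using u(2)[of k x] v(2,3)[of x] by (simp add: m_def)
  have [measurable]: "m k \<in> borel_measurable M" for k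
    unfolding m_def by measurable
  have vi: "integrable M v"
  proof (rule Bochner_Integration.integrable_bound[OF H(1) v(1)], rule AE_I2)
    show "norm (v x) \<le> norm (H x)" for x using v(2)[of x] v(3)[of x] by simp
  qed
  have mi: "integrable M (m k)" for k
  proof (rule Bochner_Integration.integrable_bound[OF H(1)], measurable, rule AE_I2)
    show "norm (m k x) \<le> norm (H x)" for x using m_le[of k x] by simp
  qed
  have ui: "integrable M (u k)" for k
  proof (rule Bochner_Integration.integrable_bound[OF H(2)[of k] u(1)], rule AE_I2)
    show "norm (u k x) \<le> norm (H' k x)" for x using u(2)[of k x] u(3)[of k x] by simp
  qed
  have "(\<lambda>k. LINT x|M. m k x) \<longlonglongrightarrow> (LINT x|M. 0)"
  proof (rule integral_dominated_convergence[where w = H])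
    show "AE x in M. (\<lambda>k. m k x) \<longlonglongrightarrow> 0"
      using lim
    proof eventually_elim
      case (elim x)
      show ?case
      proof (rule Lim_null_comparison[OF _ elim])
        show "\<forall>\<^sub>F k in sequentially. norm (m k x) \<le> max (u k x - v x) 0"
          by (intro always_eventually) (auto simp: m_def)
      qed
    qed
  qed (use m_le H(1) in auto)
  then have "(\<lambda>k. (LINT x|M. v x) + (LINT x|M. m k x) + (LINT x|M. \<bar>H' k x - H x\<bar>)) \<longlonglongrightarrow> (LINT x|M. v x) + 0 + 0"
    by (intro tendsto_intros H) simp
  moreover have "(LINT x|M. u k x) \<le> (LINT x|M. v x) + (LINT x|M. m k x) + (LINT x|M. \<bar>H' k x - H x\<bar>)" for k
  proof -
    have "(LINT x|M. u k x) \<le> (LINT x|M. v x + m k x + \<bar>H' k x - H x\<bar>)"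
    proof (rule integral_mono[OF ui])
      show "integrable M (\<lambda>x. v x + m k x + \<bar>H' k x - H x\<bar>)" using vi mi H by auto
      show "u k x \<le> v x + m k x + \<bar>H' k x - H x\<bar>" for x
        using u(3)[of k x] by (auto simp: m_def min_def max_def)
    qed
    also have "\<dots> = (LINT x|M. v x) + (LINT x|M. m k x) + (LINT x|M. \<bar>H' k x - H x\<bar>)"
      using vi mi H by simp
    finally show ?thesis .
  qed
  ultimately show ?thesis
    using tendsto_lowerbound[of "\<lambda>k. (LINT x|M. v x) + (LINT x|M. m k x) + (LINT x|M. \<bar>H' k x - H x\<bar>)" "LINT x|M. v x" sequentially c]
      eventually_mono[OF c] by (metis (no_types, lifting) add.right_neutral order_trans sequentially_bot)
qed

section \<open>Second-order weak jets and their mollification\<close>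

lemma measurable_vec_lambda:
  fixes f :: "'i::finite \<Rightarrow> 'a \<Rightarrow> 'b::euclidean_space"
  assumes "\<And>i. f i \<in> borel_measurable M"
  shows "(\<lambda>x. \<chi> i. f i x) \<in> borel_measurable M"
  using assms by (subst borel_measurable_euclidean_space) (auto simp: Basis_vec_def inner_axis)

text \<open>The derivatives are explicit arguments, so that differences, translates and restrictions
  can be formed without the choice hidden in \<open>weak_deriv\<close>.\<close>

definition W2_jet :: "(real^'n) set \<Rightarrow> (real^'n \<Rightarrow> real) \<Rightarrow> (real^'n \<Rightarrow> real^'n) \<Rightarrow> (real^'n \<Rightarrow> real^'n^'n) \<Rightarrow> bool" where
  "W2_jet U f P M \<longleftrightarrow> (\<forall>i. has_weak_deriv U i f (\<lambda>x. P x $ i) \<and> (\<lambda>x. P x $ i) \<in> Lp_loc CARD('n) U) \<and>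
    (\<forall>i j. has_weak_deriv U j (\<lambda>x. P x $ i) (\<lambda>x. M x $ i $ j) \<and> (\<lambda>x. M x $ i $ j) \<in> Lp_loc CARD('n) U)"

text \<open>Ellipticity and monotonicity of F are available only at symmetric matrices.\<close>

lemma W2_jet_symmetric:
  fixes U :: "(real^'n) set"
  assumes "open U" "W2_jet U f P M"
  shows "AE x in lebesgue_on U. M x \<in> sym_mats"
proof -
  have "AE x in lebesgue_on U. M x $ i $ j = M x $ j $ i" for i j
    using assms(2) unfolding W2_jet_def by (intro weak_deriv_symmetric[OF assms(1)]) auto
  then have "AE x in lebesgue_on U. \<forall>ij\<in>UNIV. M x $ fst ij $ snd ij = M x $ snd ij $ fst ij"
    by (intro AE_finite_allI) auto
  then show ?thesis
    by eventually_elim (simp add: sym_mats_def transpose_def vec_eq_iff)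
qed


text \<open>Stated through the quadratic form alone. What matters is that it is a closed condition:
  a limit outside the set forces the sequence outside it eventually.\<close>

definition nsd :: "(real^'n^'n) set" where
  "nsd = {N. \<forall>h. h \<bullet> (N *v h) \<le> 0}"

lemma closed_nsd: "closed (nsd :: (real^'n^'n) set)"
  unfolding nsd_def matrix_vector_mult_def inner_vec_def
  by (intro closed_Collect_all closed_Collect_le continuous_intros)

lemma moll_vec_has_derivative:
  fixes U :: "(real^'n) set"
  assumes U: "open U" and jet: "W2_jet U w P M" and T: "compact T" "T \<subseteq> U"
    and r: "0 < r" "cball x r \<subseteq> T"
  shows "(moll r (restr T w) has_derivative (\<lambda>h. (\<chi> i. moll r (restr T (\<lambda>x. P x $ i)) x) \<bullet> h)) (at x)"
    "((\<lambda>x. \<chi> i. moll r (restr T (\<lambda>x. P x $ i)) x) has_derivative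
      (\<lambda>h. (\<chi> i j. moll r (restr T (\<lambda>x. M x $ i $ j)) x) *v h)) (at x)"
proof -
  have der: "(moll r (restr T f) has_derivative (\<lambda>h. (\<chi> i. moll r (restr T (g i)) x) \<bullet> h)) (at x)"
    if "\<And>i. has_weak_deriv U i f (g i)" for f g
  proof -
    have "integrable lebesgue (restr T f)"
      using that Lp_loc_1_integrable[OF _ T] unfolding has_weak_deriv_def by blast
    from moll_smooth(1)[OF r(1) this, where x = x] show ?thesis
      by (simp add: weak_deriv_moll[OF that U T(2) r])
  qed
  show "(moll r (restr T w) has_derivative (\<lambda>h. (\<chi> i. moll r (restr T (\<lambda>x. P x $ i)) x) \<bullet> h)) (at x)"
    by (rule der) (use jet in \<open>simp add: W2_jet_def\<close>)
  have "((\<lambda>x. \<chi> i. moll r (restr T (\<lambda>x. P x $ i)) x) has_derivative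
    (\<lambda>h. \<chi> i. (\<chi> j. moll r (restr T (\<lambda>x. M x $ i $ j)) x) \<bullet> h)) (at x)"
  proof (subst has_derivative_componentwise_within, rule ballI)
    fix b :: "real^'n" assume "b \<in> Basis"
    then obtain i where b: "b = axis i 1" by (auto simp: Basis_vec_def)
    have "(moll r (restr T (\<lambda>x. P x $ i)) has_derivative
      (\<lambda>h. (\<chi> j. moll r (restr T (\<lambda>x. M x $ i $ j)) x) \<bullet> h)) (at x)"
      by (rule der) (use jet in \<open>simp add: W2_jet_def\<close>)
    then show "((\<lambda>x. (\<chi> i. moll r (restr T (\<lambda>x. P x $ i)) x) \<bullet> b) has_derivative
      (\<lambda>h. (\<chi> i. (\<chi> j. moll r (restr T (\<lambda>x. M x $ i $ j)) x) \<bullet> h) \<bullet> b)) (at x)"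
      by (simp add: b inner_axis)
  qed
  then show "((\<lambda>x. \<chi> i. moll r (restr T (\<lambda>x. P x $ i)) x) has_derivative
      (\<lambda>h. (\<chi> i j. moll r (restr T (\<lambda>x. M x $ i $ j)) x) *v h)) (at x)"
    by (simp add: matrix_vector_mult_def inner_vec_def)
qed

text \<open>The core of the Alexandrov--Bakelman--Pucci argument: since \<open>w\<close> drops by a definite amount between
  \<open>x\<^sub>0\<close> and the boundary of \<open>A\<close>, all small slopes are attained at concave contact points.\<close>

lemma contact_gradients:
  fixes U :: "(real^'n) set"
  assumes U: "open U" and jet: "W2_jet U w P M" and T: "compact T" "T \<subseteq> U"
    and A: "compact A" and r: "0 < r" "\<And>x. x \<in> A \<Longrightarrow> cball x r \<subseteq> T"
    and m: "m > 0" and x0: "x0 \<in> A" "w x0 \<ge> m" and D: "\<And>x y. x \<in> A \<Longrightarrow> y \<in> A \<Longrightarrow> norm (x - y) \<le> D" "D > 0"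
    and inner: "open {x \<in> A. w x > m / 2}"
    and near: "\<And>x. x \<in> A \<Longrightarrow> \<bar>moll r (restr T w) x - w x\<bar> \<le> m / 8"
    and p: "norm p \<le> m / (8 * D)"
  shows "p \<in> (\<lambda>x. \<chi> i. moll r (restr T (\<lambda>x. P x $ i)) x) `
    {x \<in> A. (\<chi> i j. moll r (restr T (\<lambda>x. M x $ i $ j)) x) \<in> nsd}"
proof -
  let ?w = "moll r (restr T w)" and ?P = "\<lambda>x. \<chi> i. moll r (restr T (\<lambda>x. P x $ i)) x"
    and ?M = "\<lambda>x. \<chi> i j. moll r (restr T (\<lambda>x. M x $ i $ j)) x"
  have "continuous_on A ?w"
    using moll_vec_has_derivative(1)[OF U jet T r(1) r(2)]
    by (auto intro!: continuous_at_imp_continuous_on has_derivative_continuous)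
  then have "continuous_on A (\<lambda>x. ?w x - p \<bullet> x)" by (intro continuous_intros)
  then obtain x1 where x1: "x1 \<in> A" "\<And>y. y \<in> A \<Longrightarrow> ?w y - p \<bullet> y \<le> ?w x1 - p \<bullet> x1"
    using continuous_attains_sup[OF A] x0(1) by blast
  \<comment> \<open>Over \<open>A\<close> the linear term changes by at most \<open>m / 8\<close>,
    and mollification costs \<open>m / 8\<close> at each of the two points. This leaves
    \<open>5 * m / 8\<close>, which exceeds \<open>m / 2\<close>, so the maximum lies in the open
    part of \<open>A\<close>.\<close>
  have "p \<bullet> (x1 - x0) \<ge> - (m / 8)"
  proof -
    have "\<bar>p \<bullet> (x1 - x0)\<bar> \<le> norm p * norm (x1 - x0)" by (rule Cauchy_Schwarz_ineq2)
    also have "\<dots> \<le> m / (8 * D) * D" using p D x1(1) x0(1) m by (intro mult_mono) auto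
    also have "\<dots> = m / 8" using D(2) by simp
    finally show ?thesis by linarith
  qed
  then have "w x1 \<ge> m - m / 8 - m / 8 - m / 8"
    using x1(2)[OF x0(1)] near[OF x1(1)] near[OF x0(1)] x0(2) unfolding inner_diff_right abs_le_iff
    by linarith
  then have "x1 \<in> {x \<in> A. w x > m / 2}"
    using x1(1) m by simp
  then obtain e where e: "e > 0" "ball x1 e \<subseteq> {x \<in> A. w x > m / 2}"
    using inner open_contains_ball by blast
  have eA: "y \<in> A" if "y \<in> ball x1 e" for y using e(2) that by blast
  have d1: "((\<lambda>x. ?w x - p \<bullet> x) has_derivative (\<lambda>h. (?P y - p) \<bullet> h)) (at y)" if "y \<in> ball x1 e" for y
    using moll_vec_has_derivative(1)[OF U jet T r(1) r(2)[OF eA[OF that]]]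
    by (auto intro!: derivative_eq_intros simp: inner_diff_left)
  have d2: "((\<lambda>x. ?P x - p) has_derivative (\<lambda>h. ?M x1 *v h)) (at x1)"
    using moll_vec_has_derivative(2)[OF U jet T r(1) r(2)[OF x1(1)]]
    by (auto intro!: derivative_eq_intros)
  have mx: "?w y - p \<bullet> y \<le> ?w x1 - p \<bullet> x1" if "y \<in> ball x1 e" for y
    using x1(2)[OF eA[OF that]] .
  have "?P x1 - p = 0" "\<And>h. h \<bullet> (?M x1 *v h) \<le> 0"
    using second_derivative_test[OF e(1) d1 d2 mx] by auto
  then show ?thesis
    using x1(1) by (intro image_eqI[of _ _ x1]) (auto simp: nsd_def)
qed

text \<open>Halving the radius divides the volume by at least 2, so the annulus keeps at least half
  of the ball.\<close>

lemma annulus_measure: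
  assumes "s > 0"
  shows "measure lborel (cball (0::real^'n) s - ball 0 (s / 2)) \<ge> unit_ball_vol (real CARD('n)) * s ^ CARD('n) / 2"
proof -
  let ?V = "unit_ball_vol (real CARD('n))"
  have "measure lborel (cball (0::real^'n) s - ball 0 (s / 2)) =
    measure lborel (cball (0::real^'n) s) - measure lborel (ball (0::real^'n) (s / 2))"
  proof (rule measure_Diff)
    show "emeasure lborel (cball (0::real^'n) s) \<noteq> \<infinity>"
      using emeasure_bounded_finite[of "cball (0::real^'n) s"] by auto
    show "ball (0::real^'n) (s / 2) \<subseteq> cball 0 s"
      using assms by (auto simp: dist_norm)
  qed auto
  also have "\<dots> = ?V * s ^ CARD('n) - ?V * (s / 2) ^ CARD('n)"
    using assms by (simp add: content_cball content_ball)
  also have "(s / 2) ^ CARD('n) \<le> s ^ CARD('n) / 2"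
  proof -
    have "(2::real) ^ 1 \<le> 2 ^ CARD('n)" by (rule power_increasing) auto
    then have "s ^ CARD('n) / 2 ^ CARD('n) \<le> s ^ CARD('n) / 2"
      using assms by (intro divide_left_mono) auto
    then show ?thesis by (simp add: power_divide)
  qed
  then have "?V * s ^ CARD('n) - ?V * (s ^ CARD('n) / 2) \<le> ?V * s ^ CARD('n) - ?V * (s / 2) ^ CARD('n)"
    by (intro diff_left_mono mult_left_mono) auto
  finally show ?thesis by simp
qed

text \<open>For each mollification, gradients at contact points cover the annulus of slopes and the
  area inequality applies. The conclusion survives the limit because only an upper bound on the
  limiting integrands is needed.\<close>

lemma contact_annulus_integral:
  fixes U :: "(real^'n) set"
  assumes U: "open U" and jet: "W2_jet U w P M" and T: "compact T" "T \<subseteq> U" and wT: "continuous_on T w"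
    and A: "compact A" and d: "d > 0" "\<And>x. x \<in> A \<Longrightarrow> cball x d \<subseteq> T"
    and m: "m > 0" and x0: "x0 \<in> A" "w x0 \<ge> m" and D: "\<And>x y. x \<in> A \<Longrightarrow> y \<in> A \<Longrightarrow> norm (x - y) \<le> D" "D > 0"
    and inner: "open {x \<in> A. w x > m / 2}"
    and s: "0 < s" "s \<le> m / (8 * D)"
  defines "v \<equiv> \<lambda>x. indicator {x \<in> A. s / 2 \<le> norm (P x) \<and> norm (P x) \<le> s \<and> M x \<in> nsd} x * norm (M x) ^ CARD('n)"
  shows "integrable lebesgue v"
    and "unit_ball_vol (real CARD('n)) * s ^ CARD('n) / 2 \<le> fact CARD('n) * (LINT x|lebesgue. v x)"
proof -
  let ?n = "CARD('n)"
  have n1: "?n \<ge> 1" by simp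
  have AT: "A \<subseteq> T" using d by fastforce
  define p where "p i = restr T (\<lambda>x. P x $ i)" for i
  define q where "q i j = restr T (\<lambda>x. M x $ i $ j)" for i j
  define W where "W = restr T w"
  have L: "w \<in> Lp_loc 1 U" "(\<lambda>x. P x $ i) \<in> Lp_loc 1 U" "(\<lambda>x. M x $ i $ j) \<in> Lp_loc 1 U"
    "(\<lambda>x. M x $ i $ j) \<in> Lp_loc ?n U" for i j
    using jet unfolding W2_jet_def has_weak_deriv_def by auto
  have Wi: "integrable lebesgue W" unfolding W_def by (rule Lp_loc_1_integrable[OF L(1) T])
  have pi: "integrable lebesgue (p i)" for i unfolding p_def by (rule Lp_loc_1_integrable[OF L(2) T])
  have qi: "integrable lebesgue (q i j)" for i j unfolding q_def by (rule Lp_loc_1_integrable[OF L(3) T])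
  have qni: "integrable lebesgue (\<lambda>x. \<bar>q i j x\<bar> ^ ?n)" for i j
    unfolding q_def by (rule Lp_loc_integrable_power[OF L(4) T n1])
  define Pr where "Pr x = (\<chi> i. p i x)" for x
  define Mr where "Mr x = (\<chi> i j. q i j x)" for x
  \<comment> \<open>The contact condition and the slope range as one closed set of pairs of gradient
    and Hessian.\<close>
  define E where "E = {pN :: (real^'n) \<times> (real^'n^'n). s / 2 \<le> norm (fst pN) \<and> norm (fst pN) \<le> s \<and> snd pN \<in> nsd}"
  have E: "closed E"
    unfolding E_def by (intro closed_Collect_conj closed_Collect_le continuous_intros
        closed_vimage[OF closed_nsd, unfolded vimage_def])
  \<comment> \<open>Entries of the gradient, entries of the Hessian, and n-th powers of the latter
    in one indexed family, so that a single sequence of radii works for all; the powers provide the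
    majorants.\<close>
  define F where "F = case_sum (case_sum p (\<lambda>(i, j). q i j)) (\<lambda>(i, j) x. \<bar>q i j x\<bar> ^ ?n)"
  have Fi: "integrable lebesgue (F j)" for j
    unfolding F_def using pi qi qni by (auto split: sum.split prod.split)
  from moll_tendsto_AE[where J = UNIV and f = F, OF finite Fi d(1)]
  obtain r :: "nat \<Rightarrow> real" where r': "\<forall>k. 0 < r k \<and> r k < d" and r0: "r \<longlonglongrightarrow> 0"
    and F: "\<forall>j\<in>UNIV. (AE x in lebesgue. (\<lambda>k. moll (r k) (F j) x) \<longlonglongrightarrow> F j x) \<and>
      (\<lambda>k. LINT x|lebesgue. \<bar>moll (r k) (F j) x - F j x\<bar>) \<longlonglongrightarrow> 0"
    by (elim exE conjE)
  have r: "0 < r k" "r k < d" for k using r' by auto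
  have rT: "cball x (r k) \<subseteq> T" if "x \<in> A" for x k
    using d(2)[OF that] r(2)[of k] by (meson less_imp_le order_trans subset_cball)
  define Pk where "Pk k x = (\<chi> i. moll (r k) (p i) x)" for k x
  define Mk where "Mk k x = (\<chi> i j. moll (r k) (q i j) x)" for k x
  have contP: "continuous_on B (Pk k)" and contM: "continuous_on B (Mk k)" for B k
    unfolding Pk_def Mk_def by (intro continuous_on_vec_lambda moll_smooth(2)[OF r(1)] pi qi)+
  define u where "u k x = indicator A x * indicator E (Pk k x, Mk k x) * norm (Mk k x) ^ ?n" for k x
  define C where "C = real (?n ^ 2) ^ ?n"
  have C: "C \<ge> 0" by (simp add: C_def)
  \<comment> \<open>The majorant from Jensen's inequality; unlike the n-th power of the mollified
    Hessian's norm, it is visibly convergent in L^1.\<close>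
  define Hk where "Hk k x = C * (\<Sum>(i, j)\<in>UNIV. moll (r k) (\<lambda>y. \<bar>q i j y\<bar> ^ ?n) x)" for k x
  define H where "H x = C * (\<Sum>(i, j)\<in>UNIV. \<bar>q i j x\<bar> ^ ?n)" for x
  have v: "v = (\<lambda>x. indicator A x * indicator E (Pr x, Mr x) * norm (Mr x) ^ ?n)"
  proof
    fix x
    show "v x = indicator A x * indicator E (Pr x, Mr x) * norm (Mr x) ^ ?n"
    proof (cases "x \<in> A")
      case True
      then have "Pr x = P x" "Mr x = M x"
        using AT by (auto simp: Pr_def Mr_def p_def q_def vec_eq_iff)
      with True show ?thesis by (simp add: v_def E_def indicator_def)
    qed (simp add: v_def)
  qed
  have [measurable]: "Pr \<in> borel_measurable lebesgue" "Mr \<in> borel_measurable lebesgue"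
    unfolding Pr_def Mr_def by (intro measurable_vec_lambda borel_measurable_integrable pi qi)+
  have [measurable]: "E \<in> sets borel" "A \<in> sets lebesgue"
    using E A by (auto simp: lmeasurable_compact fmeasurableD)
  have Em: "(\<lambda>x. indicator E (f x, g x) :: real) \<in> borel_measurable lebesgue"
    if [measurable]: "f \<in> borel_measurable lebesgue" "g \<in> borel_measurable lebesgue"
    for f :: "real^'n \<Rightarrow> real^'n" and g :: "real^'n \<Rightarrow> real^'n^'n"
  proof -
    have [measurable]: "(\<lambda>x. (f x, g x)) \<in> borel_measurable lebesgue"
      by (simp add: borel_prod[symmetric])
    show ?thesis by measurable
  qed
  have [measurable]: "Pk k \<in> borel_measurable lebesgue" "Mk k \<in> borel_measurable lebesgue" for k
    by (intro lebesgue_measurable_cont contP contM)+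
  have vm: "v \<in> borel_measurable lebesgue"
    unfolding v using Em[of Pr Mr] by simp
  have um: "u k \<in> borel_measurable lebesgue" for k
    unfolding u_def using Em[of "Pk k" "Mk k"] by simp
  have Hi: "integrable lebesgue H"
    unfolding H_def by (auto intro!: integrable_mult_right Bochner_Integration.integrable_sum qni split: prod.split)
  have Hki: "integrable lebesgue (Hk k)" for k
    unfolding Hk_def by (auto intro!: integrable_mult_right Bochner_Integration.integrable_sum
        integrable_moll(1)[OF r(1)] qni split: prod.split)
  have ind_le: "indicator A x * indicator E y * a \<le> (a::real)" if "a \<ge> 0" for x y a
    using that by (simp add: indicator_def)
  have vH: "v x \<le> H x" for x
  proof -
    have "v x \<le> norm (Mr x) ^ ?n" unfolding v by (rule ind_le) simp
    also have "\<dots> \<le> H x"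
      using norm_matrix_power_le[of "Mr x" ?n] by (simp add: H_def C_def Mr_def)
    finally show ?thesis .
  qed
  have uH: "u k x \<le> Hk k x" for k x
  proof -
    have "u k x \<le> norm (Mk k x) ^ ?n" unfolding u_def by (rule ind_le) simp
    also have "\<dots> \<le> C * (\<Sum>(i, j)\<in>UNIV. \<bar>moll (r k) (q i j) x\<bar> ^ ?n)"
      using norm_matrix_power_le[of "Mk k x" ?n] by (simp add: C_def Mk_def)
    also have "\<dots> \<le> Hk k x"
      unfolding Hk_def using moll_power_le[OF r(1) n1 qi qni]
      by (intro mult_left_mono sum_mono C) (auto split: prod.split)
    finally show ?thesis .
  qed
  have v0: "0 \<le> v x" for x by (simp add: v_def)
  have u0: "0 \<le> u k x" for k x by (simp add: u_def)
  show "integrable lebesgue v"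
  proof (rule Bochner_Integration.integrable_bound[OF Hi vm], rule AE_I2)
    show "norm (v x) \<le> norm (H x)" for x using v0[of x] vH[of x] by simp
  qed
  have HL1: "(\<lambda>k. LINT x|lebesgue. \<bar>Hk k x - H x\<bar>) \<longlonglongrightarrow> 0"
  proof (rule Lim_null_comparison)
    let ?D = "\<lambda>k ij x. \<bar>moll (r k) (F (Inr ij)) x - F (Inr ij) x\<bar>"
    have Di: "integrable lebesgue (?D k ij)" for k ij
      using integrable_moll(1)[OF r(1) Fi] Fi by auto
    have "(LINT x|lebesgue. \<bar>Hk k x - H x\<bar>) \<le> (LINT x|lebesgue. C * (\<Sum>ij\<in>UNIV. ?D k ij x))" for k
    proof (rule integral_mono)
      show "integrable lebesgue (\<lambda>x. \<bar>Hk k x - H x\<bar>)" using Hi Hki by auto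
      show "integrable lebesgue (\<lambda>x. C * (\<Sum>ij\<in>UNIV. ?D k ij x))"
        by (intro integrable_mult_right Bochner_Integration.integrable_sum Di)
      fix x
      have "Hk k x - H x = C * (\<Sum>ij\<in>UNIV. moll (r k) (F (Inr ij)) x - F (Inr ij) x)"
        by (simp add: Hk_def H_def F_def sum_subtractf right_diff_distrib case_prod_unfold)
      then have "\<bar>Hk k x - H x\<bar> = C * \<bar>\<Sum>ij\<in>UNIV. moll (r k) (F (Inr ij)) x - F (Inr ij) x\<bar>"
        using C by (simp add: abs_mult)
      then show "\<bar>Hk k x - H x\<bar> \<le> C * (\<Sum>ij\<in>UNIV. ?D k ij x)"
        using C by (simp add: mult_left_mono sum_abs)
    qed
    also have "(LINT x|lebesgue. C * (\<Sum>ij\<in>UNIV. ?D k ij x)) = C * (\<Sum>ij\<in>UNIV. LINT x|lebesgue. ?D k ij x)" for k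
      using Di by simp
    finally show "\<forall>\<^sub>F k in sequentially. norm (LINT x|lebesgue. \<bar>Hk k x - H x\<bar>) \<le>
        C * (\<Sum>ij\<in>UNIV. LINT x|lebesgue. ?D k ij x)"
      by simp
    have "(\<lambda>k. C * (\<Sum>ij\<in>UNIV. LINT x|lebesgue. ?D k ij x)) \<longlonglongrightarrow> C * (\<Sum>ij\<in>(UNIV :: ('n \<times> 'n) set). 0)"
      using F by (intro tendsto_intros) auto
    then show "(\<lambda>k. C * (\<Sum>ij\<in>UNIV. LINT x|lebesgue. ?D k ij x)) \<longlonglongrightarrow> 0" by simp
  qed
  have lim: "AE x in lebesgue. (\<lambda>k. max (u k x - v x) 0) \<longlonglongrightarrow> 0"
  proof -
    have "AE x in lebesgue. \<forall>j\<in>UNIV. (\<lambda>k. moll (r k) (F j) x) \<longlonglongrightarrow> F j x"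
      using F by (intro AE_finite_allI) auto
    then show ?thesis
    proof eventually_elim
      case (elim x)
      have Pc: "(\<lambda>k. Pk k x) \<longlonglongrightarrow> Pr x"
        unfolding Pk_def Pr_def
      proof (rule vec_tendstoI)
        fix i show "(\<lambda>k. (\<chi> i. moll (r k) (p i) x) $ i) \<longlonglongrightarrow> (\<chi> i. p i x) $ i"
          using elim[rule_format, of "Inl (Inl i)"] by (simp add: F_def)
      qed
      have Mc: "(\<lambda>k. Mk k x) \<longlonglongrightarrow> Mr x"
        unfolding Mk_def Mr_def
      proof (intro vec_tendstoI)
        fix i j show "(\<lambda>k. (\<chi> i j. moll (r k) (q i j) x) $ i $ j) \<longlonglongrightarrow> (\<chi> i j. q i j x) $ i $ j"
          using elim[rule_format, of "Inl (Inr (i, j))"] by (simp add: F_def)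
      qed
      have PMc: "(\<lambda>k. (Pk k x, Mk k x)) \<longlonglongrightarrow> (Pr x, Mr x)"
        by (rule tendsto_Pair[OF Pc Mc])
      show ?case
      \<comment> \<open>If the limit pair lies in \<open>E\<close>, dropping the indicator of
        \<open>E\<close> still gives the right upper bound; if not, closedness of \<open>E\<close>
        makes \<open>u k x\<close> vanish eventually.\<close>
      proof (cases "x \<in> A \<and> (Pr x, Mr x) \<in> E")
        case True
        have nc: "(\<lambda>k. max (norm (Mk k x) ^ ?n - v x) 0) \<longlonglongrightarrow> max (norm (Mr x) ^ ?n - v x) 0"
          by (intro tendsto_intros Mc)
        have "v x = norm (Mr x) ^ ?n" using True by (simp add: v)
        then have nc0: "(\<lambda>k. max (norm (Mk k x) ^ ?n - v x) 0) \<longlonglongrightarrow> 0" using nc by simp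
        show ?thesis
        proof (rule Lim_null_comparison[OF _ nc0], rule always_eventually, rule allI)
          fix k
          have "u k x \<le> norm (Mk k x) ^ ?n" unfolding u_def by (rule ind_le) simp
          then show "norm (max (u k x - v x) 0) \<le> max (norm (Mk k x) ^ ?n - v x) 0" by simp
        qed
      next
        case False
        have "\<forall>\<^sub>F k in sequentially. u k x = 0"
        proof (cases "x \<in> A")
          case True
          then have "(Pr x, Mr x) \<in> - E" using False by simp
          then have "\<forall>\<^sub>F k in sequentially. (Pk k x, Mk k x) \<in> - E"
            using PMc E by (intro topological_tendstoD) (auto simp: open_Compl)
          then show ?thesis by eventually_elim (simp add: u_def)
        qed (simp add: u_def)
        then have "\<forall>\<^sub>F k in sequentially. max (u k x - v x) 0 = 0"
          by eventually_elim (use v0[of x] in simp)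
        then show ?thesis by (rule tendsto_eventually)
      qed
    qed
  qed
  have "\<forall>\<^sub>F k in sequentially. unit_ball_vol (real ?n) * s ^ ?n / 2 / fact ?n \<le> (LINT x|lebesgue. u k x)"
  proof -
    \<comment> \<open>Small radii bring the mollification within \<open>m / 8\<close> of
      \<open>w\<close> on all of \<open>A\<close>, as \<open>contact_gradients\<close>
      demands.\<close>
    have "uniformly_continuous_on T w" by (rule compact_uniformly_continuous[OF wT T(1)])
    then obtain \<delta> where \<delta>: "\<delta> > 0" "\<And>x y. x \<in> T \<Longrightarrow> y \<in> T \<Longrightarrow> dist y x < \<delta> \<Longrightarrow> dist (w y) (w x) < m / 8"
      using m unfolding uniformly_continuous_on_def by (metis divide_pos_pos zero_less_numeral)
    have "\<forall>\<^sub>F k in sequentially. r k < \<delta>"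
      using r0 \<delta>(1) by (rule order_tendstoD(2))
    then show ?thesis
    proof eventually_elim
      case (elim k)
      have near: "\<bar>moll (r k) W x - w x\<bar> \<le> m / 8" if x: "x \<in> A" for x
      proof (rule moll_near[OF r(1) Wi])
        fix y assume y: "norm (x - y) < r k"
        then have "y \<in> cball x (r k)" by (simp add: dist_norm)
        then have "y \<in> T" using rT[OF x] by blast
        then show "\<bar>W y - w x\<bar> \<le> m / 8"
          using \<delta>(2)[of x y] x AT y elim by (auto simp: W_def dist_norm norm_minus_commute)
      qed
      let ?\<Gamma> = "{x \<in> A. (Pk k x, Mk k x) \<in> E}"
      have "closed ((\<lambda>x. (Pk k x, Mk k x)) -` E)"
        by (intro closed_vimage E continuous_on_Pair contP contM)
      from compact_Int_closed[OF A this] have \<Gamma>: "compact ?\<Gamma>"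
        by (simp add: vimage_def Int_def)
      have sub: "cball 0 s - ball 0 (s / 2) \<subseteq> Pk k ` ?\<Gamma>"
      proof
        fix y assume y: "y \<in> cball (0::real^'n) s - ball 0 (s / 2)"
        then have "norm y \<le> m / (8 * D)" using s(2) by simp
        from contact_gradients[OF U jet T A r(1) rT m x0 D inner near[unfolded W_def] this]
        have "y \<in> Pk k ` {x \<in> A. Mk k x \<in> nsd}"
          by (simp add: Pk_def[abs_def] Mk_def[abs_def] p_def q_def)
        then show "y \<in> Pk k ` ?\<Gamma>"
          using y by (auto simp: E_def)
      qed
      have der: "(Pk k has_derivative (\<lambda>h. Mk k x *v h)) (at x)" if "x \<in> ?\<Gamma>" for x
        using moll_vec_has_derivative(2)[OF U jet T r(1) rT] that
        by (simp add: Pk_def[abs_def] Mk_def p_def q_def)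
      have "unit_ball_vol (real ?n) * s ^ ?n / 2 \<le> measure lborel (cball (0::real^'n) s - ball 0 (s / 2))"
        by (rule annulus_measure[OF s(1)])
      also have "\<dots> \<le> measure lborel (Pk k ` ?\<Gamma>)"
      proof (rule measure_mono_fmeasurable[OF sub])
        have c: "compact (Pk k ` ?\<Gamma>)" by (rule compact_continuous_image[OF contP \<Gamma>])
        then show "Pk k ` ?\<Gamma> \<in> fmeasurable lborel"
          using emeasure_bounded_finite[OF compact_imp_bounded[OF c]]
          by (intro fmeasurableI) (auto simp: borel_compact)
      qed simp
      also have "\<dots> \<le> fact ?n * (LINT x|lborel. indicator ?\<Gamma> x * norm (Mk k x) ^ ?n)"
        by (rule measure_image_le[OF \<Gamma> contM der])
      also have "(LINT x|lborel. indicator ?\<Gamma> x * norm (Mk k x) ^ ?n) = (LINT x|lebesgue. indicator ?\<Gamma> x * norm (Mk k x) ^ ?n)"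
      proof -
        have "integrable lborel (\<lambda>x. indicator ?\<Gamma> x *\<^sub>R norm (Mk k x) ^ ?n)"
          by (intro borel_integrable_compact \<Gamma> continuous_intros contM)
        then show ?thesis by (subst integral_completion) auto
      qed
      also have "(\<lambda>x. indicator ?\<Gamma> x * norm (Mk k x) ^ ?n) = u k"
        by (auto simp: u_def indicator_def fun_eq_iff)
      finally show ?case by (simp add: field_simps)
    qed
  qed
  from integral_limsup_le[OF Hi Hki HL1 um u0 uH vm v0 vH lim this]
  show "unit_ball_vol (real ?n) * s ^ ?n / 2 \<le> fact ?n * (LINT x|lebesgue. v x)"
    by (simp add: field_simps)
qed


text \<open>Both sides of the annulus estimate scale like \<open>s ^ n\<close>. After dividing, a
  positive constant is bounded by a multiple of the integral of \<open>\<beta> ^ n\<close> over the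
  points with gradient of norm between 0, excluded, and \<open>s\<close>, which tends to 0.\<close>

theorem weak_maximum_principle:
  fixes G :: "(real^'n) set"
  assumes G: "open G" "bounded G" and w: "continuous_on (closure G) w" "\<And>x. x \<in> frontier G \<Longrightarrow> w x \<le> 0"
    and jet: "W2_jet G w P M" and \<beta>: "\<beta> \<in> Lp_loc CARD('n) G" and \<theta>: "\<theta> > 0"
    and sub: "AE x in lebesgue_on G. w x > 0 \<and> - M x \<in> psd_mats \<longrightarrow> \<theta> * trace (- M x) \<le> \<beta> x * norm (P x)"
    and x: "x \<in> G"
  shows "w x \<le> 0"
proof (rule ccontr)
  let ?n = "CARD('n)"
  assume "\<not> w x \<le> 0"
  define m where "m = w x"
  have m: "m > 0" using \<open>\<not> w x \<le> 0\<close> by (simp add: m_def)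
  \<comment> \<open>The boundary values are nonpositive, so this superlevel set is a compact subset
    of \<open>G\<close>; local integrability of the coefficients is enough there.\<close>
  define A where "A = closure G \<inter> w -` {m / 2..}"
  have "compact (closure G)" using G(2) by (simp add: compact_closure)
  moreover have "closed A"
    unfolding A_def by (rule continuous_closed_preimage[OF w(1)]) auto
  ultimately have A: "compact A"
    using compact_Int_closed[of "closure G" A] by (simp add: A_def Int_absorb1 inf.absorb2)
  have AG: "A \<subseteq> G"
  proof
    fix y assume y: "y \<in> A"
    then have "y \<notin> frontier G" using w(2)[of y] m by (auto simp: A_def)
    then show "y \<in> G" using y G(1) by (auto simp: A_def frontier_def interior_open)
  qed
  have xA: "x \<in> A" using x m closure_subset by (auto simp: A_def m_def)
  obtain T d where T: "d > 0" "compact T" "T \<subseteq> G" "\<forall>x\<in>A. cball x d \<subseteq> T"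
    by (rule compact_enlarge[OF A G(1) AG])
  have wG: "continuous_on G w" by (rule continuous_on_subset[OF w(1) closure_subset])
  have "bounded A" by (rule compact_imp_bounded[OF A])
  then obtain b where b: "\<And>y. y \<in> A \<Longrightarrow> norm y \<le> b" unfolding bounded_iff by blast
  define D where "D = 2 * \<bar>b\<bar> + 1"
  have D: "norm (y - z) \<le> D" if "y \<in> A" "z \<in> A" for y z
    using norm_triangle_ineq4[of y z] b[OF that(1)] b[OF that(2)] by (simp add: D_def)
  have D0: "D > 0" by (simp add: D_def)
  have "{x \<in> A. w x > m / 2} = G \<inter> w -` {m / 2<..}"
    using AG closure_subset by (auto simp: A_def)
  then have inner: "open {x \<in> A. w x > m / 2}"
    using continuous_open_preimage[OF wG G(1), of "{m / 2<..}"] by simp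
  define s0 where "s0 = m / (8 * D)"
  have s0: "s0 > 0" using m D0 by (simp add: s0_def)
  define v where "v s x = indicator {x \<in> A. s / 2 \<le> norm (P x) \<and> norm (P x) \<le> s \<and> M x \<in> nsd} x * norm (M x) ^ ?n" for s x
  have core: "integrable lebesgue (v s)"
    "unit_ball_vol (real ?n) * s ^ ?n / 2 \<le> fact ?n * (LINT x|lebesgue. v s x)" if "0 < s" "s \<le> s0" for s
    using contact_annulus_integral[OF G(1) jet T(2,3) continuous_on_subset[OF wG T(3)] A T(1) bspec[OF T(4)] m xA _ D D0 inner that(1)]
      that(2) unfolding v_def[abs_def] s0_def by (auto simp: m_def)
  \<comment> \<open>Collects the constants in passing from trace to entries (ellipticity) and from
    entries to norm (n^2 of them).\<close>
  define K where "K = (real (?n\<^sup>2) / \<theta>) ^ ?n"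
  have K: "K \<ge> 0" using \<theta> by (simp add: K_def)
  define Pr where "Pr x = (\<chi> i. restr A (\<lambda>x. P x $ i) x)" for x
  have Pm [measurable]: "Pr \<in> borel_measurable lebesgue"
    unfolding Pr_def
    by (intro measurable_vec_lambda borel_measurable_integrable Lp_loc_1_integrable[OF _ A AG])
      (use jet in \<open>auto simp: W2_jet_def has_weak_deriv_def\<close>)
  define B where "B x = \<bar>restr A \<beta> x\<bar> ^ ?n" for x
  have Bi: "integrable lebesgue B"
    unfolding B_def by (rule Lp_loc_integrable_power[OF \<beta> A AG]) simp
  then have [measurable]: "B \<in> borel_measurable lebesgue" by auto
  define g where "g s x = B x * indicator {x. 0 < norm (Pr x) \<and> norm (Pr x) \<le> s} x" for s x
  have gm: "g s \<in> borel_measurable lebesgue" for s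
    unfolding g_def by measurable
  have g_le: "norm (g s x) \<le> B x" for s x
    by (simp add: g_def B_def indicator_def)
  have gi: "integrable lebesgue (g s)" for s
    by (rule Bochner_Integration.integrable_bound[OF Bi gm], rule AE_I2)
      (use g_le in \<open>auto simp: B_def\<close>)
  have v_le: "(LINT x|lebesgue. v s x) \<le> K * s ^ ?n * (LINT x|lebesgue. g s x)" if s: "0 < s" "s \<le> s0" for s
  proof -
    have "AE x in lebesgue. x \<in> G \<longrightarrow> M x \<in> sym_mats"
      using W2_jet_symmetric[OF G(1) jet] unfolding AE_lebesgue_on_iff[OF G(1)] .
    moreover have "AE x in lebesgue. x \<in> G \<longrightarrow> w x > 0 \<and> - M x \<in> psd_mats \<longrightarrow> \<theta> * trace (- M x) \<le> \<beta> x * norm (P x)"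
      using sub unfolding AE_lebesgue_on_iff[OF G(1)] .
    ultimately have "AE x in lebesgue. v s x \<le> K * s ^ ?n * g s x"
    proof eventually_elim
      case (elim x)
      show ?case
      proof (cases "x \<in> A \<and> s / 2 \<le> norm (P x) \<and> norm (P x) \<le> s \<and> M x \<in> nsd")
        case False
        then have "v s x = 0" by (simp add: v_def)
        moreover have "0 \<le> K * s ^ ?n * g s x"
          using K s by (simp add: g_def B_def)
        ultimately show ?thesis by simp
      next
        case True
        then have xG: "x \<in> G" and wx: "w x > 0" using AG m by (auto simp: A_def)
        have neg: "(- M x) *v h = - (M x *v h)" for h
          by (simp add: matrix_vector_mult_def vec_eq_iff sum_negf)
        have sym: "- M x \<in> sym_mats"
          using elim(1) xG by (auto simp: sym_mats_def transpose_def vec_eq_iff)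
        then have psd: "- M x \<in> psd_mats"
          using True unfolding psd_mats_def nsd_def by (auto simp: neg)
        have Px: "Pr x = P x" using True by (simp add: Pr_def vec_eq_iff)
        have "\<theta> * trace (- M x) \<le> \<beta> x * norm (P x)"
          using elim(2) xG wx psd by blast
        also have "\<dots> \<le> \<bar>\<beta> x\<bar> * s"
          using True by (intro mult_mono) auto
        finally have "trace (- M x) \<le> \<bar>\<beta> x\<bar> * s / \<theta>"
          using \<theta> by (simp add: field_simps)
        then have "\<bar>M x $ i $ j\<bar> \<le> \<bar>\<beta> x\<bar> * s / \<theta>" for i j
          using psd_entry_le_trace[OF psd, of i j] by simp
        then have "norm (M x) \<le> real (?n\<^sup>2) * (\<bar>\<beta> x\<bar> * s / \<theta>)"
          by (rule norm_matrix_le)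
        then have "norm (M x) ^ ?n \<le> (real (?n\<^sup>2) * (\<bar>\<beta> x\<bar> * s / \<theta>)) ^ ?n"
          by (intro power_mono) auto
        also have "\<dots> = K * s ^ ?n * \<bar>\<beta> x\<bar> ^ ?n"
          by (simp add: K_def power_mult_distrib power_divide)
        also have "\<dots> = K * s ^ ?n * g s x"
        proof -
          \<comment> \<open>The inner radius \<open>s / 2\<close> of the annulus is used here: zero
            gradients never contribute to \<open>g\<close>.\<close>
          have "0 < norm (P x)" using True s by linarith
          then show ?thesis using True by (simp add: g_def B_def Px)
        qed
        finally show ?thesis using True by (simp add: v_def)
      qed
    qed
    then have "(LINT x|lebesgue. v s x) \<le> (LINT x|lebesgue. K * s ^ ?n * g s x)"
      by (intro integral_mono_AE core(1)[OF s] integrable_mult_right gi)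
    then show ?thesis by simp
  qed
  define s where "s k = s0 / real (Suc k)" for k
  have s: "0 < s k" "s k \<le> s0" for k
    using s0 by (auto simp: s_def divide_le_eq mult_le_cancel_left1)
  have s_lim: "s \<longlonglongrightarrow> 0"
    unfolding s_def by (rule LIMSEQ_Suc[OF lim_const_over_n])
  have "(\<lambda>k. LINT x|lebesgue. g (s k) x) \<longlonglongrightarrow> (LINT x::real^'n|lebesgue. 0)"
  proof (rule integral_dominated_convergence[where w = B])
    show "AE x in lebesgue. (\<lambda>k. g (s k) x) \<longlonglongrightarrow> 0"
    proof (rule AE_I2)
      fix x
      have "\<forall>\<^sub>F k in sequentially. g (s k) x = 0"
      proof (cases "norm (Pr x) = 0")
        case False
        then have "\<forall>\<^sub>F k in sequentially. s k < norm (Pr x)"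
          by (intro order_tendstoD(2)[OF s_lim]) simp
        then show ?thesis by eventually_elim (simp add: g_def)
      qed (simp add: g_def)
      then show "(\<lambda>k. g (s k) x) \<longlonglongrightarrow> 0" by (rule tendsto_eventually)
    qed
  qed (use gm Bi g_le in auto)
  then have "(\<lambda>k. fact ?n * K * (LINT x|lebesgue. g (s k) x)) \<longlonglongrightarrow> fact ?n * K * 0"
    by (intro tendsto_intros) simp
  moreover have "unit_ball_vol (real ?n) / 2 \<le> fact ?n * K * (LINT x|lebesgue. g (s k) x)" for k
  proof -
    have "unit_ball_vol (real ?n) * s k ^ ?n / 2 \<le> fact ?n * (K * s k ^ ?n * (LINT x|lebesgue. g (s k) x))"
      by (rule order_trans[OF core(2)[OF s] mult_left_mono[OF v_le[OF s]]]) simp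
    then have "(unit_ball_vol (real ?n) / 2) * s k ^ ?n \<le> (fact ?n * K * (LINT x|lebesgue. g (s k) x)) * s k ^ ?n"
      by (simp add: mult_ac)
    then show ?thesis
      by (rule mult_right_le_imp_le) (use s(1)[of k] in simp)
  qed
  ultimately have "unit_ball_vol (real ?n) / 2 \<le> fact ?n * K * 0"
    by (intro LIMSEQ_le_const) auto
  moreover have "unit_ball_vol (real ?n) > 0"
    by simp
  ultimately show False by linarith
qed

section \<open>Comparison principle\<close>

lemma Lp_loc_subset: "f \<in> Lp_loc p U \<Longrightarrow> V \<subseteq> U \<Longrightarrow> f \<in> Lp_loc p V"
  by (auto simp: Lp_loc_def)

lemma Lp_loc_translate:
  fixes f :: "real^'n \<Rightarrow> real"
  assumes f: "f \<in> Lp_loc p U"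
  shows "(\<lambda>x. f (x + h)) \<in> Lp_loc p ((\<lambda>x. x + h) -` U)"
  unfolding Lp_loc_iff
proof (intro allI impI conjI)
  fix C :: "(real^'n) set" assume C: "compact C \<and> C \<subseteq> (\<lambda>x. x + h) -` U"
  let ?C = "(\<lambda>x. x + h) ` C"
  have "compact ?C" using C by (intro compact_continuous_image continuous_intros) auto
  moreover have "?C \<subseteq> U" using C by auto
  ultimately have *: "restr ?C f \<in> borel_measurable lebesgue" "integrable lebesgue (\<lambda>x. indicator ?C x * \<bar>f x\<bar> ^ p)"
    using f unfolding Lp_loc_iff by auto
  have ind: "indicator ?C (x + h) = (indicator C x :: real)" for x
    by (auto simp: indicator_def image_iff)
  show "restr C (\<lambda>x. f (x + h)) \<in> borel_measurable lebesgue"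
    using LINT_lebesgue_translate(3)[OF *(1), of h] by (simp add: restr_def[abs_def] ind)
  show "integrable lebesgue (\<lambda>x. indicator C x * \<bar>f (x + h)\<bar> ^ p)"
    using LINT_lebesgue_translate(2)[OF borel_measurable_integrable[OF *(2)], of h] *(2) by (simp add: ind)
qed

lemma W2_jet_diff:
  assumes "open U" "W2_jet U f P M" "W2_jet U g Q N"
  shows "W2_jet U (\<lambda>x. f x - g x) (\<lambda>x. P x - Q x) (\<lambda>x. M x - N x)"
  using assms unfolding W2_jet_def by (simp add: has_weak_deriv_diff Lp_loc_diff)

lemma W2_jet_subset:
  assumes "open U" "open V" "V \<subseteq> U" "W2_jet U f P M"
  shows "W2_jet V f P M"
  using assms(4) unfolding W2_jet_def
  by (auto intro: has_weak_deriv_subset[OF assms(1-3)] Lp_loc_subset[OF _ assms(3)])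

lemma W2_jet_translate:
  assumes "open U" "W2_jet U f P M"
  shows "W2_jet ((\<lambda>x. x + h) -` U) (\<lambda>x. f (x + h)) (\<lambda>x. P (x + h)) (\<lambda>x. M (x + h))"
  using assms(2) unfolding W2_jet_def
  by (auto intro!: has_weak_deriv_translate[OF assms(1)] Lp_loc_translate)

lemma W2_jet_const: "open U \<Longrightarrow> W2_jet U (\<lambda>x. c) (\<lambda>x. 0) (\<lambda>x. 0)"
  unfolding W2_jet_def
  using classical_has_weak_deriv[of U "\<lambda>x. c" "\<lambda>x. 0" for c] Lp_loc_const[of 0]
  by simp

text \<open>\<open>weak_hessian\<close> differentiates the representative fixed by
  \<open>weak_deriv\<close>, whereas membership in the Sobolev space yields derivatives of some
  other one. Uniqueness almost everywhere transfers both existence and integrability.\<close>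

lemma W2_jet_sobolev:
  fixes U :: "(real^'n) set"
  assumes U: "open U" and u: "u \<in> sobolev_loc 2 CARD('n) U"
  shows "W2_jet U u (weak_grad U u) (weak_hessian U u)"
proof -
  have wd: "has_weak_deriv U i f (weak_deriv U i f)" if "has_weak_deriv U i f g" for i f g
    unfolding weak_deriv_def using that by (rule someI[of "has_weak_deriv U i f"])
  have first: "\<exists>g. has_weak_deriv U i u g \<and> g \<in> Lp_loc CARD('n) U \<and>
    (\<forall>j. \<exists>h. has_weak_deriv U j g h \<and> h \<in> Lp_loc CARD('n) U)" for i
    using u unfolding sobolev_loc_def by (simp add: numeral_2_eq_2)
  have 1: "has_weak_deriv U i u (weak_deriv U i u) \<and> weak_deriv U i u \<in> Lp_loc CARD('n) U" for i
  proof -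
    obtain g where g: "has_weak_deriv U i u g" "g \<in> Lp_loc CARD('n) U" using first by blast
    have "AE x in lebesgue_on U. g x = weak_deriv U i u x"
      by (rule weak_deriv_unique[OF U g(1) wd[OF g(1)]])
    from Lp_loc_cong_AE[OF U g(2) this] wd[OF g(1)] show ?thesis by simp
  qed
  have 2: "has_weak_deriv U j (weak_deriv U i u) (weak_deriv U j (weak_deriv U i u)) \<and>
    weak_deriv U j (weak_deriv U i u) \<in> Lp_loc CARD('n) U" for i j
  proof -
    obtain g h where g: "has_weak_deriv U i u g" and h: "has_weak_deriv U j g h" "h \<in> Lp_loc CARD('n) U"
      using first by blast
    have AE: "AE x in lebesgue_on U. g x = weak_deriv U i u x"
      by (rule weak_deriv_unique[OF U g wd[OF g]])
    have "weak_deriv U i u \<in> Lp_loc 1 U"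
      using 1[of i] unfolding has_weak_deriv_def by blast
    from has_weak_deriv_cong_AE[OF U h(1) this AE]
    have h': "has_weak_deriv U j (weak_deriv U i u) h" .
    have "AE x in lebesgue_on U. h x = weak_deriv U j (weak_deriv U i u) x"
      by (rule weak_deriv_unique[OF U h' wd[OF h']])
    from Lp_loc_cong_AE[OF U h(2) this] wd[OF h'] show ?thesis by simp
  qed
  show ?thesis
    using 1 2 unfolding W2_jet_def weak_grad_def weak_hessian_def by simp
qed

text \<open>Differentiability is given only relative to the symmetric matrices. Moving in
  \<open>p\<close> or \<open>z\<close> alone never leaves this domain, so the slices have
  unrestricted derivatives.\<close>

lemma C1_on_slice_p:
  fixes F :: "real \<Rightarrow> real^'n \<Rightarrow> real^'n^'n \<Rightarrow> real"
  assumes "C1_on (UNIV \<times> UNIV \<times> sym_mats) (\<lambda>(z, p, M). F z p M)" "M \<in> sym_mats"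
  shows "((\<lambda>q. F z q M) has_derivative (\<lambda>h. D_p F z p M \<bullet> h)) (at p)"
    and "((\<lambda>t. F t p M) has_real_derivative D_z F z p M) (at z)"
proof -
  let ?S = "UNIV \<times> UNIV \<times> sym_mats :: (real \<times> (real^'n) \<times> (real^'n^'n)) set"
  let ?F = "\<lambda>(z, p, M). F z p M"
  obtain f' where f': "\<And>x. x \<in> ?S \<Longrightarrow> (?F has_derivative blinfun_apply (f' x)) (at x within ?S)"
    using assms(1) unfolding C1_on_def by blast
  have x: "(z, p, M) \<in> ?S" using assms(2) by simp
  have "((\<lambda>q. ?F (z, q, M)) has_derivative (\<lambda>h. f' (z, p, M) (0, h, 0))) (at p)"
  proof (rule has_derivative_in_compose[where f = "\<lambda>q. (z, q, M)"])
    show "((\<lambda>q. (z, q, M)) has_derivative (\<lambda>h. (0, h, 0))) (at p)"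
      by (auto intro!: has_derivative_Pair has_derivative_const has_derivative_ident)
    show "(?F has_derivative blinfun_apply (f' (z, p, M))) (at (z, p, M) within range (\<lambda>q. (z, q, M)))"
      by (rule has_derivative_subset[OF f'[OF x]]) (use assms(2) in auto)
  qed
  then have d: "((\<lambda>q. F z q M) has_derivative (\<lambda>h. f' (z, p, M) (0, h, 0))) (at p)" by simp
  have "(\<lambda>h. f' (z, p, M) (0, h, 0)) = (\<lambda>h. D_p F z p M \<bullet> h)"
  proof
    fix h
    have "linear (\<lambda>h. f' (z, p, M) (0, h, 0))"
      using d by (rule has_derivative_linear)
    then show "f' (z, p, M) (0, h, 0) = D_p F z p M \<bullet> h"
      unfolding D_p_def partial_deriv_def frechet_derivative_at[OF d, symmetric]
      by (rule linear_eq_inner_vec)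
  qed
  with d show "((\<lambda>q. F z q M) has_derivative (\<lambda>h. D_p F z p M \<bullet> h)) (at p)" by simp
  have "((\<lambda>t. ?F (t, p, M)) has_derivative (\<lambda>h. f' (z, p, M) (h, 0, 0))) (at z)"
  proof (rule has_derivative_in_compose[where f = "\<lambda>t. (t, p, M)"])
    show "((\<lambda>t. (t, p, M)) has_derivative (\<lambda>h. (h, 0, 0))) (at z)"
      by (auto intro!: has_derivative_Pair has_derivative_const has_derivative_ident)
    show "(?F has_derivative blinfun_apply (f' (z, p, M))) (at (z, p, M) within range (\<lambda>t. (t, p, M)))"
      by (rule has_derivative_subset[OF f'[OF x]]) (use assms(2) in auto)
  qed
  then have "(\<lambda>t. F t p M) differentiable (at z)" by (auto intro: differentiableI)
  then obtain D where "((\<lambda>t. F t p M) has_real_derivative D) (at z)"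
    using real_differentiable_def by blast
  then show "((\<lambda>t. F t p M) has_real_derivative D_z F z p M) (at z)"
    unfolding D_z_def by (simp add: DERIV_imp_deriv)
qed

lemma structure_mono_z:
  assumes F: "structure_conditions F" and M: "M \<in> sym_mats" and le: "z \<le> z'"
  shows "F z p M \<le> F z' p M"
proof (rule DERIV_nonneg_imp_nondecreasing[OF le])
  fix t
  have "D_z F t p M \<ge> 0" using F M unfolding structure_conditions_def by blast
  moreover have "((\<lambda>t. F t p M) has_real_derivative D_z F t p M) (at t)"
    using F M C1_on_slice_p(2) unfolding structure_conditions_def by blast
  ultimately show "\<exists>y. ((\<lambda>z. F z p M) has_real_derivative y) (at t) \<and> 0 \<le> y" by blast
qed

text \<open>The growth bound on F_p integrated along a segment. Its linearity in \<open>M\<close> is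
  decisive: it keeps the resulting coefficient in L^n.\<close>

lemma structure_lipschitz_p:
  assumes F: "structure_conditions F" and "C > 0"
  shows "\<exists>c>0. \<forall>z p q. \<forall>M\<in>sym_mats. \<bar>z\<bar> \<le> C \<longrightarrow>
    \<bar>F z p M - F z q M\<bar> \<le> c * (1 + norm p + norm q + norm M) * norm (p - q)"
proof -
  obtain c where c: "c > 0" "\<And>z p M. M \<in> sym_mats \<Longrightarrow> \<bar>z\<bar> \<le> C \<Longrightarrow> norm (D_p F z p M) \<le> c * (1 + norm p + norm M)"
    using F \<open>C > 0\<close> unfolding structure_conditions_def by metis
  have C1: "C1_on (UNIV \<times> UNIV \<times> sym_mats) (\<lambda>(z, p, M). F z p M)"
    using F unfolding structure_conditions_def by blast
  have "\<bar>F z p M - F z q M\<bar> \<le> c * (1 + norm p + norm q + norm M) * norm (p - q)"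
    if M: "M \<in> sym_mats" and z: "\<bar>z\<bar> \<le> C" for z p q M
  proof -
    have "norm (F z p M - F z q M) \<le> c * (1 + norm p + norm q + norm M) * norm (p - q)"
    proof (rule differentiable_bound[OF convex_closed_segment])
      fix y assume y: "y \<in> closed_segment p q"
      show "((\<lambda>q. F z q M) has_derivative (\<lambda>h. D_p F z y M \<bullet> h)) (at y within closed_segment p q)"
        by (rule has_derivative_at_withinI[OF C1_on_slice_p(1)[OF C1 M]])
      have "norm y \<le> norm p + norm q"
      proof -
        obtain t where t: "0 \<le> t" "t \<le> 1" "y = (1 - t) *\<^sub>R p + t *\<^sub>R q"
          using y by (auto simp: in_segment)
        have "norm y \<le> norm ((1 - t) *\<^sub>R p) + norm (t *\<^sub>R q)" unfolding t(3) by (rule norm_triangle_ineq)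
        also have "\<dots> \<le> 1 * norm p + 1 * norm q" using t by (auto intro!: add_mono simp: mult_left_le_one_le)
        finally show ?thesis by simp
      qed
      then have "norm (D_p F z y M) \<le> c * (1 + norm p + norm q + norm M)"
        using c(1) by (intro order_trans[OF c(2)[OF M z]] mult_left_mono) auto
      then show "onorm (\<lambda>h. D_p F z y M \<bullet> h) \<le> c * (1 + norm p + norm q + norm M)"
        using c(1) by (intro onorm_bound) (auto intro!: order_trans[OF Cauchy_Schwarz_ineq2] mult_right_mono)
    qed auto
    then show ?thesis by simp
  qed
  with c(1) show ?thesis by blast
qed

text \<open>Where \<open>a > b\<close> and \<open>Mb - Ma\<close> is positive semidefinite,
  ellipticity and monotonicity in z give F(b, Pa, Mb) \<le> - \<theta> tr(Mb - Ma). Since F(b, Pb,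
  Mb) \<ge> 0, the Lipschitz bound in p yields the hypothesis of the maximum principle for
  \<open>a - b\<close>.\<close>

theorem comparison_principle:
  fixes G :: "(real^'n) set"
  assumes F: "structure_conditions F" and G: "open G" "bounded G"
    and cont: "continuous_on (closure G) a" "continuous_on (closure G) b"
    and bd: "\<And>x. x \<in> frontier G \<Longrightarrow> a x \<le> b x"
    and jet: "W2_jet G a Pa Ma" "W2_jet G b Pb Mb"
    and AE: "AE x in lebesgue_on G. a x > b x \<longrightarrow> F (a x) (Pa x) (Ma x) \<le> 0 \<and> 0 \<le> F (b x) (Pb x) (Mb x)"
    and x: "x \<in> G"
  shows "a x \<le> b x"
proof -
  have "compact (b ` closure G)"
    using G(2) by (intro compact_continuous_image cont) (simp add: compact_closure)
  from compact_imp_bounded[OF this] obtain C0 where "\<forall>y\<in>b ` closure G. norm y \<le> C0"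
    unfolding bounded_iff by blast
  then have C0: "\<bar>b x\<bar> \<le> C0" if "x \<in> closure G" for x
    using that by auto
  define C where "C = \<bar>C0\<bar> + 1"
  have C: "C > 0" "\<And>x. x \<in> G \<Longrightarrow> \<bar>b x\<bar> \<le> C"
    using C0 closure_subset by (fastforce simp: C_def)+
  obtain c where c: "c > 0" "\<forall>z p q. \<forall>M\<in>sym_mats. \<bar>z\<bar> \<le> C \<longrightarrow>
    \<bar>F z p M - F z q M\<bar> \<le> c * (1 + norm p + norm q + norm M) * norm (p - q)"
    using structure_lipschitz_p[OF F C(1)] by blast
  obtain \<theta> where \<theta>: "\<theta> > 0" "\<And>z p M N. M \<in> sym_mats \<Longrightarrow> N \<in> psd_mats \<Longrightarrow> F z p (M + N) - F z p M \<le> - \<theta> * trace N"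
    using F unfolding structure_conditions_def by metis
  \<comment> \<open>The Lipschitz coefficient with norms replaced by sums of absolute entries, so
    that its integrability follows entry by entry. Only \<open>Mb\<close> occurs, since gradients
    are compared at the Hessian of \<open>b\<close>.\<close>
  define \<beta> where "\<beta> x = c * (1 + (\<Sum>i\<in>UNIV. \<bar>Pa x $ i\<bar>) + (\<Sum>i\<in>UNIV. \<bar>Pb x $ i\<bar>) +
    (\<Sum>i\<in>UNIV. \<Sum>j\<in>UNIV. \<bar>Mb x $ i $ j\<bar>))" for x
  have \<beta>: "\<beta> \<in> Lp_loc CARD('n) G"
    unfolding \<beta>_def using jet unfolding W2_jet_def
    by (intro Lp_loc_cmult Lp_loc_add Lp_loc_sum Lp_loc_const Lp_loc_abs finite) auto
  have \<beta>_ge: "c * (1 + norm (Pa x) + norm (Pb x) + norm (Mb x)) \<le> \<beta> x" for x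
  proof -
    have "norm (Mb x) \<le> (\<Sum>i\<in>UNIV. norm (Mb x $ i))"
      unfolding norm_vec_def by (rule L2_set_le_sum) simp
    also have "\<dots> \<le> (\<Sum>i\<in>UNIV. \<Sum>j\<in>UNIV. \<bar>Mb x $ i $ j\<bar>)"
      by (intro sum_mono norm_le_l1_cart)
    finally show ?thesis
      unfolding \<beta>_def using c(1) norm_le_l1_cart[of "Pa x"] norm_le_l1_cart[of "Pb x"]
      by (intro mult_left_mono) auto
  qed
  have "(\<lambda>x. a x - b x) x \<le> 0"
  proof (rule weak_maximum_principle[OF G _ _ W2_jet_diff[OF G(1) jet] \<beta> \<theta>(1) _ x])
    show "continuous_on (closure G) (\<lambda>x. a x - b x)" by (intro continuous_intros cont)
    show "a x - b x \<le> 0" if "x \<in> frontier G" for x using bd[OF that] by simp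
    show "AE x in lebesgue_on G. a x - b x > 0 \<and> - (Ma x - Mb x) \<in> psd_mats \<longrightarrow>
      \<theta> * trace (- (Ma x - Mb x)) \<le> \<beta> x * norm (Pa x - Pb x)"
      using AE W2_jet_symmetric[OF G(1) jet(1)] W2_jet_symmetric[OF G(1) jet(2)] AE_space
    proof eventually_elim
      case (elim x)
      show ?case
      proof
        assume *: "a x - b x > 0 \<and> - (Ma x - Mb x) \<in> psd_mats"
        let ?N = "- (Ma x - Mb x)"
        have xG: "x \<in> G" using elim(4) by (simp add: space_restrict_space)
        have "F (b x) (Pa x) (Ma x + ?N) - F (b x) (Pa x) (Ma x) \<le> - \<theta> * trace ?N"
          by (rule \<theta>(2)) (use elim * in auto)
        moreover have "Ma x + ?N = Mb x" by simp
        moreover have "F (b x) (Pa x) (Ma x) \<le> F (a x) (Pa x) (Ma x)"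
          by (rule structure_mono_z[OF F]) (use elim * in auto)
        moreover have "F (a x) (Pa x) (Ma x) \<le> 0" "0 \<le> F (b x) (Pb x) (Mb x)"
          using elim(1) * by auto
        moreover have "\<bar>F (b x) (Pa x) (Mb x) - F (b x) (Pb x) (Mb x)\<bar> \<le>
          c * (1 + norm (Pa x) + norm (Pb x) + norm (Mb x)) * norm (Pa x - Pb x)"
          using c(2) elim(3) C(2)[OF xG] by blast
        moreover have "\<dots> \<le> \<beta> x * norm (Pa x - Pb x)"
          by (intro mult_right_mono \<beta>_ge) simp
        ultimately show "\<theta> * trace ?N \<le> \<beta> x * norm (Pa x - Pb x)"
          by (simp add: abs_le_iff)
      qed
    qed
  qed
  then show ?thesis by simp
qed

section \<open>Gauge functions and obstacles\<close>

context
  fixes K :: "(real^'n) set"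
  assumes K: "compact K" "convex K" "0 \<in> interior K"
begin

lemma gauge_set_nonempty: "{l. l > 0 \<and> x \<in> (\<lambda>y. l *\<^sub>R y) ` K} \<noteq> {}"
  and gauge_bound: "\<exists>C>0. \<forall>x. gauge_fun K x \<le> C * norm x"
  and gauge_bdd_below: "bdd_below {l. l > 0 \<and> x \<in> (\<lambda>y. l *\<^sub>R y) ` K}"
proof -
  show bb: "bdd_below {l. l > 0 \<and> x \<in> (\<lambda>y. l *\<^sub>R y) ` K}" for x :: "real^'n"
    by (rule bdd_belowI[of _ 0]) auto
  obtain e where e: "e > 0" "cball 0 e \<subseteq> K"
    using K(3) by (meson mem_interior_cball)
  have mem: "l \<in> {l. l > 0 \<and> x \<in> (\<lambda>y. l *\<^sub>R y) ` K}" if "l > 0" "norm x \<le> l * e" for x l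
  proof -
    have "norm ((1 / l) *\<^sub>R x) \<le> e" using that by (simp add: field_simps)
    then have "(1 / l) *\<^sub>R x \<in> K" using e(2) by auto
    then have "x \<in> (\<lambda>y. l *\<^sub>R y) ` K" using that(1) by (intro image_eqI[of _ _ "(1 / l) *\<^sub>R x"]) auto
    with that(1) show ?thesis by simp
  qed
  have "norm x / e + 1 > 0" using e(1) by (intro add_nonneg_pos) auto
  moreover have "norm x \<le> (norm x / e + 1) * e" using e(1) by (simp add: field_simps)
  ultimately have "norm x / e + 1 \<in> {l. l > 0 \<and> x \<in> (\<lambda>y. l *\<^sub>R y) ` K}" by (rule mem)
  then show "{l. l > 0 \<and> x \<in> (\<lambda>y. l *\<^sub>R y) ` K} \<noteq> {}" by blast
  have "gauge_fun K x \<le> 1 / e * norm x" for x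
  proof (rule field_le_epsilon)
    fix d :: real assume "d > 0"
    show "gauge_fun K x \<le> 1 / e * norm x + d"
      unfolding gauge_fun_def
      by (rule cInf_lower[OF mem bb]) (use e(1) \<open>d > 0\<close> in \<open>auto simp: field_simps intro: add_nonneg_pos\<close>)
  qed
  then show "\<exists>C>0. \<forall>x. gauge_fun K x \<le> C * norm x"
    using e(1) by (intro exI[of _ "1 / e"]) auto
qed

lemma gauge_le: "l > 0 \<Longrightarrow> y \<in> K \<Longrightarrow> gauge_fun K (l *\<^sub>R y) \<le> l"
  unfolding gauge_fun_def by (rule cInf_lower[OF _ gauge_bdd_below]) auto

lemma gauge_nonneg: "gauge_fun K x \<ge> 0"
  unfolding gauge_fun_def by (rule cInf_greatest[OF gauge_set_nonempty]) auto

lemma zero_in_K: "0 \<in> K"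
  using K(3) interior_subset by blast

text \<open>The dilates of \<open>K\<close> increase, because \<open>K\<close> is convex and
  contains 0; hence every factor above the infimum is admissible.\<close>

lemma gauge_less:
  assumes "gauge_fun K x < l"
  obtains y where "y \<in> K" "x = l *\<^sub>R y" "l > 0"
proof -
  obtain l' where l': "l' > 0" "x \<in> (\<lambda>y. l' *\<^sub>R y) ` K" "l' < l"
    using cInf_lessD[OF gauge_set_nonempty assms[unfolded gauge_fun_def]] by auto
  then obtain y where y: "y \<in> K" "x = l' *\<^sub>R y" by blast
  have "(1 - l' / l) *\<^sub>R 0 + (l' / l) *\<^sub>R y \<in> K"
    using l' by (intro convexD[OF K(2) zero_in_K y(1)]) auto
  moreover have "x = l *\<^sub>R ((1 - l' / l) *\<^sub>R 0 + (l' / l) *\<^sub>R y)"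
    using l' y by simp
  ultimately show ?thesis using that l' by (metis order.strict_trans)
qed

lemma gauge_triangle: "gauge_fun K (x + z) \<le> gauge_fun K x + gauge_fun K z"
proof (rule field_le_epsilon)
  fix e :: real assume e: "e > 0"
  define a where "a = gauge_fun K x + e / 2"
  define b where "b = gauge_fun K z + e / 2"
  have "gauge_fun K x < a" "gauge_fun K z < b" using e by (auto simp: a_def b_def)
  then obtain y1 y2 where y: "y1 \<in> K" "x = a *\<^sub>R y1" "a > 0" "y2 \<in> K" "z = b *\<^sub>R y2" "b > 0"
    by (elim gauge_less)
  have "(a / (a + b)) *\<^sub>R y1 + (b / (a + b)) *\<^sub>R y2 \<in> K"
  proof (rule convexD[OF K(2) y(1,4)])
    have "a + b \<noteq> 0" using y by simp
    then show "a / (a + b) + b / (a + b) = 1" by (simp add: add_divide_distrib[symmetric])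
  qed (use y in auto)
  from gauge_le[OF _ this, of "a + b"] have "gauge_fun K (x + z) \<le> a + b"
    using y by (simp add: scaleR_right_distrib)
  then show "gauge_fun K (x + z) \<le> gauge_fun K x + gauge_fun K z + e"
    by (simp add: a_def b_def)
qed

lemma gauge_zero: "gauge_fun K 0 = 0"
proof -
  obtain C where "\<forall>x. gauge_fun K x \<le> C * norm x" using gauge_bound by blast
  from this[rule_format, of 0] gauge_nonneg[of 0] show ?thesis by simp
qed

lemma gauge_scale_le:
  assumes t: "t > 0"
  shows "gauge_fun K (t *\<^sub>R x) \<le> t * gauge_fun K x"
proof (rule field_le_epsilon)
  fix e :: real assume e: "e > 0"
  have "gauge_fun K x < gauge_fun K x + e / t" using e t by simp
  then obtain y where y: "y \<in> K" "x = (gauge_fun K x + e / t) *\<^sub>R y" "gauge_fun K x + e / t > 0"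
    by (rule gauge_less)
  have "gauge_fun K ((t * (gauge_fun K x + e / t)) *\<^sub>R y) \<le> t * (gauge_fun K x + e / t)"
    by (rule gauge_le) (use y t in auto)
  moreover have "(t * (gauge_fun K x + e / t)) *\<^sub>R y = t *\<^sub>R x"
    using y(2) by (metis scaleR_scaleR)
  ultimately show "gauge_fun K (t *\<^sub>R x) \<le> t * gauge_fun K x + e"
    using t by (simp add: algebra_simps)
qed

lemma gauge_scale:
  assumes t: "t > 0"
  shows "gauge_fun K (t *\<^sub>R x) = t * gauge_fun K x"
  using gauge_scale_le[OF t, of x] gauge_scale_le[of "1 / t" "t *\<^sub>R x"] t
  by (simp add: field_simps)

text \<open>Boundedness of \<open>K\<close> keeps admissible factors away from 0.\<close>

lemma gauge_pos:
  assumes "x \<noteq> 0"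
  shows "gauge_fun K x > 0"
proof -
  obtain R where R: "\<And>y. y \<in> K \<Longrightarrow> norm y \<le> R" "R > 0"
    using compact_imp_bounded[OF K(1)] bounded_pos by metis
  have "norm x / R \<le> gauge_fun K x"
    unfolding gauge_fun_def
  proof (rule cInf_greatest[OF gauge_set_nonempty])
    fix l assume "l \<in> {l. l > 0 \<and> x \<in> (\<lambda>y. l *\<^sub>R y) ` K}"
    then obtain y where "l > 0" "y \<in> K" "x = l *\<^sub>R y" by blast
    then show "norm x / R \<le> l" using R by (simp add: field_simps)
  qed
  moreover have "norm x / R > 0" using assms R(2) by simp
  ultimately show ?thesis by linarith
qed

lemma continuous_gauge: "continuous_on A (gauge_fun K)"
proof -
  obtain C where C: "C > 0" "\<And>x. gauge_fun K x \<le> C * norm x" using gauge_bound by blast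
  have "\<bar>gauge_fun K x - gauge_fun K y\<bar> \<le> C * norm (x - y)" for x y
    using gauge_triangle[of y "x - y"] gauge_triangle[of x "y - x"] C(2)[of "x - y"] C(2)[of "y - x"]
    by (simp add: norm_minus_commute abs_le_iff)
  then have "C-lipschitz_on A (gauge_fun K)"
    using C(1) by (intro lipschitz_onI) (auto simp: dist_norm)
  then show ?thesis by (rule lipschitz_on_continuous_on)
qed

lemma gauge_polar_le_1:
  assumes "\<And>h. g \<bullet> h \<le> gauge_fun K h"
  shows "gauge_fun (polar_set K) g \<le> 1"
proof -
  have "g \<in> polar_set K"
    unfolding polar_set_def
  proof (safe)
    fix y assume "y \<in> K"
    then show "g \<bullet> y \<le> 1" using assms[of y] gauge_le[of 1 y] by simp
  qed
  then have "1 \<in> {l. l > 0 \<and> g \<in> (\<lambda>y. l *\<^sub>R y) ` polar_set K}" by force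
  then show ?thesis
    unfolding gauge_fun_def by (rule cInf_lower) (auto intro!: bdd_belowI[of _ 0])
qed

text \<open>If \<open>g\<close> is \<open>l\<close> times an element of the polar, then the gauge of
  \<open>h\<close> is at most \<open>g \<bullet> h\<close>, which is at most \<open>l\<close> times
  that gauge; the gauge is positive, so \<open>l\<close> is at least 1.\<close>

lemma gauge_polar_ge_1:
  assumes h: "h \<noteq> 0" "g \<bullet> h \<ge> gauge_fun K h"
  shows "gauge_fun (polar_set K) g \<ge> 1"
  unfolding gauge_fun_def[of "polar_set K"]
proof (rule cInf_greatest)
  \<comment> \<open>The infimum of an empty set would be unspecified. Boundedness of
    \<open>K\<close> shows that some dilate of the polar contains \<open>g\<close>.\<close>
  obtain R where R: "\<And>y. y \<in> K \<Longrightarrow> norm y \<le> R" "R > 0"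
    using compact_imp_bounded[OF K(1)] bounded_pos by metis
  define l where "l = norm g * R + 1"
  have l: "l > 0" using R(2) by (simp add: l_def add_nonneg_pos)
  have "(1 / l) *\<^sub>R g \<in> polar_set K"
    unfolding polar_set_def
  proof safe
    fix y assume "y \<in> K"
    have "g \<bullet> y \<le> norm g * norm y" by (rule norm_cauchy_schwarz)
    also have "\<dots> \<le> norm g * R" using R(1)[OF \<open>y \<in> K\<close>] by (rule mult_left_mono) simp
    finally have "g \<bullet> y \<le> l" by (simp add: l_def)
    then show "(1 / l) *\<^sub>R g \<bullet> y \<le> 1" using l by (simp add: field_simps)
  qed
  then have "g \<in> (\<lambda>y. l *\<^sub>R y) ` polar_set K"
    using l by (intro image_eqI[of _ _ "(1 / l) *\<^sub>R g"]) auto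
  with l show "{l. l > 0 \<and> g \<in> (\<lambda>y. l *\<^sub>R y) ` polar_set K} \<noteq> {}" by blast
next
  fix l assume "l \<in> {l. l > 0 \<and> g \<in> (\<lambda>y. l *\<^sub>R y) ` polar_set K}"
  then obtain q where q: "l > 0" "q \<in> polar_set K" "g = l *\<^sub>R q" by blast
  have "q \<bullet> h \<le> gauge_fun K h"
  proof (rule field_le_epsilon)
    fix e :: real assume "e > 0"
    then have "gauge_fun K h < gauge_fun K h + e" by simp
    then obtain y where y: "y \<in> K" "h = (gauge_fun K h + e) *\<^sub>R y" "gauge_fun K h + e > 0"
      by (rule gauge_less)
    have "q \<bullet> y \<le> 1" using q(2) y(1) by (simp add: polar_set_def)
    then have "(gauge_fun K h + e) * (q \<bullet> y) \<le> (gauge_fun K h + e) * 1"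
      using y(3) by (intro mult_left_mono) auto
    then show "q \<bullet> h \<le> gauge_fun K h + e"
      by (subst y(2)) simp
  qed
  then have "gauge_fun K h \<le> l * gauge_fun K h"
    using h(2) q by (metis inner_scaleR_left mult_left_mono order_trans less_imp_le)
  then show "1 \<le> l" using gauge_pos[OF h(1)] by simp
qed

section \<open>Elementary properties of the two obstacles\<close>

context
  fixes U :: "(real^'n) set" and \<phi> :: "real^'n \<Rightarrow> real"
  assumes U: "open U" "bounded U" "U \<noteq> {}" and \<phi>: "continuous_on UNIV \<phi>"
    and lip: "\<And>x y. \<phi> x - \<phi> y \<le> gauge_fun K (x - y)"
begin

lemma frontier_compact: "compact (frontier U)" and frontier_ne: "frontier U \<noteq> {}"
proof -
  show "compact (frontier U)" using U(2) by (rule compact_frontier_bounded)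
  show "frontier U \<noteq> {}"
  proof
    assume "frontier U = {}"
    then have "U = UNIV" using U(3) frontier_eq_empty by blast
    then show False using U(2) not_bounded_UNIV by blast
  qed
qed

text \<open>The one-sided Lipschitz bound supplies the lower bound \<open>\<phi> x\<close> that
  gives the infimum its meaning; compactness of the frontier makes it a minimum.\<close>

lemma upper_attained: "\<exists>y\<in>frontier U. upper_obstacle K U \<phi> x = gauge_fun K (x - y) + \<phi> y"
  and upper_le: "y \<in> frontier U \<Longrightarrow> upper_obstacle K U \<phi> x \<le> gauge_fun K (x - y) + \<phi> y"
proof -
  have bb: "bdd_below ((\<lambda>y. gauge_fun K (x - y) + \<phi> y) ` frontier U)"
  proof (rule bdd_belowI2)
    show "\<phi> x \<le> gauge_fun K (x - y) + \<phi> y" for y using lip[of x y] by simp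
  qed
  then show "y \<in> frontier U \<Longrightarrow> upper_obstacle K U \<phi> x \<le> gauge_fun K (x - y) + \<phi> y"
    unfolding upper_obstacle_def by (rule cINF_lower)
  have "continuous_on (frontier U) (\<lambda>y. gauge_fun K (x - y) + \<phi> y)"
    by (intro continuous_intros continuous_on_compose2[OF continuous_gauge[of UNIV]] continuous_on_subset[OF \<phi>]) auto
  from continuous_attains_inf[OF frontier_compact frontier_ne this] obtain y where
    y: "y \<in> frontier U" "\<And>z. z \<in> frontier U \<Longrightarrow> gauge_fun K (x - y) + \<phi> y \<le> gauge_fun K (x - z) + \<phi> z"
    by blast
  have "upper_obstacle K U \<phi> x = gauge_fun K (x - y) + \<phi> y"
    unfolding upper_obstacle_def
    by (rule antisym[OF cINF_lower[OF bb y(1)] cINF_greatest[OF frontier_ne y(2)]])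
  with y(1) show "\<exists>y\<in>frontier U. upper_obstacle K U \<phi> x = gauge_fun K (x - y) + \<phi> y" by blast
qed

lemma lower_attained: "\<exists>y\<in>frontier U. lower_obstacle K U \<phi> x = gauge_fun K (y - x) - \<phi> y"
  and lower_le: "y \<in> frontier U \<Longrightarrow> lower_obstacle K U \<phi> x \<le> gauge_fun K (y - x) - \<phi> y"
proof -
  have bb: "bdd_below ((\<lambda>y. gauge_fun K (y - x) - \<phi> y) ` frontier U)"
  proof (rule bdd_belowI2)
    show "- \<phi> x \<le> gauge_fun K (y - x) - \<phi> y" for y using lip[of y x] by simp
  qed
  then show "y \<in> frontier U \<Longrightarrow> lower_obstacle K U \<phi> x \<le> gauge_fun K (y - x) - \<phi> y"
    unfolding lower_obstacle_def by (rule cINF_lower)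
  have "continuous_on (frontier U) (\<lambda>y. gauge_fun K (y - x) - \<phi> y)"
    by (intro continuous_intros continuous_on_compose2[OF continuous_gauge[of UNIV]] continuous_on_subset[OF \<phi>]) auto
  from continuous_attains_inf[OF frontier_compact frontier_ne this] obtain y where
    y: "y \<in> frontier U" "\<And>z. z \<in> frontier U \<Longrightarrow> gauge_fun K (y - x) - \<phi> y \<le> gauge_fun K (z - x) - \<phi> z"
    by blast
  have "lower_obstacle K U \<phi> x = gauge_fun K (y - x) - \<phi> y"
    unfolding lower_obstacle_def
    by (rule antisym[OF cINF_lower[OF bb y(1)] cINF_greatest[OF frontier_ne y(2)]])
  with y(1) show "\<exists>y\<in>frontier U. lower_obstacle K U \<phi> x = gauge_fun K (y - x) - \<phi> y" by blast
qed

lemma upper_frontier: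
  assumes "x \<in> frontier U"
  shows "upper_obstacle K U \<phi> x = \<phi> x"
proof -
  obtain y where y: "upper_obstacle K U \<phi> x = gauge_fun K (x - y) + \<phi> y" using upper_attained by blast
  then have "\<phi> x \<le> upper_obstacle K U \<phi> x" using lip[of x y] by simp
  moreover have "upper_obstacle K U \<phi> x \<le> \<phi> x" using upper_le[OF assms, of x] by (simp add: gauge_zero)
  ultimately show ?thesis by simp
qed

lemma lower_frontier:
  assumes "x \<in> frontier U"
  shows "lower_obstacle K U \<phi> x = - \<phi> x"
proof -
  obtain y where y: "lower_obstacle K U \<phi> x = gauge_fun K (y - x) - \<phi> y" using lower_attained by blast
  then have "- \<phi> x \<le> lower_obstacle K U \<phi> x" using lip[of y x] by simp
  moreover have "lower_obstacle K U \<phi> x \<le> - \<phi> x" using lower_le[OF assms, of x] by (simp add: gauge_zero)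
  ultimately show ?thesis by simp
qed

text \<open>Keeping the minimizing boundary point of \<open>x\<close> costs at most the gauge of
  \<open>h\<close>. With its counterpart below, this lets the obstacle constraints be compared at
  \<open>x\<close> and at \<open>x + h\<close>.\<close>

lemma upper_shift: "upper_obstacle K U \<phi> (x + h) \<le> upper_obstacle K U \<phi> x + gauge_fun K h"
proof -
  obtain y where y: "y \<in> frontier U" "upper_obstacle K U \<phi> x = gauge_fun K (x - y) + \<phi> y" using upper_attained by blast
  have "upper_obstacle K U \<phi> (x + h) \<le> gauge_fun K ((x - y) + h) + \<phi> y"
    using upper_le[OF y(1), of "x + h"] by (simp add: algebra_simps)
  then show ?thesis using gauge_triangle[of "x - y" h] y(2) by simp
qed

lemma lower_shift: "lower_obstacle K U \<phi> x \<le> lower_obstacle K U \<phi> (x + h) + gauge_fun K h"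
proof -
  obtain y where y: "y \<in> frontier U" "lower_obstacle K U \<phi> (x + h) = gauge_fun K (y - (x + h)) - \<phi> y"
    using lower_attained by blast
  have "lower_obstacle K U \<phi> x \<le> gauge_fun K ((y - (x + h)) + h) - \<phi> y"
    using lower_le[OF y(1), of x] by (simp add: algebra_simps)
  then show ?thesis using gauge_triangle[of "y - (x + h)" h] y(2) by simp
qed

lemma continuous_obstacles:
  "continuous_on A (upper_obstacle K U \<phi>)" "continuous_on A (lower_obstacle K U \<phi>)"
proof -
  obtain C where C: "C > 0" "\<And>x. gauge_fun K x \<le> C * norm x" using gauge_bound by blast
  have "\<bar>upper_obstacle K U \<phi> x - upper_obstacle K U \<phi> y\<bar> \<le> C * norm (x - y)" for x y
    using upper_shift[of x "y - x"] upper_shift[of y "x - y"] C(2)[of "x - y"] C(2)[of "y - x"]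
    by (simp add: norm_minus_commute abs_le_iff)
  then have "C-lipschitz_on A (upper_obstacle K U \<phi>)"
    using C(1) by (intro lipschitz_onI) (auto simp: dist_norm)
  then show "continuous_on A (upper_obstacle K U \<phi>)" by (rule lipschitz_on_continuous_on)
  have "\<bar>lower_obstacle K U \<phi> x - lower_obstacle K U \<phi> y\<bar> \<le> C * norm (x - y)" for x y
    using lower_shift[of x "y - x"] lower_shift[of y "x - y"] C(2)[of "x - y"] C(2)[of "y - x"]
    by (simp add: norm_minus_commute abs_le_iff)
  then have "C-lipschitz_on A (lower_obstacle K U \<phi>)"
    using C(1) by (intro lipschitz_onI) (auto simp: dist_norm)
  then show "continuous_on A (lower_obstacle K U \<phi>)" by (rule lipschitz_on_continuous_on)
qed

text \<open>By continuity the inequality fails on an open subset of \<open>U\<close>; a null open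
  set is empty. Density then carries the inequality to the closure.\<close>

lemma AE_le_closure:
  assumes f: "continuous_on (closure U) f" "continuous_on (closure U) g"
    and AE: "AE x in lebesgue_on U. f x \<le> g x" and x: "x \<in> closure U"
  shows "f x \<le> (g x :: real)"
proof -
  have U_le: "f y \<le> g y" if y: "y \<in> U" for y
  proof (rule ccontr)
    assume "\<not> f y \<le> g y"
    define S where "S = U \<inter> (\<lambda>x. f x - g x) -` {0<..}"
    have "continuous_on U (\<lambda>x. f x - g x)"
      by (rule continuous_on_diff[OF continuous_on_subset[OF f(1) closure_subset]
            continuous_on_subset[OF f(2) closure_subset]])
    then have "open S" unfolding S_def by (intro continuous_open_preimage U) auto
    moreover have "y \<in> S" using y \<open>\<not> f y \<le> g y\<close> by (simp add: S_def)
    ultimately have "\<not> negligible S" using open_not_negligible by blast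
    moreover have "AE x in lebesgue. x \<notin> S"
      using AE unfolding AE_lebesgue_on_iff[OF U(1)] by eventually_elim (auto simp: S_def)
    then have "negligible S"
      using \<open>open S\<close> by (subst negligible_iff_null_sets) (subst AE_iff_null_sets, auto)
    ultimately show False by simp
  qed
  have "closure U \<subseteq> {x \<in> closure U. f x \<le> g x}"
  proof (rule closure_minimal)
    show "U \<subseteq> {x \<in> closure U. f x \<le> g x}" using U_le closure_subset by auto
    have "closed (closure U \<inter> (\<lambda>x. g x - f x) -` {0..})"
      using f by (intro continuous_closed_preimage continuous_intros) auto
    moreover have "closure U \<inter> (\<lambda>x. g x - f x) -` {0..} = {x \<in> closure U. f x \<le> g x}" by auto
    ultimately show "closed {x \<in> closure U. f x \<le> g x}" by simp
  qed
  with x show ?thesis by blast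
qed

end

end

section \<open>The double obstacle problem\<close>

lemma directional_derivative_le:
  fixes u :: "real^'n \<Rightarrow> real"
  assumes d: "(u has_derivative (\<lambda>h. g \<bullet> h)) (at x)" and "\<delta> > 0"
    and le: "\<And>t. 0 < t \<Longrightarrow> t < \<delta> \<Longrightarrow> u (x + t *\<^sub>R k) - u x \<le> t * c"
  shows "g \<bullet> k \<le> c"
proof -
  have "((\<lambda>t. x + t *\<^sub>R k) has_derivative (\<lambda>t. t *\<^sub>R k)) (at 0)"
    by (auto intro!: derivative_eq_intros)
  then have "((\<lambda>t. u (x + t *\<^sub>R k)) has_derivative (\<lambda>t. g \<bullet> (t *\<^sub>R k))) (at 0)"
    by (rule has_derivative_compose) (simp add: d)
  then have "((\<lambda>t. u (x + t *\<^sub>R k)) has_real_derivative g \<bullet> k) (at 0)"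
    by (simp add: has_field_derivative_def mult_commute_abs)
  then have "((\<lambda>t. (u (x + t *\<^sub>R k) - u x) / t) \<longlongrightarrow> g \<bullet> k) (at 0)"
    by (simp add: DERIV_def)
  then have "((\<lambda>t. (u (x + t *\<^sub>R k) - u x) / t) \<longlongrightarrow> g \<bullet> k) (at_right 0)"
    by (rule tendsto_mono[rotated]) (simp add: at_le)
  then show ?thesis
  proof (rule tendsto_upperbound)
    show "\<forall>\<^sub>F t in at_right 0. (u (x + t *\<^sub>R k) - u x) / t \<le> c"
      unfolding eventually_at_right_field using \<open>\<delta> > 0\<close> le
      by (intro exI[of _ \<delta>]) (auto simp: divide_le_eq mult.commute)
  qed simp
qed


theorem theorem2:
  fixes K U :: "(real^'n) set"
    and \<phi> u :: "real^'n \<Rightarrow> real"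
    and F :: "real \<Rightarrow> real^'n \<Rightarrow> real^'n^'n \<Rightarrow> real"
  assumes "compact K" and "convex K" and "0 \<in> interior K"
    and "bounded U" and "open U" and "C1_boundary U"
    and "continuous_on UNIV \<phi>"
    and "\<And>x y. - gauge_fun K (y - x) \<le> \<phi> x - \<phi> y \<and> \<phi> x - \<phi> y \<le> gauge_fun K (x - y)"
    and "structure_conditions F" and "second_order_growth F"
    and "\<exists>v. continuous_on (closure U) v \<and> v \<in> sobolev_loc 2 CARD('n) U \<and> v \<in> W_obstacle K U \<phi> \<and>
             (AE x in lebesgue_on U. op_apply F U v x \<le> 0)"
    and "u \<in> C1_closure U" and "u \<in> sobolev_loc 2 CARD('n) U" and "u \<in> W_obstacle K U \<phi>"
    and "solves_double_obstacle F K U \<phi> u"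
  shows "(AE x in lebesgue_on U. max (op_apply F U u x) (H_fun K (weak_grad U u x)) = 0) \<and>
         (\<forall>x\<in>frontier U. u x = \<phi> x)"
proof (cases "U = {}")
  \<comment> \<open>Both conclusions are vacuous here, and the obstacles would be infima over an
    empty frontier.\<close>
  case True
  then show ?thesis by (simp add: AE_lebesgue_on_iff)
next
  case False
  note K = assms(1-3) and oU = assms(5) and F = assms(9)
  have lip: "\<phi> x - \<phi> y \<le> gauge_fun K (x - y)" for x y using assms(8) by blast
  note ob = oU assms(4) False assms(7) lip
  let ?up = "upper_obstacle K U \<phi>" and ?lo = "lower_obstacle K U \<phi>"
  note up_cont = continuous_obstacles(1)[OF K ob] and lo_cont = continuous_obstacles(2)[OF K ob]
  obtain v where v: "continuous_on (closure U) v" "v \<in> sobolev_loc 2 CARD('n) U" "v \<in> W_obstacle K U \<phi>"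
    "AE x in lebesgue_on U. op_apply F U v x \<le> 0"
    using assms(11) by blast
  obtain G where uc: "continuous_on (closure U) u" and G: "continuous_on (closure U) G"
    "\<And>x. x \<in> U \<Longrightarrow> (u has_derivative (\<lambda>h. G x \<bullet> h)) (at x)"
    using assms(12) unfolding C1_closure_def by blast
  \<comment> \<open>The obstacle constraints become pointwise up to the boundary, where both
    obstacles meet in \<open>\<phi>\<close>.\<close>
  have between: "- ?lo x \<le> w x" "w x \<le> ?up x"
    if w: "continuous_on (closure U) w" "w \<in> W_obstacle K U \<phi>" and x: "x \<in> closure U" for w x
  proof -
    have AE: "AE x in lebesgue_on U. - ?lo x \<le> w x \<and> w x \<le> ?up x"
      using w(2) unfolding W_obstacle_def by blast
    have "AE x in lebesgue_on U. - ?lo x \<le> w x" using AE by eventually_elim blast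
    from AE_le_closure[OF K ob continuous_on_minus[OF lo_cont] w(1) this x] show "- ?lo x \<le> w x" .
    have "AE x in lebesgue_on U. w x \<le> ?up x" using AE by eventually_elim blast
    from AE_le_closure[OF K ob w(1) up_cont this x] show "w x \<le> ?up x" .
  qed
  have frontier_sub: "frontier U \<subseteq> closure U" by (simp add: frontier_def)
  have boundary: "w x = \<phi> x"
    if w: "continuous_on (closure U) w" "w \<in> W_obstacle K U \<phi>" and x: "x \<in> frontier U" for w x
    using between[OF w subsetD[OF frontier_sub x]] upper_frontier[OF K ob x] lower_frontier[OF K ob x] by simp
  note ub = between[OF uc assms(14)] and vb = between[OF v(1,3)]
  note jet_u = W2_jet_sobolev[OF oU assms(13)] and jet_v = W2_jet_sobolev[OF oU v(2)]
  have solves: "AE x in lebesgue_on U. - ?lo x < u x \<and> u x < ?up x \<longrightarrow> op_apply F U u x = 0"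
    "AE x in lebesgue_on U. u x = ?up x \<longrightarrow> op_apply F U u x \<le> 0"
    "AE x in lebesgue_on U. u x = - ?lo x \<longrightarrow> op_apply F U u x \<ge> 0"
    using assms(15) unfolding solves_double_obstacle_def by auto
  \<comment> \<open>Away from the lower contact set only the free region and the upper contact set
    remain, and both give this sign; \<open>super\<close> is the mirror image.\<close>
  have sub: "AE x in lebesgue_on U. - ?lo x < u x \<longrightarrow> op_apply F U u x \<le> 0"
    using solves(1,2) AE_space
  proof eventually_elim
    case (elim x)
    then have "x \<in> closure U" using closure_subset by (auto simp: space_restrict_space)
    with elim ub(2)[of x] show ?case by (auto simp: less_le)
  qed
  have super: "AE x in lebesgue_on U. u x < ?up x \<longrightarrow> op_apply F U u x \<ge> 0"
    using solves(1,3) AE_space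
  proof eventually_elim
    case (elim x)
    then have "x \<in> closure U" using closure_subset by (auto simp: space_restrict_space)
    with elim ub(1)[of x] show ?case by (auto simp: less_le)
  qed
  \<comment> \<open>Where \<open>v > u\<close>, the bound of \<open>v\<close> by the upper obstacle
    puts \<open>u\<close> strictly below it, so \<open>u\<close> is a supersolution there.\<close>
  have v_le_u: "v x \<le> u x" if "x \<in> U" for x
  proof (rule comparison_principle[OF F oU assms(4) v(1) uc _ jet_v jet_u _ that])
    show "v x \<le> u x" if "x \<in> frontier U" for x
      using boundary[OF v(1,3) that] boundary[OF uc assms(14) that] by simp
    show "AE x in lebesgue_on U. v x > u x \<longrightarrow> F (v x) (weak_grad U v x) (weak_hessian U v x) \<le> 0 \<and>
      0 \<le> F (u x) (weak_grad U u x) (weak_hessian U u x)"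
      using super v(4) AE_space
    proof eventually_elim
      case (elim x)
      then have "x \<in> closure U" using closure_subset by (auto simp: space_restrict_space)
      with elim vb(2)[of x] show ?case by (auto simp: op_apply_def)
    qed
  qed
  have F_le: "AE x in lebesgue_on U. op_apply F U u x \<le> 0"
  proof -
    note jet_d = W2_jet_diff[OF oU jet_v jet_u]
    \<comment> \<open>Zero sets are used twice: the gradient of \<open>v - u\<close> vanishes a.e.
      on \<open>{v = u}\<close>, and each row of the Hessian vanishes a.e. where the corresponding
      gradient component does.\<close>
    have "AE x in lebesgue_on U. v x - u x = 0 \<longrightarrow> (weak_grad U v x - weak_grad U u x) $ i = 0" for i
      by (rule weak_deriv_zero_set[OF oU, where i = i]) (use jet_d in \<open>simp add: W2_jet_def\<close>)
    then have 1: "AE x in lebesgue_on U. \<forall>i\<in>UNIV. v x - u x = 0 \<longrightarrow> (weak_grad U v x - weak_grad U u x) $ i = 0"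
      by (intro AE_finite_allI) auto
    have "AE x in lebesgue_on U. (weak_grad U v x - weak_grad U u x) $ i = 0 \<longrightarrow>
      (weak_hessian U v x - weak_hessian U u x) $ i $ j = 0" for i j
      by (rule weak_deriv_zero_set[OF oU, where i = j]) (use jet_d in \<open>simp add: W2_jet_def\<close>)
    then have 2: "AE x in lebesgue_on U. \<forall>ij\<in>UNIV. (weak_grad U v x - weak_grad U u x) $ fst ij = 0 \<longrightarrow>
      (weak_hessian U v x - weak_hessian U u x) $ fst ij $ snd ij = 0"
      by (intro AE_finite_allI) auto
    show ?thesis
      using sub v(4) 1 2 AE_space
    proof eventually_elim
      case (elim x)
      then have xU: "x \<in> U" and xc: "x \<in> closure U" using closure_subset by (auto simp: space_restrict_space)
      show ?case
      proof (cases "- ?lo x < u x")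
        case True
        then show ?thesis using elim(1) by blast
      next
        case False
        \<comment> \<open>On the lower contact set, \<open>v\<close> is squeezed between the lower
          barrier and \<open>u\<close>, which coincide.\<close>
        then have eq: "v x = u x" using v_le_u[OF xU] vb(1)[OF xc] by simp
        then have g: "weak_grad U v x = weak_grad U u x" using elim(3) by (simp add: vec_eq_iff)
        then have "weak_hessian U v x = weak_hessian U u x" using elim(4) by (simp add: vec_eq_iff)
        then show ?thesis using elim(2) eq g by (simp add: op_apply_def)
      qed
    qed
  qed
  have u_lip: "u (x + h) - u x \<le> gauge_fun K h" if x: "x \<in> U" "x + h \<in> U" for x h
  proof -
    let ?V = "(\<lambda>x. x + h) -` U"
    let ?G = "U \<inter> ?V"
    let ?a = "\<lambda>x. u (x + h) - gauge_fun K h"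
    have oV: "open ?V" by (intro open_vimage oU continuous_intros)
    then have oG: "open ?G" using oU by blast
    have cl: "closure ?G \<subseteq> closure U" "closure ?G \<subseteq> (\<lambda>x. x + h) -` closure U"
    proof -
      show "closure ?G \<subseteq> closure U" by (rule closure_mono) blast
      show "closure ?G \<subseteq> (\<lambda>x. x + h) -` closure U"
        by (rule closure_minimal) (use closure_subset in \<open>auto intro!: closed_vimage continuous_intros\<close>)
    qed
    have jet_a: "W2_jet ?G ?a (\<lambda>x. weak_grad U u (x + h)) (\<lambda>x. weak_hessian U u (x + h))"
      using W2_jet_diff[OF oG W2_jet_subset[OF oV oG _ W2_jet_translate[OF oU jet_u, of h]] W2_jet_const[OF oG]]
      by simp
    have jet_b: "W2_jet ?G u (weak_grad U u) (weak_hessian U u)"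
      by (rule W2_jet_subset[OF oU oG _ jet_u]) blast
    have "?a x \<le> u x"
    proof (rule comparison_principle[OF F oG _ _ _ _ jet_a jet_b])
      show "bounded ?G" using assms(4) by (rule bounded_subset) blast
      show "continuous_on (closure ?G) ?a"
        by (intro continuous_intros continuous_on_compose2[OF uc]) (use cl(2) in auto)
      show "continuous_on (closure ?G) u" by (rule continuous_on_subset[OF uc cl(1)])
      show "x \<in> ?G" using x by simp
      show "?a y \<le> u y" if y: "y \<in> frontier ?G" for y
      proof -
        have "y \<in> closure ?G" and yG: "y \<notin> ?G"
          using y unfolding frontier_def interior_open[OF oG] by auto
        then have yc: "y \<in> closure U" "y + h \<in> closure U"
          using cl by auto
        \<comment> \<open>Both points lie in the closure of \<open>U\<close> but not both in
          \<open>U\<close>. Whichever is on the frontier, the boundary value of \<open>u\<close> and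
          the shift inequality of one obstacle decide.\<close>
        with yG consider "y \<in> frontier U" | "y + h \<in> frontier U"
          using oU by (auto simp: frontier_def interior_open)
        then show ?thesis
        proof cases
          case 1
          then have "u y = ?up y" using boundary[OF uc assms(14)] upper_frontier[OF K ob] by simp
          then show ?thesis using ub(2)[OF yc(2)] upper_shift[OF K ob, of y h] by simp
        next
          case 2
          then have "u (y + h) = - ?lo (y + h)" using boundary[OF uc assms(14)] lower_frontier[OF K ob] by simp
          then show ?thesis using ub(1)[OF yc(1)] lower_shift[OF K ob, of y h] by simp
        qed
      qed
      have 1: "AE y in lebesgue. y \<in> U \<longrightarrow> u y < ?up y \<longrightarrow> op_apply F U u y \<ge> 0"
        using super unfolding AE_lebesgue_on_iff[OF oU] .
      have 2: "AE y in lebesgue. y + h \<in> U \<longrightarrow> - ?lo (y + h) < u (y + h) \<longrightarrow> op_apply F U u (y + h) \<le> 0"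
        using AE_lebesgue_translate[OF sub[unfolded AE_lebesgue_on_iff[OF oU]], of h] .
      have 3: "AE y in lebesgue. y + h \<in> U \<longrightarrow> weak_hessian U u (y + h) \<in> sym_mats"
        using AE_lebesgue_translate[OF W2_jet_symmetric[OF oU jet_u, unfolded AE_lebesgue_on_iff[OF oU]], of h] .
      show "AE y in lebesgue_on ?G. ?a y > u y \<longrightarrow>
        F (?a y) (weak_grad U u (y + h)) (weak_hessian U u (y + h)) \<le> 0 \<and>
        0 \<le> F (u y) (weak_grad U u y) (weak_hessian U u y)"
        unfolding AE_lebesgue_on_iff[OF oG]
        using 1 2 3
      proof eventually_elim
        case (elim y)
        show ?case
        proof (intro impI)
          assume y: "y \<in> ?G" and gt: "?a y > u y"
          then have yc: "y \<in> closure U" "y + h \<in> closure U" using closure_subset by auto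
          have "u y < ?up y" using gt ub(2)[OF yc(2)] upper_shift[OF K ob, of y h] by simp
          moreover have "- ?lo (y + h) < u (y + h)" using gt ub(1)[OF yc(1)] lower_shift[OF K ob, of y h] by simp
          ultimately have le: "op_apply F U u (y + h) \<le> 0" "op_apply F U u y \<ge> 0" using elim y by auto
          \<comment> \<open>The gauge is nonnegative and F is nondecreasing in z, so the lowered
            translate is still a subsolution.\<close>
          have "F (?a y) (weak_grad U u (y + h)) (weak_hessian U u (y + h)) \<le> op_apply F U u (y + h)"
            unfolding op_apply_def
            by (rule structure_mono_z[OF F]) (use elim(3) y gauge_nonneg[OF K] in auto)
          with le show "F (?a y) (weak_grad U u (y + h)) (weak_hessian U u (y + h)) \<le> 0 \<and>
            0 \<le> F (u y) (weak_grad U u y) (weak_hessian U u y)"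
            by (simp add: op_apply_def)
        qed
      qed
    qed
    then show ?thesis by simp
  qed
  have inside: "\<exists>\<delta>>0. \<forall>t. 0 < t \<and> t < \<delta> \<longrightarrow> x + t *\<^sub>R k \<in> U" if x: "x \<in> U" for x k :: "real^'n"
  proof -
    obtain e where e: "e > 0" "ball x e \<subseteq> U" using oU x open_contains_ball by blast
    have "x + t *\<^sub>R k \<in> U" if "0 < t" "t < e / (norm k + 1)" for t
    proof -
      have "t * norm k \<le> t * (norm k + 1)" using that by (intro mult_left_mono) auto
      also have "\<dots> < e" using that by (simp add: pos_less_divide_eq add_nonneg_pos)
      finally show ?thesis using e(2) that by (intro subsetD[OF e(2)]) (simp add: dist_norm)
    qed
    then show ?thesis using e(1) by (intro exI[of _ "e / (norm k + 1)"]) (auto simp: add_nonneg_pos)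
  qed
  have G_le: "H_fun K (G x) \<le> 0" if x: "x \<in> U" for x
  proof -
    have "G x \<bullet> k \<le> gauge_fun K k" for k
    proof -
      obtain \<delta> where \<delta>: "\<delta> > 0" "\<forall>t. 0 < t \<and> t < \<delta> \<longrightarrow> x + t *\<^sub>R k \<in> U" using inside[OF x] by blast
      show ?thesis
      proof (rule directional_derivative_le[OF G(2)[OF x] \<delta>(1)])
        fix t assume "0 < t" "t < \<delta>"
        then show "u (x + t *\<^sub>R k) - u x \<le> t * gauge_fun K k"
          using u_lip[OF x, of "t *\<^sub>R k"] \<delta>(2) gauge_scale[OF K, of t k] by simp
      qed
    qed
    from gauge_polar_le_1[OF K this] show ?thesis by (simp add: H_fun_def)
  qed
  have contact: "H_fun K (G x) \<ge> 0" if x: "x \<in> U" and c: "u x = ?up x \<or> u x = - ?lo x" for x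
  proof -
    have xf: "x \<notin> frontier U" using x oU by (simp add: frontier_def interior_open)
    have "\<exists>k. k \<noteq> 0 \<and> gauge_fun K k \<le> G x \<bullet> k"
      using c
    proof
      assume ux: "u x = ?up x"
      obtain y where y: "y \<in> frontier U" "?up x = gauge_fun K (x - y) + \<phi> y" using upper_attained[OF K ob] by blast
      let ?k = "x - y"
      obtain \<delta> where \<delta>: "\<delta> > 0" "\<forall>t. 0 < t \<and> t < \<delta> \<longrightarrow> x + t *\<^sub>R (- ?k) \<in> U" using inside[OF x] by blast
      \<comment> \<open>Along the segment towards \<open>y\<close> the same \<open>y\<close> remains
        a competitor in the obstacle, with gauge scaled by \<open>1 - t\<close>. So \<open>u\<close>
        starts on the obstacle and falls at least at rate \<open>gauge_fun K ?k\<close>; the bound 1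
        on \<open>t\<close> keeps the scaling factor positive.\<close>
      have "G x \<bullet> (- ?k) \<le> - gauge_fun K ?k"
      proof (rule directional_derivative_le[OF G(2)[OF x], of "min \<delta> 1"])
        fix t assume t: "0 < t" "t < min \<delta> 1"
        then have "x + t *\<^sub>R (- ?k) \<in> closure U" using \<delta>(2) closure_subset by auto
        from ub(2)[OF this] have "u (x + t *\<^sub>R (- ?k)) \<le> gauge_fun K (x + t *\<^sub>R (- ?k) - y) + \<phi> y"
          using upper_le[OF K ob y(1)] order_trans by blast
        moreover have "x + t *\<^sub>R (- ?k) - y = (1 - t) *\<^sub>R ?k" by (simp add: algebra_simps)
        moreover have "gauge_fun K ((1 - t) *\<^sub>R ?k) = (1 - t) * gauge_fun K ?k"
          using t by (intro gauge_scale[OF K]) simp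
        ultimately show "u (x + t *\<^sub>R (- ?k)) - u x \<le> t * - gauge_fun K ?k"
          using ux y(2) by (simp add: algebra_simps)
      qed (use \<delta> in auto)
      then have "gauge_fun K ?k \<le> G x \<bullet> ?k"
        by (simp only: inner_minus_right inner_minus_left neg_le_iff_le)
      moreover have "?k \<noteq> 0" using y(1) xf by auto
      ultimately show ?thesis by blast
    next
      assume ux: "u x = - ?lo x"
      obtain y where y: "y \<in> frontier U" "?lo x = gauge_fun K (y - x) - \<phi> y" using lower_attained[OF K ob] by blast
      let ?k = "y - x"
      obtain \<delta> where \<delta>: "\<delta> > 0" "\<forall>t. 0 < t \<and> t < \<delta> \<longrightarrow> x + t *\<^sub>R ?k \<in> U" using inside[OF x] by blast
      \<comment> \<open>The same argument for \<open>- u\<close>, which starts on the lower obstacle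
        and stays below it.\<close>
      have "(- G x) \<bullet> ?k \<le> - gauge_fun K ?k"
      proof (rule directional_derivative_le[where u = "\<lambda>x. - u x" and x = x, of _ "min \<delta> 1"])
        show "((\<lambda>x. - u x) has_derivative (\<lambda>h. (- G x) \<bullet> h)) (at x)"
          using has_derivative_minus[OF G(2)[OF x]] by simp
        fix t assume t: "0 < t" "t < min \<delta> 1"
        then have "x + t *\<^sub>R ?k \<in> closure U" using \<delta>(2) closure_subset by auto
        from ub(1)[OF this] have "- u (x + t *\<^sub>R ?k) \<le> gauge_fun K (y - (x + t *\<^sub>R ?k)) - \<phi> y"
          using lower_le[OF K ob y(1), of "x + t *\<^sub>R ?k"] by linarith
        moreover have "y - (x + t *\<^sub>R ?k) = (1 - t) *\<^sub>R ?k" by (simp add: algebra_simps)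
        moreover have "gauge_fun K ((1 - t) *\<^sub>R ?k) = (1 - t) * gauge_fun K ?k"
          using t by (intro gauge_scale[OF K]) simp
        ultimately show "- u (x + t *\<^sub>R ?k) - - u x \<le> t * - gauge_fun K ?k"
          using ux y(2) by (simp add: algebra_simps)
      qed (use \<delta> in auto)
      then have "gauge_fun K ?k \<le> G x \<bullet> ?k"
        by (simp only: inner_minus_right inner_minus_left neg_le_iff_le)
      moreover have "?k \<noteq> 0" using y(1) xf by auto
      ultimately show ?thesis by blast
    qed
    then obtain k where "k \<noteq> 0" "gauge_fun K k \<le> G x \<bullet> k" by blast
    from gauge_polar_ge_1[OF K this] show ?thesis by (simp add: H_fun_def)
  qed
  have GU: "continuous_on U G" by (rule continuous_on_subset[OF G(1) closure_subset])
  \<comment> \<open>The pointwise bounds concern the classical gradient \<open>G\<close>; uniqueness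
    of weak derivatives transfers them to \<open>weak_grad\<close>.\<close>
  have "AE x in lebesgue_on U. weak_grad U u x $ i = G x $ i" for i
    by (rule weak_deriv_unique[OF oU _ classical_has_weak_deriv[OF oU G(2) GU]])
      (use jet_u in \<open>simp add: W2_jet_def\<close>)
  then have grad: "AE x in lebesgue_on U. \<forall>i\<in>UNIV. weak_grad U u x $ i = G x $ i"
    by (intro AE_finite_allI) auto
  have "AE x in lebesgue_on U. max (op_apply F U u x) (H_fun K (weak_grad U u x)) = 0"
    using grad F_le solves(1) AE_space
  proof eventually_elim
    case (elim x)
    then have xU: "x \<in> U" and xc: "x \<in> closure U" using closure_subset by (auto simp: space_restrict_space)
    have "weak_grad U u x = G x" using elim(1) by (simp add: vec_eq_iff)
    \<comment> \<open>Both entries of the maximum are at most 0. Off the contact sets the first is 0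
      by the equation; on them the second is 0.\<close>
    then show ?case
      using G_le[OF xU] contact[OF xU] elim(2,3) ub(1)[OF xc] ub(2)[OF xc] by (auto simp: max_def less_le)
  qed
  then show ?thesis
    using boundary[OF uc assms(14)] by blast
qed

end
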